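(* Let $1<p<q$, $2\le q<\infty$, and $0<s=n\left(\frac1p-\frac1q\right)<1$. Then $\mathcal R_{s,q}$ is of weak type $(p,p)$: there is $C$ depending only on fixed parameters such that for every $\alpha>0$ and $f\in L^p(\mathbb R^n)$, $$\mathcal L^n(\{x\in\mathbb R^n:\mathcal R_{s,q}(f)(x)>\alpha\})\le C\alpha^{-p}\|f\|_{L^p(\mathbb R^n)}^p.$$
   Context: $P_t(x)=C_0t(t^2+|x|^2)^{-\frac{n+1}{2}}$, $C_0=\Gamma(\frac{n+1}{2})\pi^{-\frac{n+1}{2}}$, $\mathscr P(f;x,t)=f*P_t(x)$, $\partial_{n+1}=\partial/\partial t$. $\mathcal R_{s,q}(f)(x)=\left(\int_{\mathbb R^n}\frac{1}{|x-y|^{n+sq}}\left(\int_0^{2|x-y|}|\partial_{n+1}\mathscr P(f;y,t)|t^s\,dt\right)^q dy\right)^{1/q}$. *)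

theory Defs
  imports "HOL-Analysis.Analysis"
begin

text \<open>Power of an extended nonnegative real with a positive real exponent
  (infinity stays infinity).\<close>
definition enn_powr :: "ennreal \<Rightarrow> real \<Rightarrow> ennreal" where
  "enn_powr a r = (if a = \<infinity> then \<infinity> else ennreal (enn2real a powr r))"

definition poisson_const :: "nat \<Rightarrow> real" where
  "poisson_const n = Gamma ((real n + 1) / 2) * pi powr (- (real n + 1) / 2)"

definition poisson_kernel :: "real \<Rightarrow> 'a::euclidean_space \<Rightarrow> real" where
  "poisson_kernel t x =
     poisson_const DIM('a) * t * (t\<^sup>2 + (norm x)\<^sup>2) powr (- (real DIM('a) + 1) / 2)"

definition poisson_integral :: "('a::euclidean_space \<Rightarrow> real) \<Rightarrow> 'a \<Rightarrow> real \<Rightarrow> real" where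
  "poisson_integral f x t = (\<integral> y. f y * poisson_kernel t (x - y) \<partial>lebesgue)"

definition R_op :: "real \<Rightarrow> real \<Rightarrow> ('a::euclidean_space \<Rightarrow> real) \<Rightarrow> 'a \<Rightarrow> ennreal" where
  "R_op s q f x = enn_powr
     (\<integral>\<^sup>+ y. ennreal (1 / norm (x - y) powr (real DIM('a) + s * q)) *
        enn_powr (\<integral>\<^sup>+ t\<in>{0<..<2 * norm (x - y)}.
                     ennreal (\<bar>deriv (\<lambda>\<tau>. poisson_integral f y \<tau>) t\<bar> * t powr s) \<partial>lborel) q
      \<partial>lebesgue) (1 / q)"

definition lebesgue_outer :: "'a::euclidean_space set \<Rightarrow> ennreal" where
  "lebesgue_outer A = (INF B\<in>{B \<in> sets lebesgue. A \<subseteq> B}. emeasure lebesgue B)"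

end

theory Submission
  imports Defs
begin

text \<open>
  Let \<open>u\<close> be the Poisson extension of \<open>f\<close> and \<open>\<Omega>\<close> an open set of measure at most
  \<open>C \<alpha>\<^bsup>-p\<^esup> \<parallel>f\<parallel>\<^sub>p\<^sup>p\<close> off which \<open>\<bar>f\<bar> \<le> \<alpha>\<close> and all averages of \<open>\<bar>f\<bar>\<^sup>p\<close> over balls are at most \<open>\<alpha>\<^sup>p\<close>;
  let \<open>E\<close> be its complement and \<open>d(y)\<close> the distance from \<open>y\<close> to \<open>E\<close>. Integrating the \<open>q\<close>-th power of
  the operator over \<open>E\<close>, Tonelli, polar coordinates and Hardy's inequality leave two terms.

  In \<open>\<integral> d(y)\<^bsup>-sq\<^esup> (\<integral>\<^sub>0\<^bsup>d(y)\<^esup> \<bar>\<partial>\<^sub>t u\<bar> t\<^sup>s dt)\<^sup>q dy\<close> the derivative is bounded both by \<open>M f(y) / t\<close> and, since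
  balls around \<open>y\<close> of radius greater than \<open>d(y)\<close> meet \<open>E\<close>, by \<open>\<alpha> d(y)\<^bsup>n/p\<^esup> t\<^bsup>-1-n/p\<^esup>\<close>. Splitting the
  \<open>t\<close>-integral where the two bounds agree (Hedberg) gives the bound \<open>C \<alpha>\<^bsup>q-p\<^esup> max(M f, \<alpha>)\<^sup>p\<close>, and the maximal
  function is bounded on \<open>L\<^sup>p\<close>.

  In \<open>\<integral>\<integral>\<^bsub>t \<ge> d(y)\<^esub> \<bar>t \<partial>\<^sub>t u\<bar>\<^sup>q dt/t dy\<close> the function \<open>f\<close> is replaced by a function \<open>g\<close> with
  \<open>\<bar>g\<bar> \<le> C \<alpha>\<close>, obtained by spreading the mass of \<open>f\<close> at each \<open>w \<in> \<Omega>\<close> uniformly over the ball of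
  radius \<open>d(w)/4\<close>. The error is small because the kernel varies slowly on that ball when \<open>t \<ge> d(y)\<close>. For \<open>g\<close>
  one uses that \<open>g \<mapsto> t \<partial>\<^sub>t u\<close> maps \<open>L\<^sup>q\<close> to \<open>L\<^sup>q(dy dt/t)\<close> for \<open>q \<ge> 2\<close>: this is trivial
  for \<open>q = \<infinity>\<close>, follows for \<open>q = 2\<close> from Schur's test for \<open>T T\<^sup>*\<close> (the kernel of \<open>t \<partial>\<^sub>t\<close> has
  integral zero), and is interpolated in between.
\<close>

section \<open>Powers and radial integrals\<close>

text \<open>Only an L^q estimate over \<open>E\<close> is proved; Chebyshev's inequality with
  exponent q turns the bound K \<alpha>^(q-p) ||f||_p^p into K \<alpha>^(-p) ||f||_p^p. Restricting
  x to \<open>E\<close> helps because then |x - y| \<ge> d(y), so integrating |x - y|^(-n-sq) in x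
  costs only d(y)^(-sq). The relation s = n/p - n/q balances this weight: the splitting of the
  t-integral returns exactly d(y)^s, and all powers of d(y) cancel. A function g bounded by C
  \<alpha> has what f lacks: its L^q norm to the power q is at most C \<alpha>^(q-p) ||f||_p^p. The
  radius of spreading must serve two purposes. It is comparable to d(w), so that g is controlled by
  averages of f over balls that meet \<open>E\<close>; and it is a small fraction of d(w), hence of
  t + |y - w| when t \<ge> d(y), so that the kernel hardly changes over the ball. The error is then
  bounded by C \<alpha> everywhere and is integrable, which suffices for its q-th power.\<close>

lemma nn_integral_powr_atLeast:
  fixes a b :: real
  assumes "0 < a" "0 < b"
  shows "(\<integral>\<^sup>+r. ennreal (r powr (- b - 1)) * indicator {a..} r \<partial>lborel) = ennreal (a powr (- b) / b)"
proof -
  have "((\<lambda>x. x powr (- b - 1)) has_integral a powr (- b) / b) {a..}"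
    using has_integral_powr_to_inf[of "- b - 1" a] assms by (simp add: field_simps)
  then show ?thesis
    by (intro nn_integral_has_integral_lebesgue') auto
qed

lemma nn_integral_powr_atMost:
  fixes a b :: real
  assumes "0 \<le> a" "0 < b"
  shows "(\<integral>\<^sup>+r. ennreal (r powr (b - 1)) * indicator {0..a} r \<partial>lborel) = ennreal (a powr b / b)"
proof -
  have "((\<lambda>x. x powr (b - 1)) has_integral a powr b / b) {0..a}"
    using has_integral_powr_from_0[of "b - 1" a] assms by (simp add: field_simps)
  then show ?thesis
    by (intro nn_integral_has_integral_lebesgue') auto
qed

section \<open>Powers of extended nonnegative numbers\<close>

lemma enn_powr_ennreal: "0 \<le> x \<Longrightarrow> enn_powr (ennreal x) r = ennreal (x powr r)"
  by (simp add: enn_powr_def)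

lemma enn_powr_top [simp]: "enn_powr top r = top"
  by (simp add: enn_powr_def)

lemma enn_powr_0 [simp]: "enn_powr 0 r = 0"
  by (simp add: enn_powr_def)

lemma enn_powr_mono:
  assumes "a \<le> b" "0 \<le> r"
  shows "enn_powr a r \<le> enn_powr b r"
proof (cases b)
  case (real y)
  then obtain x where "a = ennreal x" "0 \<le> x"
    using assms by (cases a) (auto simp: top_unique)
  then show ?thesis
    using real assms by (auto simp: enn_powr_ennreal intro!: ennreal_leI powr_mono2)
qed simp

lemma enn_powr_add_le:
  assumes "0 \<le> r"
  shows "enn_powr (a + b) r \<le> ennreal (2 powr r) * (enn_powr a r + enn_powr b r)"
proof (cases a; cases b)
  fix x y assume xy: "a = ennreal x" "0 \<le> x" "b = ennreal y" "0 \<le> y"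
  have "(x + y) powr r \<le> (2 * max x y) powr r"
    using xy assms by (intro powr_mono2) auto
  also have "\<dots> = 2 powr r * (max x y) powr r"
    using xy by (simp add: powr_mult)
  also have "\<dots> \<le> 2 powr r * (x powr r + y powr r)"
    by (intro mult_left_mono) (auto simp: max_def)
  finally show ?thesis
    using xy by (simp add: enn_powr_ennreal flip: ennreal_plus ennreal_mult'')
qed (auto simp: ennreal_mult_top)

text \<open>Raising to the power q removes the outer root of \<open>R_op\<close>, so that its
  superlevel sets become those of the double integral inside.\<close>

lemma enn_powr_less_iff:
  assumes "0 < q" "0 < \<alpha>"
  shows "ennreal \<alpha> < enn_powr a (1 / q) \<longleftrightarrow> ennreal (\<alpha> powr q) < a"
proof (cases a)
  case (real x)
  have "\<alpha> < x powr (1 / q) \<longleftrightarrow> \<alpha> powr q < x"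
  proof
    assume "\<alpha> < x powr (1 / q)"
    then have "\<alpha> powr q < (x powr (1 / q)) powr q"
      using assms by (intro powr_less_mono2) auto
    then show "\<alpha> powr q < x"
      using assms real by (simp add: powr_powr)
  next
    assume "\<alpha> powr q < x"
    then have "(\<alpha> powr q) powr (1 / q) < x powr (1 / q)"
      using assms by (intro powr_less_mono2) auto
    then show "\<alpha> < x powr (1 / q)"
      using assms real by (simp add: powr_powr)
  qed
  then show ?thesis
    using real assms by (auto simp: enn_powr_ennreal ennreal_less_iff)
qed auto

lemma enn_powr_measurable [measurable]:
  assumes [measurable]: "f \<in> borel_measurable M"
  shows "(\<lambda>x. enn_powr (f x) r) \<in> borel_measurable M"
  unfolding enn_powr_def by measurable

text \<open>Layer cake formula: q l^(q-1) is the derivative of l^q. The infinite value has to be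
  covered as well, since the formula is applied to the maximal function.\<close>

lemma enn_powr_eq_nn_integral:
  assumes "0 < q"
  shows "enn_powr a q = (\<integral>\<^sup>+l. ennreal (q * l powr (q - 1)) * indicator {0<..} l *
           (if ennreal l < a then 1 else 0) \<partial>lborel)"
proof (cases a)
  case (real x)
  have "(\<integral>\<^sup>+l. ennreal (q * l powr (q - 1)) * indicator {0<..} l * (if ennreal l < a then 1 else 0) \<partial>lborel)
      = (\<integral>\<^sup>+l. ennreal q * (ennreal (l powr (q - 1)) * indicator {0..x} l) \<partial>lborel)"
  proof (intro nn_integral_cong_AE)
    \<comment> \<open>The strict condition on l and the closed interval can disagree only at the
      endpoints.\<close>
    have "AE l in lborel. l \<noteq> x \<and> l \<noteq> 0"
      using AE_lborel_singleton[of x] AE_lborel_singleton[of 0] by auto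
    then show "AE l in lborel. ennreal (q * l powr (q - 1)) * indicator {0<..} l * (if ennreal l < a then 1 else 0)
        = ennreal q * (ennreal (l powr (q - 1)) * indicator {0..x} l)"
    proof eventually_elim
      case (elim l)
      show ?case
      proof (cases "0 < l")
        case True
        then have "(ennreal l < a) = (l \<le> x)"
          using real elim by (auto simp: ennreal_less_iff)
        then show ?thesis
          using True assms by (simp add: indicator_def ennreal_mult)
      qed (use elim in \<open>auto simp: indicator_def\<close>)
    qed
  qed
  also have "\<dots> = ennreal q * ennreal (x powr q / q)"
    using nn_integral_powr_atMost[of x q] real assms by (subst nn_integral_cmult) auto
  also have "\<dots> = ennreal (x powr q)"
    using assms by (simp flip: ennreal_mult'')
  finally show ?thesis
    using real by (simp add: enn_powr_ennreal)
next
  case top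
  \<comment> \<open>Cutting the integral off at k already produces k^q; as k is arbitrary, the full
    integral exceeds every real number.\<close>
  have "ennreal (k powr q) \<le> (\<integral>\<^sup>+l. ennreal (q * l powr (q - 1)) * indicator {0<..} l \<partial>lborel)" if "0 \<le> k" for k
  proof -
    have "ennreal (k powr q) = ennreal q * ennreal (k powr q / q)"
      using assms by (simp flip: ennreal_mult'')
    also have "\<dots> = (\<integral>\<^sup>+l. ennreal q * (ennreal (l powr (q - 1)) * indicator {0..k} l) \<partial>lborel)"
      using nn_integral_powr_atMost[of k q] that assms by (subst nn_integral_cmult) auto
    also have "\<dots> \<le> (\<integral>\<^sup>+l. ennreal (q * l powr (q - 1)) * indicator {0<..} l \<partial>lborel)"
    proof (intro nn_integral_mono_AE)
      show "AE l in lborel. ennreal q * (ennreal (l powr (q - 1)) * indicator {0..k} l)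
         \<le> ennreal (q * l powr (q - 1)) * indicator {0<..} l"
        using AE_lborel_singleton[of "0::real"]
        by eventually_elim (use assms in \<open>auto simp: indicator_def ennreal_mult\<close>)
    qed
    finally show ?thesis .
  qed
  note * = this
  have "ennreal x \<le> (\<integral>\<^sup>+l. ennreal (q * l powr (q - 1)) * indicator {0<..} l \<partial>lborel)" if "0 \<le> x" for x
    using *[of "x powr (1/q)"] that assms by (simp add: powr_powr)
  note ** = this
  have "(\<integral>\<^sup>+l. ennreal (q * l powr (q - 1)) * indicator {0<..} l \<partial>lborel) = top" (is "?I = _")
  proof (cases ?I)
    case (real y)
    then show ?thesis
      using **[of "y + 1"] by simp
  qed
  then show ?thesis
    using top by simp
qed

text \<open>Polar coordinates without a measure on the sphere: on the half-line up to a both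
  measures give the volume of the ball of radius a, and half-lines generate the Borel sets.\<close>

lemma distr_norm_lborel:
  "distr (lborel :: 'a::euclidean_space measure) borel norm =
   density lborel (\<lambda>r. ennreal (real DIM('a) * unit_ball_vol (real DIM('a)) * r ^ (DIM('a) - 1)) * indicator {0..} r)"
    (is "?M = ?N")
proof (rule measure_eqI_generator_eq[where E = "range (\<lambda>a. {..a})" and \<Omega> = UNIV and A = "\<lambda>i::nat. {..real i}"])
  let ?c = "unit_ball_vol (real DIM('a))"
  show "Int_stable (range (\<lambda>a::real. {..a}))"
    by (auto simp: Int_stable_def)
  have M: "emeasure ?M {..a} = ennreal (if a < 0 then 0 else ?c * a ^ DIM('a))" for a
  proof -
    have "emeasure ?M {..a} = emeasure lborel (cball (0::'a) a)"
      by (subst emeasure_distr) (auto simp: vimage_def cball_def)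
    then show ?thesis
      by (auto simp: emeasure_cball)
  qed
  have N: "emeasure ?N {..a} = ennreal (if a < 0 then 0 else ?c * a ^ DIM('a))" for a
  proof -
    have "emeasure ?N {..a} = (\<integral>\<^sup>+r. ennreal (real DIM('a) * ?c * r ^ (DIM('a) - 1)) * indicator {0..a} r \<partial>lborel)"
      by (subst emeasure_density) (auto intro!: nn_integral_cong simp: indicator_def)
    also have "\<dots> = ennreal (if a < 0 then 0 else ?c * a ^ DIM('a))"
    proof (cases "a < 0")
      case False
      have "(\<integral>\<^sup>+r. ennreal (real DIM('a) * ?c * r ^ (DIM('a) - 1)) * indicator {0..a} r \<partial>lborel)
          = ennreal (?c * a ^ DIM('a)) - ennreal (?c * 0 ^ DIM('a))"
        using False
        by (subst nn_integral_FTC_Icc[where F = "\<lambda>r. ?c * r ^ DIM('a)"])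
          (auto intro!: derivative_eq_intros mult_nonneg_nonneg simp: ennreal_minus)
      then show ?thesis
        using False by (simp add: power_0_left)
    qed (auto simp: indicator_def)
    finally show ?thesis .
  qed
  show "emeasure ?M X = emeasure ?N X" if "X \<in> range (\<lambda>a. {..a})" for X
    using that M N by auto
  show "sets ?M = sigma_sets UNIV (range (\<lambda>a::real. {..a}))"
    "sets ?N = sigma_sets UNIV (range (\<lambda>a::real. {..a}))"
    by (simp_all add: borel_eq_atMost)
  show "(\<Union>i::nat. {..real i}) = UNIV"
    using real_arch_simple by auto
  show "emeasure ?M {..real i} \<noteq> \<infinity>" for i
    by (simp add: M)
qed auto

lemma nn_integral_norm:
  fixes \<phi> :: "real \<Rightarrow> ennreal"
  assumes [measurable]: "\<phi> \<in> borel_measurable borel"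
  shows "(\<integral>\<^sup>+x. \<phi> (norm (x::'a::euclidean_space)) \<partial>lborel) =
    (\<integral>\<^sup>+r. ennreal (real DIM('a) * unit_ball_vol (real DIM('a)) * r powr (real DIM('a) - 1)) *
        indicator {0<..} r * \<phi> r \<partial>lborel)"
proof -
  have "(\<integral>\<^sup>+x. \<phi> (norm (x::'a)) \<partial>lborel) = (\<integral>\<^sup>+r. \<phi> r \<partial>distr (lborel :: 'a measure) borel norm)"
    by (subst nn_integral_distr) auto
  also have "\<dots> = (\<integral>\<^sup>+r. (ennreal (real DIM('a) * unit_ball_vol (real DIM('a)) * r ^ (DIM('a) - 1)) * indicator {0..} r) * \<phi> r \<partial>lborel)"
    unfolding distr_norm_lborel by (subst nn_integral_density) auto
  also have "\<dots> = (\<integral>\<^sup>+r. ennreal (real DIM('a) * unit_ball_vol (real DIM('a)) * r powr (real DIM('a) - 1)) *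
        indicator {0<..} r * \<phi> r \<partial>lborel)"
  proof (intro nn_integral_cong_AE)
    have 1: "real DIM('a) - 1 = real (DIM('a) - 1)"
      using DIM_positive[where 'a='a] by (simp add: of_nat_diff)
    have 2: "r powr (real DIM('a) - 1) = r ^ (DIM('a) - 1)" if "0 < r" for r :: real
      using that unfolding 1 by (rule powr_realpow)
    show "AE r in lborel. (ennreal (real DIM('a) * unit_ball_vol (real DIM('a)) * r ^ (DIM('a) - 1)) * indicator {0..} r) * \<phi> r
      = ennreal (real DIM('a) * unit_ball_vol (real DIM('a)) * r powr (real DIM('a) - 1)) * indicator {0<..} r * \<phi> r"
      using AE_lborel_singleton[of "0::real"]
      by eventually_elim (auto simp: indicator_def 2)
  qed
  finally show ?thesis .
qed

text \<open>The tangent to x^q at m lies below the graph; this is Young's inequality for h and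
  m^(q-1).\<close>

lemma Young_powr:
  fixes h m q :: real
  assumes "1 < q" "0 \<le> h" "0 \<le> m"
  shows "q * m powr (q - 1) * h \<le> h powr q + (q - 1) * m powr q"
proof -
  have "h * m powr (q - 1) \<le> h powr q / q + (m powr (q - 1)) powr (q / (q - 1)) / (q / (q - 1))"
    using assms by (intro Youngs_inequality) (auto simp: field_simps)
  also have "(m powr (q - 1)) powr (q / (q - 1)) = m powr q"
    using assms by (simp add: powr_powr)
  finally show ?thesis
    using assms by (simp add: field_simps)
qed

text \<open>Integrate the tangent inequality at m against w and optimise in m. It takes the place of
  Holder's inequality in \<open>nn_integral_Hardy_tail\<close> and \<open>potential_le_near\<close>,
  where the total mass of the weight is known only through an upper bound A.\<close>

lemma nn_integral_Jensen_powr: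
  fixes q A :: real and w h :: "'b \<Rightarrow> ennreal"
  assumes q: "1 < q" and A: "0 \<le> A"
    and [measurable]: "w \<in> borel_measurable M" "h \<in> borel_measurable M"
    and W: "(\<integral>\<^sup>+x. w x \<partial>M) \<le> ennreal A"
  shows "enn_powr (\<integral>\<^sup>+x. w x * h x \<partial>M) q \<le> ennreal (A powr (q - 1)) * (\<integral>\<^sup>+x. w x * enn_powr (h x) q \<partial>M)"
proof (cases "A = 0")
  case True
  then have "(\<integral>\<^sup>+x. w x \<partial>M) = 0"
    using W by simp
  then have "AE x in M. w x = 0"
    by (subst (asm) nn_integral_0_iff_AE) auto
  then have "(\<integral>\<^sup>+x. w x * h x \<partial>M) = 0"
    by (subst nn_integral_0_iff_AE) (auto elim: eventually_mono)
  then show ?thesis by simp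
next
  case False
  then have A: "0 < A" using A by simp
  let ?I = "\<integral>\<^sup>+x. w x * h x \<partial>M" and ?J = "\<integral>\<^sup>+x. w x * enn_powr (h x) q \<partial>M"
  have key: "ennreal (q * m powr (q - 1)) * ?I \<le> ?J + ennreal ((q - 1) * m powr q * A)" if "0 \<le> m" for m
  proof -
    have pt: "ennreal (q * m powr (q - 1)) * h x \<le> enn_powr (h x) q + ennreal ((q - 1) * m powr q)" for x
    proof (cases "h x")
      case (real y)
      then show ?thesis
        using Young_powr[of q y m] that q
        by (simp add: enn_powr_ennreal flip: ennreal_mult'' ennreal_plus)
    qed simp
    have "ennreal (q * m powr (q - 1)) * ?I = (\<integral>\<^sup>+x. w x * (ennreal (q * m powr (q - 1)) * h x) \<partial>M)"
      by (subst nn_integral_cmult[symmetric]) (auto simp: ac_simps)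
    also have "\<dots> \<le> (\<integral>\<^sup>+x. w x * (enn_powr (h x) q + ennreal ((q - 1) * m powr q)) \<partial>M)"
      by (intro nn_integral_mono mult_left_mono pt) auto
    also have "\<dots> = ?J + ennreal ((q - 1) * m powr q) * (\<integral>\<^sup>+x. w x \<partial>M)"
      by (simp add: distrib_left nn_integral_add nn_integral_multc mult.commute)
    also have "\<dots> \<le> ?J + ennreal ((q - 1) * m powr q) * ennreal A"
      by (intro add_left_mono mult_left_mono W) auto
    also have "ennreal ((q - 1) * m powr q) * ennreal A = ennreal ((q - 1) * m powr q * A)"
      using A by (simp flip: ennreal_mult'')
    finally show ?thesis .
  qed
  show ?thesis
  proof (cases ?J)
    case (real j)
    \<comment> \<open>The choice m = 1 shows that \<open>?I\<close> is finite. Only then is the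
      optimal m, the mean i / A, a real number.\<close>
    have "ennreal q * ?I \<le> ennreal (j + (q - 1) * A)"
      using key[of 1] real q A by (simp add: ennreal_plus)
    then have "?I \<noteq> top"
      using q by (auto simp: ennreal_mult_top top_unique)
    then obtain i where i: "?I = ennreal i" "0 \<le> i"
      by (cases ?I) auto
    have "ennreal (q * (i / A) powr (q - 1) * i) \<le> ennreal (j + (q - 1) * (i / A) powr q * A)"
      using key[of "i / A"] i real q A
      by (simp add: ennreal_plus ennreal_mult'')
    then have "q * (i / A) powr (q - 1) * i \<le> j + (q - 1) * (i / A) powr q * A"
      using real q A i by (subst (asm) ennreal_le_iff) auto
    moreover have "(i / A) powr (q - 1) * i = i powr q / A powr (q - 1)"
      using i A q by (cases "i = 0") (auto simp: powr_divide powr_diff field_simps)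
    moreover have "(i / A) powr q * A = i powr q / A powr (q - 1)"
      using i A q by (auto simp: powr_divide powr_diff field_simps)
    ultimately have "q * (i powr q / A powr (q - 1)) \<le> j + (q - 1) * (i powr q / A powr (q - 1))"
      by (simp only: mult.assoc)
    then have "i powr q / A powr (q - 1) \<le> j"
      by (simp only: left_diff_distrib)
    then have "i powr q \<le> A powr (q - 1) * j"
      using A by (simp add: field_simps)
    then show ?thesis
      using i real A by (simp add: enn_powr_ennreal flip: ennreal_mult'')
  qed (use A in \<open>auto simp: ennreal_mult_top\<close>)
qed

section \<open>Hardy's inequality, interpolation and the maximal function\<close>

text \<open>Jensen's inequality is applied with the weight t^(s/2-1), integrable at 0, which has
  mass (2r)^(s/2) / (s/2) on (0, 2r). The remaining power of r is -1 - s(q+1)/2, so after Tonelli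
  the integral over r > t/2 converges and leaves t^(q-1). The two factors of \<open>C\<close> come
  from these two steps. The cut-off at d passes through unchanged.\<close>

lemma nn_integral_Hardy_tail:
  fixes v :: "real \<Rightarrow> real"
  assumes s: "0 < s" and q: "1 < q" and [measurable]: "v \<in> borel_measurable borel" and v: "\<And>t. 0 \<le> v t"
  defines "C \<equiv> (2 / s * 2 powr (s / 2)) powr (q - 1) * (2 powr (s * (q + 1) / 2) / (s * (q + 1) / 2))"
  shows "(\<integral>\<^sup>+r. ennreal (r powr (- 1 - s * q)) * indicator {0<..} r *
            enn_powr (\<integral>\<^sup>+t. ennreal (v t * t powr s) * indicator {0<..<2 * r} t * indicator {d..} t \<partial>lborel) q \<partial>lborel)
       \<le> ennreal C * (\<integral>\<^sup>+t. ennreal (t powr (q - 1) * v t powr q) * indicator {0<..} t * indicator {d..} t \<partial>lborel)"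
proof -
  define H where "H = (\<lambda>t. ennreal (t powr ((s / 2 + 1) * q + s / 2 - 1) * v t powr q) * indicator {0<..} t * indicator {d..} t :: ennreal)"
  have [measurable]: "H \<in> borel_measurable borel"
    unfolding H_def by measurable
  define K where "K = (2 / s * 2 powr (s / 2)) powr (q - 1)"
  have K: "0 \<le> K"
    by (simp add: K_def)
  have 1: "enn_powr (\<integral>\<^sup>+t. ennreal (v t * t powr s) * indicator {0<..<2 * r} t * indicator {d..} t \<partial>lborel) q
     \<le> ennreal (K * r powr (s / 2 * (q - 1))) * (\<integral>\<^sup>+t. H t * (if t / 2 < r then 1 else 0) \<partial>lborel)" if r: "0 < r" for r
  proof -
    let ?w = "\<lambda>t. ennreal (t powr (s / 2 - 1)) * indicator {0<..<2 * r} t"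
    let ?h = "\<lambda>t. ennreal (v t * t powr (s / 2 + 1)) * indicator {d..} t"
    have "(\<integral>\<^sup>+t. ?w t \<partial>lborel) \<le> (\<integral>\<^sup>+t. ennreal (t powr (s / 2 - 1)) * indicator {0..2 * r} t \<partial>lborel)"
      by (intro nn_integral_mono) (auto simp: indicator_def)
    also have "\<dots> = ennreal ((2 * r) powr (s / 2) / (s / 2))"
      using r s by (intro nn_integral_powr_atMost) auto
    finally have W: "(\<integral>\<^sup>+t. ?w t \<partial>lborel) \<le> ennreal ((2 * r) powr (s / 2) / (s / 2))" .
    have e1: "(\<integral>\<^sup>+t. ennreal (v t * t powr s) * indicator {0<..<2 * r} t * indicator {d..} t \<partial>lborel)
      = (\<integral>\<^sup>+t. ?w t * ?h t \<partial>lborel)"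
    proof (intro nn_integral_cong)
      fix t :: real
      have "t powr s = t powr (s / 2 - 1) * t powr (s / 2 + 1)" if "0 < t"
        using that by (simp flip: powr_add)
      then show "ennreal (v t * t powr s) * indicator {0<..<2 * r} t * indicator {d..} t = ?w t * ?h t"
        using v[of t] by (auto simp: indicator_def ac_simps simp flip: ennreal_mult'')
    qed
    have e2: "((2 * r) powr (s / 2) / (s / 2)) powr (q - 1) = K * r powr (s / 2 * (q - 1))"
    proof -
      have "(2 * r) powr (s / 2) / (s / 2) = (2 / s * 2 powr (s / 2)) * r powr (s / 2)"
        using r by (simp add: powr_mult)
      then have "((2 * r) powr (s / 2) / (s / 2)) powr (q - 1) = ((2 / s * 2 powr (s / 2)) * r powr (s / 2)) powr (q - 1)"
        by (rule arg_cong)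
      also have "\<dots> = K * r powr (s / 2 * (q - 1))"
        using s unfolding K_def by (subst powr_mult) (auto simp: powr_powr)
      finally show ?thesis .
    qed
    have e3: "(\<integral>\<^sup>+t. ?w t * enn_powr (?h t) q \<partial>lborel) = (\<integral>\<^sup>+t. H t * (if t / 2 < r then 1 else 0) \<partial>lborel)"
    proof (intro nn_integral_cong)
      fix t :: real
      have "t powr ((s / 2 + 1) * q + s / 2 - 1) = t powr (s / 2 - 1) * (t powr (s / 2 + 1)) powr q" if "0 < t"
        using that by (simp add: powr_powr algebra_simps flip: powr_add)
      then show "?w t * enn_powr (?h t) q = H t * (if t / 2 < r then 1 else 0)"
        using v[of t] by (auto simp: indicator_def H_def ac_simps enn_powr_ennreal powr_mult simp flip: ennreal_mult'')
    qed
    have "enn_powr (\<integral>\<^sup>+t. ?w t * ?h t \<partial>lborel) q \<le> ennreal (((2 * r) powr (s / 2) / (s / 2)) powr (q - 1)) *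
         (\<integral>\<^sup>+t. ?w t * enn_powr (?h t) q \<partial>lborel)"
    proof (rule nn_integral_Jensen_powr[OF q _ _ _ W])
      show "0 \<le> (2 * r) powr (s / 2) / (s / 2)"
        using s by simp
    qed measurable
    then show ?thesis
      unfolding e1 e2 e3 .
  qed
  have "(\<integral>\<^sup>+r. ennreal (r powr (- 1 - s * q)) * indicator {0<..} r *
            enn_powr (\<integral>\<^sup>+t. ennreal (v t * t powr s) * indicator {0<..<2 * r} t * indicator {d..} t \<partial>lborel) q \<partial>lborel)
     \<le> (\<integral>\<^sup>+r. \<integral>\<^sup>+t. ennreal K * ennreal (r powr (- (s * (q + 1) / 2) - 1)) * indicator {0<..} r * (H t * (if t / 2 < r then 1 else 0)) \<partial>lborel \<partial>lborel)"
  proof (intro nn_integral_mono)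
    fix r :: real
    show "ennreal (r powr (- 1 - s * q)) * indicator {0<..} r *
            enn_powr (\<integral>\<^sup>+t. ennreal (v t * t powr s) * indicator {0<..<2 * r} t * indicator {d..} t \<partial>lborel) q
     \<le> (\<integral>\<^sup>+t. ennreal K * ennreal (r powr (- (s * (q + 1) / 2) - 1)) * indicator {0<..} r * (H t * (if t / 2 < r then 1 else 0)) \<partial>lborel)"
    proof (cases "0 < r")
      case True
      have "ennreal (r powr (- 1 - s * q)) * enn_powr (\<integral>\<^sup>+t. ennreal (v t * t powr s) * indicator {0<..<2 * r} t * indicator {d..} t \<partial>lborel) q
        \<le> ennreal (r powr (- 1 - s * q)) * (ennreal (K * r powr (s / 2 * (q - 1))) * (\<integral>\<^sup>+t. H t * (if t / 2 < r then 1 else 0) \<partial>lborel))"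
        by (intro mult_left_mono 1 True) auto
      also have "\<dots> = ennreal (K * (r powr (- 1 - s * q) * r powr (s / 2 * (q - 1)))) * (\<integral>\<^sup>+t. H t * (if t / 2 < r then 1 else 0) \<partial>lborel)"
        using K by (simp add: ennreal_mult'' ac_simps)
      also have "r powr (- 1 - s * q) * r powr (s / 2 * (q - 1)) = r powr (- (s * (q + 1) / 2) - 1)"
        unfolding powr_add[symmetric] by (rule arg_cong[where f = "\<lambda>e. r powr e"]) (simp add: field_simps)
      also have "ennreal (K * r powr (- (s * (q + 1) / 2) - 1)) * (\<integral>\<^sup>+t. H t * (if t / 2 < r then 1 else 0) \<partial>lborel)
        = (\<integral>\<^sup>+t. ennreal K * ennreal (r powr (- (s * (q + 1) / 2) - 1)) * (H t * (if t / 2 < r then 1 else 0)) \<partial>lborel)"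
        using K by (subst nn_integral_cmult) (auto simp: ennreal_mult'')
      finally show ?thesis
        using True by simp
    qed simp
  qed
  also have "\<dots> = (\<integral>\<^sup>+t. \<integral>\<^sup>+r. ennreal K * ennreal (r powr (- (s * (q + 1) / 2) - 1)) * indicator {0<..} r * (H t * (if t / 2 < r then 1 else 0)) \<partial>lborel \<partial>lborel)"
    by (intro lborel_pair.Fubini') measurable
  also have "\<dots> \<le> (\<integral>\<^sup>+t. ennreal C * (ennreal (t powr (q - 1) * v t powr q) * indicator {0<..} t * indicator {d..} t) \<partial>lborel)"
  proof (intro nn_integral_mono)
    fix t :: real
    show "(\<integral>\<^sup>+r. ennreal K * ennreal (r powr (- (s * (q + 1) / 2) - 1)) * indicator {0<..} r * (H t * (if t / 2 < r then 1 else 0)) \<partial>lborel)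
      \<le> ennreal C * (ennreal (t powr (q - 1) * v t powr q) * indicator {0<..} t * indicator {d..} t)"
    proof (cases "0 < t")
      case True
      have "(\<integral>\<^sup>+r. ennreal K * ennreal (r powr (- (s * (q + 1) / 2) - 1)) * indicator {0<..} r * (H t * (if t / 2 < r then 1 else 0)) \<partial>lborel)
       \<le> (\<integral>\<^sup>+r. (ennreal K * H t) * (ennreal (r powr (- (s * (q + 1) / 2) - 1)) * indicator {t/2..} r) \<partial>lborel)"
        by (intro nn_integral_mono) (auto simp: indicator_def ac_simps)
      also have "\<dots> = (ennreal K * H t) * ennreal ((t / 2) powr (- (s * (q + 1) / 2)) / (s * (q + 1) / 2))"
        using nn_integral_powr_atLeast[of "t/2" "s * (q + 1) / 2"] True s q
        by (subst nn_integral_cmult) auto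
      also have "(t / 2) powr (- (s * (q + 1) / 2)) = 2 powr (s * (q + 1) / 2) * t powr (- (s * (q + 1) / 2))"
        using True by (simp add: powr_divide powr_minus field_simps)
      also have "(ennreal K * H t) * ennreal (2 powr (s * (q + 1) / 2) * t powr (- (s * (q + 1) / 2)) / (s * (q + 1) / 2))
        = ennreal C * (ennreal (t powr (- (s * (q + 1) / 2))) * H t)"
      proof -
        let ?L = "2 powr (s * (q + 1) / 2) / (s * (q + 1) / 2)"
        have "2 powr (s * (q + 1) / 2) * t powr (- (s * (q + 1) / 2)) / (s * (q + 1) / 2) = ?L * t powr (- (s * (q + 1) / 2))"
          by simp
        then have "ennreal (2 powr (s * (q + 1) / 2) * t powr (- (s * (q + 1) / 2)) / (s * (q + 1) / 2))
          = ennreal ?L * ennreal (t powr (- (s * (q + 1) / 2)))"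
          by (metis ennreal_mult'' powr_ge_zero)
        moreover have "ennreal C = ennreal K * ennreal ?L"
          using s q by (simp only: C_def K_def) (rule ennreal_mult'', simp)
        ultimately show ?thesis by (simp only: ac_simps)
      qed
      also have "ennreal (t powr (- (s * (q + 1) / 2))) * H t
        = ennreal (t powr (- (s * (q + 1) / 2)) * t powr ((s / 2 + 1) * q + s / 2 - 1) * v t powr q) * indicator {0<..} t * indicator {d..} t"
        by (simp add: H_def ac_simps flip: ennreal_mult'')
      also have "t powr (- (s * (q + 1) / 2)) * t powr ((s / 2 + 1) * q + s / 2 - 1) = t powr (q - 1)"
        unfolding powr_add[symmetric] by (rule arg_cong[where f = "\<lambda>e. t powr e"]) (simp add: field_simps)
      finally show ?thesis .
    qed (simp add: H_def)
  qed
  also have "\<dots> = ennreal C * (\<integral>\<^sup>+t. ennreal (t powr (q - 1) * v t powr q) * indicator {0<..} t * indicator {d..} t \<partial>lborel)"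
    by (subst nn_integral_cmult) auto
  finally show ?thesis .
qed

text \<open>The usual truncation of f at a multiple of l is assumed to be done already:
  \<open>weak\<close> bounds the distribution function at l by the r-th power of f over the set
  where f > c l. The layer cake formula and Tonelli finish the argument, and r < q makes the
  integral over l < f/c converge at 0. It is used with r = 1 for the maximal function and with r = 2
  for the square function.\<close>

lemma nn_integral_Marcinkiewicz:
  fixes F :: "'b \<Rightarrow> ennreal" and f :: "'c \<Rightarrow> real"
  assumes "sigma_finite_measure M" "sigma_finite_measure N"
    and [measurable]: "F \<in> borel_measurable M" "f \<in> borel_measurable N"
    and f: "\<And>x. 0 \<le> f x" and r: "r < q" "0 < q" and c: "0 < c" and B: "0 \<le> B"
    and weak: "\<And>l. 0 < l \<Longrightarrow> emeasure M {x \<in> space M. ennreal l < F x} \<le>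
        ennreal (B * l powr (- r)) * (\<integral>\<^sup>+x. ennreal (f x powr r) * indicator {c * l<..} (f x) \<partial>N)"
  shows "(\<integral>\<^sup>+x. enn_powr (F x) q \<partial>M) \<le> ennreal (B * q / (q - r) * c powr (r - q)) * (\<integral>\<^sup>+x. ennreal (f x powr q) \<partial>N)"
proof -
  interpret M: sigma_finite_measure M by fact
  interpret N: sigma_finite_measure N by fact
  interpret PM: pair_sigma_finite M lborel ..
  interpret PN: pair_sigma_finite N lborel ..
  have "(\<integral>\<^sup>+x. enn_powr (F x) q \<partial>M)
      = (\<integral>\<^sup>+x. \<integral>\<^sup>+l. ennreal (q * l powr (q - 1)) * indicator {0<..} l * (if ennreal l < F x then 1 else 0) \<partial>lborel \<partial>M)"
    by (simp add: enn_powr_eq_nn_integral r)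
  also have "\<dots> = (\<integral>\<^sup>+l. \<integral>\<^sup>+x. ennreal (q * l powr (q - 1)) * indicator {0<..} l * (if ennreal l < F x then 1 else 0) \<partial>M \<partial>lborel)"
    by (intro PM.Fubini'[symmetric]) measurable
  also have "\<dots> \<le> (\<integral>\<^sup>+l. \<integral>\<^sup>+x. ennreal (B * q) * ennreal (l powr (q - r - 1)) * indicator {0<..} l *
       (ennreal (f x powr r) * (if c * l < f x then 1 else 0)) \<partial>N \<partial>lborel)"
  proof (intro nn_integral_mono)
    fix l :: real
    show "(\<integral>\<^sup>+x. ennreal (q * l powr (q - 1)) * indicator {0<..} l * (if ennreal l < F x then 1 else 0) \<partial>M)
      \<le> (\<integral>\<^sup>+x. ennreal (B * q) * ennreal (l powr (q - r - 1)) * indicator {0<..} l *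
       (ennreal (f x powr r) * (if c * l < f x then 1 else 0)) \<partial>N)"
    proof (cases "0 < l")
      case True
      have "(\<integral>\<^sup>+x. ennreal (q * l powr (q - 1)) * indicator {0<..} l * (if ennreal l < F x then 1 else 0) \<partial>M)
         = ennreal (q * l powr (q - 1)) * (\<integral>\<^sup>+x. (if ennreal l < F x then 1 else 0) \<partial>M)"
        using True by (subst nn_integral_cmult) auto
      also have "(\<integral>\<^sup>+x. (if ennreal l < F x then 1 else 0) \<partial>M) = (\<integral>\<^sup>+x. indicator {x \<in> space M. ennreal l < F x} x \<partial>M)"
        by (intro nn_integral_cong) (auto simp: indicator_def)
      also have "\<dots> = emeasure M {x \<in> space M. ennreal l < F x}"
        by (intro nn_integral_indicator) measurable
      also have "ennreal (q * l powr (q - 1)) * \<dots> \<le> ennreal (q * l powr (q - 1)) *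
          (ennreal (B * l powr (- r)) * (\<integral>\<^sup>+x. ennreal (f x powr r) * indicator {c * l<..} (f x) \<partial>N))"
        by (intro mult_left_mono weak True) auto
      also have "\<dots> = (ennreal (B * q * (l powr (q - 1) * l powr (- r)))) * (\<integral>\<^sup>+x. ennreal (f x powr r) * indicator {c * l<..} (f x) \<partial>N)"
        using B r by (simp add: ac_simps ennreal_mult'')
      also have "l powr (q - 1) * l powr (- r) = l powr (q - r - 1)"
        by (simp add: algebra_simps flip: powr_add)
      also have "ennreal (B * q * l powr (q - r - 1)) * (\<integral>\<^sup>+x. ennreal (f x powr r) * indicator {c * l<..} (f x) \<partial>N)
         = (\<integral>\<^sup>+x. ennreal (B * q) * ennreal (l powr (q - r - 1)) * indicator {0<..} l *
       (ennreal (f x powr r) * (if c * l < f x then 1 else 0)) \<partial>N)"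
        using True B r by (subst nn_integral_cmult[symmetric])
          (auto intro!: nn_integral_cong simp: indicator_def ennreal_mult'')
      finally show ?thesis .
    qed simp
  qed
  also have "\<dots> = (\<integral>\<^sup>+x. \<integral>\<^sup>+l. ennreal (B * q) * ennreal (l powr (q - r - 1)) * indicator {0<..} l *
       (ennreal (f x powr r) * (if c * l < f x then 1 else 0)) \<partial>lborel \<partial>N)"
    by (intro PN.Fubini') measurable
  also have "\<dots> \<le> (\<integral>\<^sup>+x. ennreal (B * q / (q - r) * c powr (r - q)) * ennreal (f x powr q) \<partial>N)"
  proof (intro nn_integral_mono)
    fix x
    have "(\<integral>\<^sup>+l. ennreal (B * q) * ennreal (l powr (q - r - 1)) * indicator {0<..} l *
       (ennreal (f x powr r) * (if c * l < f x then 1 else 0)) \<partial>lborel)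
      \<le> (\<integral>\<^sup>+l. ennreal (B * q * f x powr r) * (ennreal (l powr (q - r - 1)) * indicator {0..f x / c} l) \<partial>lborel)"
      using B r c by (intro nn_integral_mono) (auto simp: indicator_def ennreal_mult'' field_simps)
    also have "\<dots> = ennreal (B * q * f x powr r) * ennreal ((f x / c) powr (q - r) / (q - r))"
      using nn_integral_powr_atMost[of "f x / c" "q - r"] r f[of x] c by (subst nn_integral_cmult) auto
    also have "\<dots> = ennreal (B * q * f x powr r * ((f x / c) powr (q - r) / (q - r)))"
      using r by (intro ennreal_mult''[symmetric]) auto
    also have "B * q * f x powr r * ((f x / c) powr (q - r) / (q - r)) = B * q / (q - r) * c powr (r - q) * f x powr q"
    proof -
      have "f x powr r * f x powr (q - r) = f x powr q"
        by (simp flip: powr_add)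
      moreover have "(f x / c) powr (q - r) = f x powr (q - r) * c powr (r - q)"
        using f[of x] c powr_minus[of c "q - r"] by (simp add: powr_divide field_simps)
      ultimately show ?thesis by (simp add: mult_ac)
    qed
    also have "ennreal \<dots> = ennreal (B * q / (q - r) * c powr (r - q)) * ennreal (f x powr q)"
      by (intro ennreal_mult'') auto
    finally show "(\<integral>\<^sup>+l. ennreal (B * q) * ennreal (l powr (q - r - 1)) * indicator {0<..} l *
       (ennreal (f x powr r) * (if c * l < f x then 1 else 0)) \<partial>lborel)
        \<le> ennreal (B * q / (q - r) * c powr (r - q)) * ennreal (f x powr q)" .
  qed
  also have "\<dots> = ennreal (B * q / (q - r) * c powr (r - q)) * (\<integral>\<^sup>+x. ennreal (f x powr q) \<partial>N)"
    by (subst nn_integral_cmult) auto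
  finally show ?thesis .
qed

section \<open>The uncentred maximal function\<close>

lemma emeasure_Union_countable_le:
  assumes "countable C" "\<And>i. i \<in> C \<Longrightarrow> A i \<in> sets M"
  shows "emeasure M (\<Union>i\<in>C. A i) \<le> (\<integral>\<^sup>+i. emeasure M (A i) \<partial>count_space C)"
proof -
  have [measurable]: "(\<Union>i\<in>C. A i) \<in> sets M"
    using assms by (intro sets.countable_UN') auto
  have "emeasure M (\<Union>i\<in>C. A i) = (\<integral>\<^sup>+x. indicator (\<Union>i\<in>C. A i) x \<partial>M)"
    by simp
  also have "\<dots> \<le> (\<integral>\<^sup>+x. \<integral>\<^sup>+i. indicator (A i) x \<partial>count_space C \<partial>M)"
  proof (intro nn_integral_mono)
    fix x
    show "indicator (\<Union>i\<in>C. A i) x \<le> (\<integral>\<^sup>+i. indicator (A i) x \<partial>count_space C)"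
    proof (cases "\<exists>i\<in>C. x \<in> A i")
      case True
      then obtain i where "i \<in> C" "x \<in> A i" by auto
      then have "(1::ennreal) = (\<integral>\<^sup>+j. indicator {i} j \<partial>count_space C)"
        by (subst nn_integral_indicator) auto
      also have "\<dots> \<le> (\<integral>\<^sup>+i. indicator (A i) x \<partial>count_space C)"
        using \<open>x \<in> A i\<close> by (intro nn_integral_mono) (auto simp: indicator_def)
      finally show ?thesis
        by (auto simp: indicator_def)
    qed (auto simp: indicator_def)
  qed
  also have "\<dots> = (\<integral>\<^sup>+i. \<integral>\<^sup>+x. indicator (A i) x \<partial>M \<partial>count_space C)"
    using assms by (intro nn_integral_count_space_nn_integral) auto
  also have "\<dots> = (\<integral>\<^sup>+i. emeasure M (A i) \<partial>count_space C)"
    using assms by (intro nn_integral_cong) auto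
  finally show ?thesis .
qed

lemma ball_in_sets_borel [measurable]: "ball c r \<in> sets borel"
  by simp

text \<open>The weak type (1,1) inequality by Vitali covering: disjoint balls are selected whose
  fivefold enlargements cover the union, and each selected ball carries h-mass greater than l times
  its volume. Speaking of the union of the balls makes the set open, and the same form serves for
  the exceptional set.\<close>

lemma emeasure_large_average_balls_le:
  fixes h :: "'a::euclidean_space \<Rightarrow> ennreal"
  assumes [measurable]: "h \<in> borel_measurable borel" and l: "0 < l"
  shows "emeasure lborel (\<Union>{ball c r |c r. 0 < r \<and> ennreal l * emeasure lborel (ball c r) < (\<integral>\<^sup>+z\<in>ball c r. h z \<partial>lborel)})
    \<le> ennreal (5 ^ DIM('a) / l) * (\<integral>\<^sup>+z. h z \<partial>lborel)"
proof (cases "\<integral>\<^sup>+z. h z \<partial>lborel")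
  case top
  then show ?thesis
    using l by (simp add: ennreal_mult_top)
next
  case (real I)
  define K where "K = {(c, r). 0 < r \<and> ennreal l * emeasure lborel (ball c r) < (\<integral>\<^sup>+z\<in>ball (c::'a) r. h z \<partial>lborel)}"
  let ?w = "unit_ball_vol (real DIM('a))"
  \<comment> \<open>The covering lemma needs bounded radii. Each ball has l times its volume below
    the total mass \<open>I\<close>, which bounds r^n, and r \<le> r^n once r \<ge> 1.\<close>
  have bound: "0 < snd i \<and> snd i \<le> 1 + I / (l * ?w)" if "i \<in> K" for i
  proof -
    obtain c r where i: "i = (c, r)" by (cases i)
    have r: "0 < r" and "ennreal l * emeasure lborel (ball c r) < (\<integral>\<^sup>+z\<in>ball c r. h z \<partial>lborel)"
      using that by (auto simp: K_def i)
    note this(2)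
    also have "(\<integral>\<^sup>+z\<in>ball c r. h z \<partial>lborel) \<le> (\<integral>\<^sup>+z. h z \<partial>lborel)"
      by (intro nn_integral_mono) (auto simp: indicator_def)
    finally have "ennreal (l * (?w * r ^ DIM('a))) < ennreal I"
      using r l real by (simp add: emeasure_ball ennreal_mult'')
    then have "l * (?w * r ^ DIM('a)) < I"
      using r l by (subst (asm) ennreal_less_iff) auto
    then have *: "r ^ DIM('a) < I / (l * ?w)"
      using l by (simp add: field_simps)
    have "r \<le> 1 + I / (l * ?w)"
    proof (cases "r \<le> 1")
      case True
      have "0 \<le> I / (l * ?w)" using real l by simp
      then show ?thesis using True by linarith
    next
      case False
      then have "r \<le> r ^ DIM('a)"
        using power_increasing[of 1 "DIM('a)" r] by (simp add: Suc_leI)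
      then show ?thesis using * by linarith
    qed
    then show ?thesis using r i by simp
  qed
  let ?S = "\<Union>i\<in>K. ball (fst i) (snd i)"
  obtain C where C: "countable C" "C \<subseteq> K"
     "pairwise (\<lambda>i j. disjnt (ball (fst i) (snd i)) (ball (fst j) (snd j))) C"
     "?S \<subseteq> (\<Union>i\<in>C. ball (fst i) (5 * snd i))"
    by (rule Vitali_covering_lemma_balls[of ?S fst snd K "1 + I / (l * ?w)"]) (use bound in blast)+
  have "emeasure lborel ?S \<le> emeasure lborel (\<Union>i\<in>C. ball (fst i) (5 * snd i))"
    using C by (intro emeasure_mono) auto
  also have "\<dots> \<le> (\<integral>\<^sup>+i. emeasure lborel (ball (fst i) (5 * snd i)) \<partial>count_space C)"
    using C by (intro emeasure_Union_countable_le) auto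
  also have "\<dots> \<le> (\<integral>\<^sup>+i. ennreal (5 ^ DIM('a) / l) * emeasure (density lborel h) (ball (fst i) (snd i)) \<partial>count_space C)"
  proof (intro nn_integral_mono)
    fix i assume "i \<in> space (count_space C)"
    then have "i \<in> K" using C by auto
    then obtain c r where i: "i = (c, r)" "0 < r" "ennreal l * emeasure lborel (ball c r) < (\<integral>\<^sup>+z\<in>ball c r. h z \<partial>lborel)"
      by (auto simp: K_def)
    have "emeasure lborel (ball c (5 * r)) = ennreal (5 ^ DIM('a) / l) * (ennreal l * emeasure lborel (ball c r))"
      using l i by (simp add: emeasure_ball power_mult_distrib field_simps flip: ennreal_mult'')
    also have "\<dots> \<le> ennreal (5 ^ DIM('a) / l) * (\<integral>\<^sup>+z\<in>ball c r. h z \<partial>lborel)"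
      using i by (intro mult_left_mono) auto
    finally show "emeasure lborel (ball (fst i) (5 * snd i)) \<le> ennreal (5 ^ DIM('a) / l) * emeasure (density lborel h) (ball (fst i) (snd i))"
      by (simp add: i emeasure_density)
  qed
  also have "\<dots> = ennreal (5 ^ DIM('a) / l) * (\<integral>\<^sup>+i. emeasure (density lborel h) (ball (fst i) (snd i)) \<partial>count_space C)"
    by (subst nn_integral_cmult) auto
  \<comment> \<open>The selected balls are disjoint, so their h-masses add up to at most the total
    mass.\<close>
  also have "(\<integral>\<^sup>+i. emeasure (density lborel h) (ball (fst i) (snd i)) \<partial>count_space C)
     = emeasure (density lborel h) (\<Union>i\<in>C. ball (fst i) (snd i))"
    using C by (intro emeasure_UN_countable[symmetric])
      (auto simp: disjoint_family_on_def pairwise_def disjnt_def)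
  also have "\<dots> \<le> emeasure (density lborel h) UNIV"
    by (intro emeasure_mono) auto
  also have "\<dots> = (\<integral>\<^sup>+z. h z \<partial>lborel)"
    by (subst emeasure_density) auto
  finally have "emeasure lborel ?S \<le> ennreal (5 ^ DIM('a) / l) * (\<integral>\<^sup>+z. h z \<partial>lborel)"
    by (simp add: mult_left_mono)
  moreover have "{ball c r |c r. 0 < r \<and> ennreal l * emeasure lborel (ball c r) < (\<integral>\<^sup>+z\<in>ball c r. h z \<partial>lborel)}
      = (\<lambda>i. ball (fst i) (snd i)) ` K" (is "?L = ?R")
  proof (intro set_eqI iffI)
    fix X assume "X \<in> ?L"
    then obtain c r where "X = ball c r" "(c, r) \<in> K"
      by (auto simp: K_def)
    then show "X \<in> ?R"
      by (intro image_eqI[of _ _ "(c, r)"]) auto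
  next
    fix X assume "X \<in> ?R"
    then obtain c r where "X = ball c r" "(c, r) \<in> K"
      by auto
    then show "X \<in> ?L"
      unfolding K_def by blast
  qed
  ultimately show ?thesis by simp
qed

definition maximal_fun :: "('a::euclidean_space \<Rightarrow> ennreal) \<Rightarrow> 'a \<Rightarrow> ennreal" where
  "maximal_fun h x = (SUP (c, r)\<in>{(c, r). 0 < r \<and> x \<in> ball c r}.
      (\<integral>\<^sup>+z\<in>ball c r. h z \<partial>lborel) / emeasure lborel (ball c r))"

lemma maximal_fun_greater:
  fixes h :: "'a::euclidean_space \<Rightarrow> ennreal"
  shows "{x. l < maximal_fun h x} =
     \<Union>{ball c r |c r. 0 < r \<and> l * emeasure lborel (ball c r) < (\<integral>\<^sup>+z\<in>ball c r. h z \<partial>lborel)}"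
proof -
  have "l < I / emeasure lborel (ball c r) \<longleftrightarrow> l * emeasure lborel (ball c r) < I" if "0 < r" for c :: 'a and r I
  proof -
    define y where "y = unit_ball_vol (real DIM('a)) * r ^ DIM('a)"
    have y: "0 < y" "emeasure lborel (ball c r) = ennreal y"
      using that by (auto simp: y_def emeasure_ball)
    have "l < I / ennreal y \<longleftrightarrow> l * ennreal y < I"
    proof (cases l; cases I)
      fix a b assume "l = ennreal a" "0 \<le> a" "I = ennreal b" "0 \<le> b"
      then show ?thesis
        using y by (simp add: divide_ennreal ennreal_less_iff pos_less_divide_eq flip: ennreal_mult'')
    next
      fix a assume "l = ennreal a" "0 \<le> a" "I = top"
      then show ?thesis
        using y by (simp add: ennreal_top_divide flip: ennreal_mult'')
    qed (use y in \<open>auto simp: ennreal_top_mult\<close>)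
    then show ?thesis using y by simp
  qed
  note * = this
  show ?thesis
  proof (intro set_eqI iffI)
    fix x assume "x \<in> {x. l < maximal_fun h x}"
    then obtain c r where cr: "0 < r" "x \<in> ball c r" "l < (\<integral>\<^sup>+z\<in>ball c r. h z \<partial>lborel) / emeasure lborel (ball c r)"
      unfolding maximal_fun_def by (auto simp: less_SUP_iff)
    then have "l * emeasure lborel (ball c r) < (\<integral>\<^sup>+z\<in>ball c r. h z \<partial>lborel)"
      using *[of r] by simp
    then show "x \<in> \<Union>{ball c r |c r. 0 < r \<and> l * emeasure lborel (ball c r) < (\<integral>\<^sup>+z\<in>ball c r. h z \<partial>lborel)}"
      using cr by blast
  next
    fix x assume "x \<in> \<Union>{ball c r |c r. 0 < r \<and> l * emeasure lborel (ball c r) < (\<integral>\<^sup>+z\<in>ball c r. h z \<partial>lborel)}"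
    then obtain c r where cr: "0 < r" "x \<in> ball c r" "l * emeasure lborel (ball c r) < (\<integral>\<^sup>+z\<in>ball c r. h z \<partial>lborel)"
      by blast
    then have "l < (\<integral>\<^sup>+z\<in>ball c r. h z \<partial>lborel) / emeasure lborel (ball c r)"
      using *[of r] by simp
    also have "\<dots> \<le> maximal_fun h x"
      unfolding maximal_fun_def using cr by (intro SUP_upper2[of "(c, r)"]) auto
    finally show "x \<in> {x. l < maximal_fun h x}"
      by simp
  qed
qed

lemma maximal_fun_measurable [measurable]: "maximal_fun h \<in> borel_measurable borel"
proof (rule borel_measurableI_greater)
  fix l
  have "open {x. l < maximal_fun h x}"
    unfolding maximal_fun_greater by auto
  then show "{x \<in> space borel. l < maximal_fun h x} \<in> sets borel"
    by simp
qed

text \<open>Otherwise x would belong to the superlevel set at its own level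
  \<open>maximal_fun h x\<close>, by \<open>maximal_fun_greater\<close>. This route avoids dividing
  by extended numbers.\<close>

lemma nn_integral_ball_le_maximal_fun:
  fixes h :: "'a::euclidean_space \<Rightarrow> ennreal"
  assumes "0 < r" "x \<in> ball c r"
  shows "(\<integral>\<^sup>+z\<in>ball c r. h z \<partial>lborel) \<le> maximal_fun h x * emeasure lborel (ball c r)"
proof (rule ccontr)
  assume "\<not> ?thesis"
  then have "x \<in> {y. maximal_fun h x < maximal_fun h y}"
    using assms unfolding maximal_fun_greater by (auto simp: not_le intro!: exI[of _ "ball c r"])
  then show False by simp
qed

text \<open>The part of h below l/2 contributes at most l/2 to any average. Hence a ball on which
  the average of h exceeds l has average above l/2 for the part of h where h > l/2, and the covering
  bound at height l/2 is the hypothesis of the interpolation lemma with r = 1, c = 1/2 and B = 2 *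
  5^n.\<close>

lemma nn_integral_maximal_fun_powr_le:
  fixes h :: "'a::euclidean_space \<Rightarrow> real"
  assumes [measurable]: "h \<in> borel_measurable borel" and h: "\<And>x. 0 \<le> h x" and p: "1 < p"
  shows "(\<integral>\<^sup>+x. enn_powr (maximal_fun (\<lambda>z. ennreal (h z)) x) p \<partial>lborel)
     \<le> ennreal (2 * 5 ^ DIM('a) * p / (p - 1) * (1 / 2) powr (1 - p)) * (\<integral>\<^sup>+x. ennreal (h x powr p) \<partial>lborel)"
proof (rule nn_integral_Marcinkiewicz)
  fix l :: real assume l: "0 < l"
  let ?h = "\<lambda>z. ennreal (h z) * indicator {1/2 * l<..} (h z)"
  let ?S = "\<lambda>l h. \<Union>{ball c r |c r. 0 < r \<and> ennreal l * emeasure lborel (ball (c::'a) r) < (\<integral>\<^sup>+z\<in>ball c r. h z \<partial>lborel)}"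
  have "?S l (\<lambda>z. ennreal (h z)) \<subseteq> ?S (l / 2) ?h"
  proof -
    have "ennreal (l / 2) * emeasure lborel (ball c r) < (\<integral>\<^sup>+z\<in>ball c r. ?h z \<partial>lborel)"
      if r: "0 < r" and lt: "ennreal l * emeasure lborel (ball c r) < (\<integral>\<^sup>+z\<in>ball c r. ennreal (h z) \<partial>lborel)" for c :: 'a and r
    proof (rule ccontr)
      assume "\<not> ?thesis"
      then have le: "(\<integral>\<^sup>+z\<in>ball c r. ?h z \<partial>lborel) \<le> ennreal (l / 2) * emeasure lborel (ball c r)"
        by simp
      have "(\<integral>\<^sup>+z\<in>ball c r. ennreal (h z) \<partial>lborel) \<le> (\<integral>\<^sup>+z. ?h z * indicator (ball c r) z + ennreal (l / 2) * indicator (ball c r) z \<partial>lborel)"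
        by (intro nn_integral_mono) (auto simp: indicator_def intro!: ennreal_leI)
      also have "\<dots> = (\<integral>\<^sup>+z\<in>ball c r. ?h z \<partial>lborel) + ennreal (l / 2) * emeasure lborel (ball c r)"
        by (simp add: nn_integral_add nn_integral_cmult)
      also have "\<dots> \<le> ennreal (l / 2) * emeasure lborel (ball c r) + ennreal (l / 2) * emeasure lborel (ball c r)"
        by (intro add_right_mono le)
      also have "\<dots> = ennreal l * emeasure lborel (ball c r)"
        using l by (simp flip: distrib_right ennreal_plus)
      finally show False using lt by simp
    qed
    then show ?thesis by blast
  qed
  then have "emeasure lborel {x \<in> space lborel. ennreal l < maximal_fun (\<lambda>z. ennreal (h z)) x} \<le> emeasure lborel (?S (l / 2) ?h)"
    using maximal_fun_greater[of "ennreal l" "\<lambda>z. ennreal (h z)"]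
    by (intro emeasure_mono) (auto intro!: borel_open open_Union)
  also have "\<dots> \<le> ennreal (5 ^ DIM('a) / (l / 2)) * (\<integral>\<^sup>+z. ?h z \<partial>lborel)"
    using l by (intro emeasure_large_average_balls_le) auto
  also have "5 ^ DIM('a) / (l / 2) = 2 * 5 ^ DIM('a) * l powr - 1"
    using l by (simp add: powr_minus field_simps)
  also have "(\<integral>\<^sup>+z. ?h z \<partial>lborel) = (\<integral>\<^sup>+x. ennreal (h x powr 1) * indicator {1/2 * l<..} (h x) \<partial>lborel)"
    using h by simp
  finally show "emeasure lborel {x \<in> space lborel. ennreal l < maximal_fun (\<lambda>z. ennreal (h z)) x}
    \<le> ennreal (2 * 5 ^ DIM('a) * l powr - 1) * (\<integral>\<^sup>+x. ennreal (h x powr 1) * indicator {1/2 * l<..} (h x) \<partial>lborel)" .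
qed (use h p in \<open>simp_all add: lborel.sigma_finite_measure_axioms\<close>)

section \<open>Schur's test for square functions\<close>

lemma abs_integral_le_nn_integral:
  fixes f :: "'b \<Rightarrow> real"
  shows "ennreal \<bar>\<integral>x. f x \<partial>M\<bar> \<le> (\<integral>\<^sup>+x. ennreal \<bar>f x\<bar> \<partial>M)"
proof (cases "integrable M f")
  case True
  then show ?thesis
    using integral_norm_bound_ennreal[OF True] by simp
qed (simp add: not_integrable_integral_eq)

text \<open>Let T have kernel \<open>\<Psi>\<close>, put F = T g and let H be the adjoint of T
  applied to F. Then ||F||^2 = <g, H>, while Schur's test for the composed kernel gives ||H||^2
  \<le> A ||F||^2. The bounds \<open>B\<close>, \<open>L\<close>, \<open>G\<close> and the
  finiteness of M secure convergence and do not enter the final constant.\<close>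

lemma nn_integral_TT_star_le:
  fixes \<Psi> :: "'b \<Rightarrow> 'c \<Rightarrow> real" and g :: "'c \<Rightarrow> real"
  assumes "finite_measure M" "sigma_finite_measure N"
    and meas [measurable]: "(\<lambda>(w, z). \<Psi> w z) \<in> borel_measurable (M \<Otimes>\<^sub>M N)" "g \<in> borel_measurable N"
    and B: "\<And>w z. w \<in> space M \<Longrightarrow> \<bar>\<Psi> w z\<bar> \<le> B"
    and L: "\<And>w. w \<in> space M \<Longrightarrow> (\<integral>\<^sup>+z. ennreal \<bar>\<Psi> w z\<bar> \<partial>N) \<le> ennreal L" "0 \<le> L"
    and G: "\<And>z. \<bar>g z\<bar> \<le> G" and g2: "(\<integral>\<^sup>+z. ennreal ((g z)\<^sup>2) \<partial>N) < \<infinity>"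
    and A: "0 < A" "\<And>w. w \<in> space M \<Longrightarrow> (\<integral>\<^sup>+w'. ennreal \<bar>\<integral>z. \<Psi> w z * \<Psi> w' z \<partial>N\<bar> \<partial>M) \<le> ennreal A"
  shows "(\<integral>\<^sup>+w. ennreal ((\<integral>z. \<Psi> w z * g z \<partial>N)\<^sup>2) \<partial>M) \<le> ennreal A * (\<integral>\<^sup>+z. ennreal ((g z)\<^sup>2) \<partial>N)"
proof -
  interpret M: finite_measure M by fact
  interpret N: sigma_finite_measure N by fact
  interpret MN: pair_sigma_finite M N ..
  interpret MM: pair_sigma_finite M M ..
  have [measurable]: "\<Psi> w \<in> borel_measurable N" if "w \<in> space M" for w
    using measurable_compose_Pair1[OF that meas(1)] by simp
  have [measurable]: "(\<lambda>(w, w'). \<integral>z. \<Psi> w z * \<Psi> w' z \<partial>N) \<in> borel_measurable (M \<Otimes>\<^sub>M M)"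
    by measurable
  define K where "K = (\<lambda>w w'. \<integral>z. \<Psi> w z * \<Psi> w' z \<partial>N)"
  have K_meas [measurable]: "(\<lambda>(w, w'). K w w') \<in> borel_measurable (M \<Otimes>\<^sub>M M)"
    unfolding K_def by measurable
  have K_sym: "K w w' = K w' w" for w w'
    by (simp add: K_def mult.commute)
  have G0: "0 \<le> G" using G[of undefined] by linarith
  have int_prod: "integrable N (\<lambda>z. \<Psi> w z * k z)" "\<bar>\<integral>z. \<Psi> w z * k z \<partial>N\<bar> \<le> L * Q"
    if w: "w \<in> space M" and [measurable]: "k \<in> borel_measurable N" and k: "\<And>z. \<bar>k z\<bar> \<le> Q" for w k Q
  proof -
    have Q: "0 \<le> Q" using k[of undefined] by linarith
    have "(\<integral>\<^sup>+z. ennreal (norm (\<Psi> w z * k z)) \<partial>N) \<le> (\<integral>\<^sup>+z. ennreal Q * ennreal \<bar>\<Psi> w z\<bar> \<partial>N)"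
      using k Q by (intro nn_integral_mono) (auto simp: abs_mult mult.commute simp flip: ennreal_mult intro!: ennreal_leI mult_right_mono)
    also have "\<dots> \<le> ennreal Q * ennreal L"
      using w by (subst nn_integral_cmult) (auto intro!: mult_left_mono L)
    finally have *: "(\<integral>\<^sup>+z. ennreal (norm (\<Psi> w z * k z)) \<partial>N) \<le> ennreal (L * Q)"
      using L(2) Q by (simp add: ennreal_mult mult.commute)
    then show i: "integrable N (\<lambda>z. \<Psi> w z * k z)"
      using w by (intro integrableI_bounded) (auto simp: less_top[symmetric] top_unique)
    have "ennreal \<bar>\<integral>z. \<Psi> w z * k z \<partial>N\<bar> \<le> ennreal (L * Q)"
      using integral_norm_bound_ennreal[OF i] * by simp
    then show "\<bar>\<integral>z. \<Psi> w z * k z \<partial>N\<bar> \<le> L * Q"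
      using L(2) Q by (subst (asm) ennreal_le_iff) auto
  qed
  define F where "F = (\<lambda>w. \<integral>z. \<Psi> w z * g z \<partial>N)"
  have F_meas [measurable]: "F \<in> borel_measurable M"
    unfolding F_def by measurable
  have F: "\<bar>F w\<bar> \<le> L * G" if "w \<in> space M" for w
    unfolding F_def using that G by (intro int_prod) auto
  define H where "H = (\<lambda>z. \<integral>w. \<Psi> w z * F w \<partial>M)"
  have H_meas [measurable]: "H \<in> borel_measurable N"
    unfolding H_def by measurable
  \<comment> \<open>The duality <k, H> = <F, T k> for bounded k. It is applied to g, to H itself and
    to each function \<open>\<Psi> w\<close>.\<close>
  have swap: "(\<integral>z. k z * H z \<partial>N) = (\<integral>w. F w * (\<integral>z. \<Psi> w z * k z \<partial>N) \<partial>M)"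
     "integrable N (\<lambda>z. k z * H z)"
    if [measurable]: "k \<in> borel_measurable N" and k: "\<And>z. \<bar>k z\<bar> \<le> Q" for k Q
  proof -
    have Q: "0 \<le> Q" using k[of undefined] by linarith
    have "(\<integral>\<^sup>+x. ennreal (norm (case x of (w, z) \<Rightarrow> F w * (\<Psi> w z * k z))) \<partial>(M \<Otimes>\<^sub>M N))
       = (\<integral>\<^sup>+w. \<integral>\<^sup>+z. ennreal (norm (F w * (\<Psi> w z * k z))) \<partial>N \<partial>M)"
      by (subst N.nn_integral_fst[symmetric]) auto
    also have "\<dots> \<le> (\<integral>\<^sup>+w. ennreal (L * G * Q * L) \<partial>M)"
    proof (intro nn_integral_mono)
      fix w assume w: "w \<in> space M"
      have "(\<integral>\<^sup>+z. ennreal (norm (F w * (\<Psi> w z * k z))) \<partial>N) \<le> (\<integral>\<^sup>+z. ennreal (L * G * Q) * ennreal \<bar>\<Psi> w z\<bar> \<partial>N)"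
      proof (intro nn_integral_mono)
        fix z
        have "\<bar>F w\<bar> * (\<bar>\<Psi> w z\<bar> * \<bar>k z\<bar>) \<le> (L * G) * (\<bar>\<Psi> w z\<bar> * Q)"
          using F[OF w] k[of z] by (intro mult_mono) auto
        then show "ennreal (norm (F w * (\<Psi> w z * k z))) \<le> ennreal (L * G * Q) * ennreal \<bar>\<Psi> w z\<bar>"
          using L(2) G0 Q by (simp add: abs_mult ac_simps flip: ennreal_mult)
      qed
      also have "\<dots> \<le> ennreal (L * G * Q) * ennreal L"
        using w by (subst nn_integral_cmult) (auto intro!: mult_left_mono L)
      finally show "(\<integral>\<^sup>+z. ennreal (norm (F w * (\<Psi> w z * k z))) \<partial>N) \<le> ennreal (L * G * Q * L)"
        using L(2) G0 Q by (simp add: ennreal_mult)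
    qed
    also have "\<dots> < \<infinity>"
      using M.emeasure_finite[of "space M"] by (simp add: ennreal_mult_eq_top_iff less_top[symmetric])
    finally have i: "integrable (M \<Otimes>\<^sub>M N) (\<lambda>(w, z). F w * (\<Psi> w z * k z))"
      by (intro integrableI_bounded) auto
    have "(\<integral>z. k z * H z \<partial>N) = (\<integral>z. \<integral>w. F w * (\<Psi> w z * k z) \<partial>M \<partial>N)"
      unfolding H_def by (subst integral_mult_right_zero[symmetric]) (simp add: ac_simps)
    also have "\<dots> = (\<integral>w. \<integral>z. F w * (\<Psi> w z * k z) \<partial>N \<partial>M)"
      by (rule MN.Fubini_integral[OF i])
    finally show "(\<integral>z. k z * H z \<partial>N) = (\<integral>w. F w * (\<integral>z. \<Psi> w z * k z \<partial>N) \<partial>M)"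
      by simp
    have "integrable N (\<lambda>z. \<integral>w. F w * (\<Psi> w z * k z) \<partial>M)"
      using MN.integrable_snd[OF i] by simp
    also have "(\<lambda>z. \<integral>w. F w * (\<Psi> w z * k z) \<partial>M) = (\<lambda>z. k z * H z)"
      unfolding H_def by (subst integral_mult_right_zero[symmetric]) (simp add: ac_simps)
    finally show "integrable N (\<lambda>z. k z * H z)" .
  qed
  define HB where "HB = B * (L * G) * measure M (space M)"
  have H: "\<bar>H z\<bar> \<le> HB" for z
  proof -
    have B0: "0 \<le> B" if "space M \<noteq> {}"
      using that B[of _ undefined] by (meson abs_ge_zero all_not_in_conv order_trans)
    have b: "\<bar>\<Psi> w z * F w\<bar> \<le> B * (L * G)" if "w \<in> space M" for w
      unfolding abs_mult using that B F B0 by (intro mult_mono) auto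
    have "\<bar>H z\<bar> \<le> (\<integral>w. B * (L * G) \<partial>M)"
      unfolding H_def using b integral_norm_bound[of M "\<lambda>w. \<Psi> w z * F w"]
      by (intro order_trans[OF integral_abs_bound] integral_mono_AE')
        (auto intro!: AE_I2 order_trans[OF abs_ge_zero b])
    then show ?thesis by (simp add: HB_def mult_ac)
  qed
  have X: "(\<integral>z. g z * H z \<partial>N) = (\<integral>w. (F w)\<^sup>2 \<partial>M)"
    using swap(1)[of g G] G by (simp add: F_def power2_eq_square)
  have F2: "integrable M (\<lambda>w. (F w)\<^sup>2)"
    using F by (intro M.integrable_const_bound[of _ "(L * G)\<^sup>2"]) (auto intro!: AE_I2 simp: abs_le_square_iff[symmetric] L(2) G0)
  have nnF2: "(\<integral>\<^sup>+w. ennreal ((F w)\<^sup>2) \<partial>M) = ennreal (\<integral>w. (F w)\<^sup>2 \<partial>M)"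
    by (intro nn_integral_eq_integral F2) auto
  have H2: "(\<integral>z. H z * H z \<partial>N) \<le> A * (\<integral>w. (F w)\<^sup>2 \<partial>M)"
  proof -
    have "(\<integral>z. H z * H z \<partial>N) = (\<integral>w. F w * (\<integral>z. \<Psi> w z * H z \<partial>N) \<partial>M)"
      using H by (intro swap) auto
    also have "\<dots> = (\<integral>w. F w * (\<integral>w'. F w' * K w w' \<partial>M) \<partial>M)"
    proof (intro Bochner_Integration.integral_cong refl)
      fix w assume w: "w \<in> space M"
      have "(\<integral>z. \<Psi> w z * H z \<partial>N) = (\<integral>w'. F w' * (\<integral>z. \<Psi> w' z * \<Psi> w z \<partial>N) \<partial>M)"
        using w B by (intro swap) auto
      then show "F w * (\<integral>z. \<Psi> w z * H z \<partial>N) = F w * (\<integral>w'. F w' * K w w' \<partial>M)"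
        by (simp add: K_def mult.commute)
    qed
    finally have "ennreal (\<integral>z. H z * H z \<partial>N) \<le> (\<integral>\<^sup>+w. ennreal (norm (F w * (\<integral>w'. F w' * K w w' \<partial>M))) \<partial>M)"
      using abs_integral_le_nn_integral[of M "\<lambda>w. F w * (\<integral>w'. F w' * K w w' \<partial>M)"]
      by (simp add: order_trans[OF ennreal_leI[OF abs_ge_self]])
    also have "\<dots> \<le> (\<integral>\<^sup>+w. \<integral>\<^sup>+w'. ennreal ((F w)\<^sup>2 / 2) * ennreal \<bar>K w w'\<bar> + ennreal ((F w')\<^sup>2 / 2) * ennreal \<bar>K w w'\<bar> \<partial>M \<partial>M)"
    proof (intro nn_integral_mono)
      fix w assume w: "w \<in> space M"
      have [measurable]: "K w \<in> borel_measurable M"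
        using measurable_compose_Pair1[OF w K_meas] by simp
      have "ennreal (norm (F w * (\<integral>w'. F w' * K w w' \<partial>M))) = ennreal (norm (\<integral>w'. F w * (F w' * K w w') \<partial>M))"
        by simp
      also have "\<dots> \<le> (\<integral>\<^sup>+w'. ennreal (norm (F w * (F w' * K w w'))) \<partial>M)"
        using abs_integral_le_nn_integral[of M "\<lambda>w'. F w * (F w' * K w w')"] by simp
      also have "\<dots> \<le> (\<integral>\<^sup>+w'. ennreal ((F w)\<^sup>2 / 2) * ennreal \<bar>K w w'\<bar> + ennreal ((F w')\<^sup>2 / 2) * ennreal \<bar>K w w'\<bar> \<partial>M)"
      proof (intro nn_integral_mono)
        fix w'
        \<comment> \<open>Schur's test with constant weights: the product is split symmetrically,
          and by \<open>K_sym\<close> and Tonelli both halves have the same integral.\<close>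
        have "\<bar>F w\<bar> * \<bar>F w'\<bar> \<le> (F w)\<^sup>2 / 2 + (F w')\<^sup>2 / 2"
          using sum_squares_bound[of "\<bar>F w\<bar>" "\<bar>F w'\<bar>"] by simp
        then have "\<bar>F w\<bar> * \<bar>F w'\<bar> * \<bar>K w w'\<bar> \<le> ((F w)\<^sup>2 / 2 + (F w')\<^sup>2 / 2) * \<bar>K w w'\<bar>"
          by (intro mult_right_mono) auto
        then show "ennreal (norm (F w * (F w' * K w w'))) \<le> ennreal ((F w)\<^sup>2 / 2) * ennreal \<bar>K w w'\<bar> + ennreal ((F w')\<^sup>2 / 2) * ennreal \<bar>K w w'\<bar>"
          by (simp add: abs_mult algebra_simps flip: ennreal_mult ennreal_plus)
      qed
      finally show "ennreal (norm (F w * (\<integral>w'. F w' * K w w' \<partial>M)))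
        \<le> (\<integral>\<^sup>+w'. ennreal ((F w)\<^sup>2 / 2) * ennreal \<bar>K w w'\<bar> + ennreal ((F w')\<^sup>2 / 2) * ennreal \<bar>K w w'\<bar> \<partial>M)" .
    qed
    also have "\<dots> = (\<integral>\<^sup>+w. \<integral>\<^sup>+w'. ennreal ((F w)\<^sup>2 / 2) * ennreal \<bar>K w w'\<bar> \<partial>M \<partial>M) + (\<integral>\<^sup>+w. \<integral>\<^sup>+w'. ennreal ((F w')\<^sup>2 / 2) * ennreal \<bar>K w w'\<bar> \<partial>M \<partial>M)"
      by (subst nn_integral_add[symmetric]) (auto intro!: nn_integral_cong nn_integral_add)
    also have "(\<integral>\<^sup>+w. \<integral>\<^sup>+w'. ennreal ((F w')\<^sup>2 / 2) * ennreal \<bar>K w w'\<bar> \<partial>M \<partial>M) = (\<integral>\<^sup>+w'. \<integral>\<^sup>+w. ennreal ((F w')\<^sup>2 / 2) * ennreal \<bar>K w w'\<bar> \<partial>M \<partial>M)"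
      by (rule MM.Fubini') measurable
    also have "\<dots> = (\<integral>\<^sup>+w. \<integral>\<^sup>+w'. ennreal ((F w)\<^sup>2 / 2) * ennreal \<bar>K w w'\<bar> \<partial>M \<partial>M)"
      by (subst K_sym) simp
    also have "\<dots> \<le> (\<integral>\<^sup>+w. ennreal ((F w)\<^sup>2 / 2) * ennreal A \<partial>M)"
    proof (intro nn_integral_mono)
      fix w assume w: "w \<in> space M"
      have [measurable]: "K w \<in> borel_measurable M"
        using measurable_compose_Pair1[OF w K_meas] by simp
      show "(\<integral>\<^sup>+w'. ennreal ((F w)\<^sup>2 / 2) * ennreal \<bar>K w w'\<bar> \<partial>M) \<le> ennreal ((F w)\<^sup>2 / 2) * ennreal A"
      proof (subst nn_integral_cmult)
        have "(\<integral>\<^sup>+w'. ennreal \<bar>K w w'\<bar> \<partial>M) \<le> ennreal A"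
          using A(2)[OF w] by (simp add: K_def)
        then show "ennreal ((F w)\<^sup>2 / 2) * (\<integral>\<^sup>+w'. ennreal \<bar>K w w'\<bar> \<partial>M) \<le> ennreal ((F w)\<^sup>2 / 2) * ennreal A"
          by (intro mult_left_mono) auto
      qed measurable
    qed
    also have "(\<integral>\<^sup>+w. ennreal ((F w)\<^sup>2 / 2) * ennreal A \<partial>M) = ennreal (A / 2) * (\<integral>\<^sup>+w. ennreal ((F w)\<^sup>2) \<partial>M)"
      using A(1) by (subst nn_integral_cmult[symmetric]) (auto simp: ac_simps simp flip: ennreal_mult)
    finally have "ennreal (\<integral>z. H z * H z \<partial>N) \<le> ennreal (A / 2) * (\<integral>\<^sup>+w. ennreal ((F w)\<^sup>2) \<partial>M) + ennreal (A / 2) * (\<integral>\<^sup>+w. ennreal ((F w)\<^sup>2) \<partial>M)"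
      by (meson add_mono order_trans order_refl)
    also have "\<dots> = ennreal (A * (\<integral>w. (F w)\<^sup>2 \<partial>M))"
      using A(1) unfolding nnF2 by (simp flip: ennreal_mult ennreal_plus)
    finally show ?thesis
      using A(1) by (subst (asm) ennreal_le_iff) auto
  qed
  have ig2: "integrable N (\<lambda>z. (g z)\<^sup>2)"
    using g2 by (intro integrableI_bounded) auto
  have igH: "integrable N (\<lambda>z. g z * H z)" and iHH: "integrable N (\<lambda>z. H z * H z)"
    using swap(2)[of g G] swap(2)[of H HB] G H by auto
  \<comment> \<open>Expanding the square of g - H/A takes the place of the Cauchy-Schwarz
    inequality, so no division by the norm of F occurs.\<close>
  have "0 \<le> (\<integral>z. (g z - H z / A)\<^sup>2 \<partial>N)"
    by simp
  also have "\<dots> = (\<integral>z. (g z)\<^sup>2 - 2 / A * (g z * H z) + 1 / A\<^sup>2 * (H z * H z) \<partial>N)"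
    by (intro Bochner_Integration.integral_cong) (auto simp: power2_eq_square algebra_simps)
  also have "\<dots> = (\<integral>z. (g z)\<^sup>2 \<partial>N) - 2 / A * (\<integral>z. g z * H z \<partial>N) + 1 / A\<^sup>2 * (\<integral>z. H z * H z \<partial>N)"
    using ig2 igH iHH by simp
  also have "\<dots> \<le> (\<integral>z. (g z)\<^sup>2 \<partial>N) - 2 / A * (\<integral>w. (F w)\<^sup>2 \<partial>M) + 1 / A\<^sup>2 * (A * (\<integral>w. (F w)\<^sup>2 \<partial>M))"
    unfolding X using H2 by (intro add_left_mono mult_left_mono) auto
  also have "\<dots> = (\<integral>z. (g z)\<^sup>2 \<partial>N) - (\<integral>w. (F w)\<^sup>2 \<partial>M) / A"
    using A(1) by (simp add: power2_eq_square field_simps)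
  finally have "(\<integral>w. (F w)\<^sup>2 \<partial>M) \<le> A * (\<integral>z. (g z)\<^sup>2 \<partial>N)"
    using A(1) by (simp add: field_simps)
  moreover have "(\<integral>\<^sup>+z. ennreal ((g z)\<^sup>2) \<partial>N) = ennreal (\<integral>z. (g z)\<^sup>2 \<partial>N)"
    by (intro nn_integral_eq_integral ig2) auto
  ultimately show ?thesis
    using A(1) nnF2 unfolding F_def by (simp flip: ennreal_mult)
qed

section \<open>The Poisson kernel and its time derivative\<close>

text \<open>The Euclidean norm of (t, x). All kernels are expressed through it, since the triangle
  inequality in the product space makes it 1-Lipschitz in x.\<close>

definition rho :: "real \<Rightarrow> 'a::euclidean_space \<Rightarrow> real" where
  "rho t x = sqrt (t\<^sup>2 + (norm x)\<^sup>2)"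

lemma rho_eq_norm: "rho t x = norm (t, x)"
  by (simp add: rho_def norm_Pair)

lemma rho_measurable [measurable]:
  assumes [measurable]: "f \<in> borel_measurable M" "g \<in> borel_measurable M"
  shows "(\<lambda>x. rho (f x) (g x)) \<in> borel_measurable M"
  unfolding rho_def by measurable

lemma rho_nonneg [simp]: "0 \<le> rho t x"
  by (simp add: rho_eq_norm)

lemma rho_pos: "0 < t \<Longrightarrow> 0 < rho t x"
  by (simp add: rho_def add_pos_nonneg)

lemma le_rho: "t \<le> rho t x"
  using norm_fst_le[of t x] by (simp add: rho_eq_norm)

lemma norm_le_rho: "norm x \<le> rho t x"
  using norm_snd_le[of x t] by (simp add: rho_eq_norm)

lemma norm_less_rho: "0 < t \<Longrightarrow> norm x < rho t x"
  unfolding rho_def by (rule real_less_rsqrt) auto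

lemma add_le_2_rho: "t + norm x \<le> 2 * rho t x"
  using le_rho[of t x] norm_le_rho[of x t] by linarith

lemma rho_minus [simp]: "rho t (- x) = rho t x"
  by (simp add: rho_def)

lemma rho_minus_commute: "rho t (x - y) = rho t (y - x)"
  by (simp add: rho_def norm_minus_commute)

lemma rho_mono: "0 \<le> t \<Longrightarrow> t \<le> t' \<Longrightarrow> rho t x \<le> rho t' x"
  unfolding rho_def by (intro real_sqrt_le_mono) (auto intro: power_mono)

lemma abs_rho_diff_le: "\<bar>rho t x - rho t y\<bar> \<le> norm (x - y)"
  using norm_triangle_ineq3[of "(t, x)" "(t, y)"] by (simp add: rho_eq_norm norm_Pair)

lemma rho_powr:
  assumes "0 < t"
  shows "(t\<^sup>2 + (norm x)\<^sup>2) powr (k / 2) = rho t x powr k"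
  using assms by (simp add: rho_def powr_half_sqrt[symmetric] powr_powr add_pos_nonneg)

lemma abs_powr_diff_le:
  fixes a b m k :: real
  assumes "0 < m" "m \<le> a" "m \<le> b" "0 \<le> k"
  shows "\<bar>a powr (- k) - b powr (- k)\<bar> \<le> k * \<bar>a - b\<bar> * m powr (- k - 1)"
proof -
  have "norm (a powr (- k) - b powr (- k)) \<le> (k * m powr (- k - 1)) * norm (a - b)"
  proof (rule field_differentiable_bound[of "{m..}"])
    fix z assume "z \<in> {m..}"
    then have z: "0 < z" "m \<le> z" using assms by auto
    then show "((\<lambda>x. x powr (- k)) has_field_derivative (- k * z powr (- k - 1))) (at z within {m..})"
      by (intro has_field_derivative_at_within[OF has_real_derivative_powr])
    have "z powr (- k - 1) \<le> m powr (- k - 1)"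
      using z assms by (intro powr_mono2') auto
    then show "norm (- k * z powr (- k - 1)) \<le> k * m powr (- k - 1)"
      using assms by (auto simp: abs_mult intro!: mult_left_mono)
  qed (use assms in auto)
  then show ?thesis by (simp add: ac_simps)
qed

lemma power2_mult_powr:
  fixes x k l :: real
  assumes "0 < x" "l = k + 2"
  shows "x\<^sup>2 * x powr (- l) = x powr (- k)"
proof -
  have "x powr (- k) = x powr (2 + - l)"
    using assms by simp
  then show ?thesis
    using assms by (simp only: powr_add) simp
qed

section \<open>Size and smoothness of the differentiated kernel\<close>

lemma poisson_const_pos: "0 < poisson_const n"
  unfolding poisson_const_def by (intro mult_pos_pos Gamma_real_pos) (auto simp: powr_gt_zero)

text \<open>The t-derivative of the Poisson kernel, see
  \<open>has_derivative_poisson_kernel\<close>.\<close>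

definition dker :: "real \<Rightarrow> 'a::euclidean_space \<Rightarrow> real" where
  "dker t x = poisson_const DIM('a) * (rho t x powr (- (real DIM('a) + 1)) -
      (real DIM('a) + 1) * t\<^sup>2 * rho t x powr (- (real DIM('a) + 3)))"

lemma dker_measurable [measurable]:
  assumes [measurable]: "f \<in> borel_measurable M" "g \<in> borel_measurable M"
  shows "(\<lambda>x. dker (f x) (g x)) \<in> borel_measurable M"
  unfolding dker_def by measurable

lemma poisson_kernel_measurable [measurable]:
  assumes [measurable]: "f \<in> borel_measurable M" "g \<in> borel_measurable M"
  shows "(\<lambda>x. poisson_kernel (f x) (g x)) \<in> borel_measurable M"
  unfolding poisson_kernel_def by measurable

lemma dker_minus: "dker t (- x) = dker t x"
  by (simp add: dker_def)

lemma dker_minus_commute: "dker t (x - y) = dker t (y - x)"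
  unfolding dker_def by (subst (1 2) rho_minus_commute) (rule refl)

lemma poisson_kernel_eq:
  "0 < t \<Longrightarrow> poisson_kernel t (x::'a::euclidean_space) = poisson_const DIM('a) * t * rho t x powr (- (real DIM('a) + 1))"
  using rho_powr[of t x "- (real DIM('a) + 1)"] by (simp add: poisson_kernel_def)

lemma poisson_kernel_nonneg: "0 < t \<Longrightarrow> 0 \<le> poisson_kernel t x"
  using poisson_const_pos by (simp add: poisson_kernel_eq less_imp_le)

lemma has_derivative_poisson_kernel:
  fixes x :: "'a::euclidean_space"
  assumes t: "0 < t"
  shows "((\<lambda>\<tau>. poisson_kernel \<tau> x) has_real_derivative dker t x) (at t)"
proof -
  let ?N = "real DIM('a)" and ?\<sigma> = "t\<^sup>2 + (norm x)\<^sup>2"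
  have \<sigma>: "0 < ?\<sigma>" using t by (simp add: add_pos_nonneg)
  have "((\<lambda>\<tau>. poisson_kernel \<tau> x) has_real_derivative
     poisson_const DIM('a) * (?\<sigma> powr (- (?N + 1) / 2) + t * (- (?N + 1) / 2 * ?\<sigma> powr (- (?N + 1) / 2 - 1) * (2 * t)))) (at t)"
    unfolding poisson_kernel_def using \<sigma>
    by (auto intro!: derivative_eq_intros simp: algebra_simps)
  moreover have "?\<sigma> powr (- (?N + 1) / 2 - 1) = rho t x powr (- (?N + 3))"
  proof -
    have *: "- (?N + 1) / 2 - 1 = - (?N + 3) / 2"
      by (simp add: field_simps)
    show ?thesis unfolding * by (rule rho_powr[OF t])
  qed
  moreover have "?\<sigma> powr (- (?N + 1) / 2) = rho t x powr (- (?N + 1))"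
    using rho_powr[of t x "- (?N + 1)"] t by simp
  moreover have "poisson_const DIM('a) * (rho t x powr (- (?N + 1)) + t * (- (?N + 1) / 2 * rho t x powr (- (?N + 3)) * (2 * t))) = dker t x"
    by (simp add: dker_def power2_eq_square field_simps)
  ultimately show ?thesis by simp
qed

lemma abs_dker_le:
  fixes x :: "'a::euclidean_space"
  assumes t: "0 < t"
  shows "\<bar>dker t x\<bar> \<le> poisson_const DIM('a) * (real DIM('a) + 2) * rho t x powr (- (real DIM('a) + 1))"
proof -
  let ?N = "real DIM('a)" and ?r = "rho t x"
  have r: "0 < ?r" using t by (rule rho_pos)
  have "t\<^sup>2 * ?r powr (- (?N + 3)) \<le> ?r\<^sup>2 * ?r powr (- (?N + 3))"
    using le_rho[of t x] t by (intro mult_right_mono power_mono) auto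
  also have "\<dots> = ?r powr (- (?N + 1))"
    by (rule power2_mult_powr[OF r]) simp
  finally have *: "t\<^sup>2 * ?r powr (- (?N + 3)) \<le> ?r powr (- (?N + 1))" .
  have "\<bar>?r powr (- (?N + 1)) - (?N + 1) * t\<^sup>2 * ?r powr (- (?N + 3))\<bar> \<le> ?r powr (- (?N + 1)) + (?N + 1) * (t\<^sup>2 * ?r powr (- (?N + 3)))"
    by (intro order_trans[OF abs_triangle_ineq4]) (auto simp: abs_mult)
  also have "\<dots> \<le> ?r powr (- (?N + 1)) + (?N + 1) * ?r powr (- (?N + 1))"
    using * by (intro add_left_mono mult_left_mono) auto
  also have "\<dots> = (?N + 2) * ?r powr (- (?N + 1))"
    by (simp add: algebra_simps)
  finally show ?thesis
    unfolding dker_def abs_mult using poisson_const_pos[of "DIM('a)"] by (simp add: mult.assoc)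
qed

text \<open>Moving x by at most half of \<open>rho t x\<close> keeps \<open>rho\<close> above
  \<open>rho t x / 2\<close>, so the mean value theorem for negative powers loses only the factors
  2^(N+2) and 2^(N+4). The factor t^2 of the second term is absorbed by two powers of
  \<open>rho\<close>.\<close>

lemma abs_dker_diff_le:
  fixes x y :: "'a::euclidean_space"
  assumes t: "0 < t" and xy: "norm (x - y) \<le> rho t x / 2"
  defines "N \<equiv> real DIM('a)"
  shows "\<bar>dker t x - dker t y\<bar> \<le> poisson_const DIM('a) * ((N + 1) * 2 powr (N + 2) + (N + 1) * (N + 3) * 2 powr (N + 4)) *
     norm (x - y) * rho t x powr (- (N + 2))"
proof -
  let ?r = "rho t x" and ?r' = "rho t y" and ?d = "norm (x - y)"
  have r: "0 < ?r" using t by (rule rho_pos)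
  have d: "\<bar>?r - ?r'\<bar> \<le> ?d" by (rule abs_rho_diff_le)
  have r': "?r / 2 \<le> ?r'" "?r / 2 \<le> ?r" using d xy r by linarith+
  have N: "0 \<le> N" by (simp add: N_def)
  have half: "(?r / 2) powr (- k) = 2 powr k * ?r powr (- k)" for k
    using r by (simp add: powr_divide powr_minus field_simps)
  have *: "\<bar>?r powr (- k) - ?r' powr (- k)\<bar> \<le> k * ?d * (2 powr (k + 1) * ?r powr (- (k + 1)))" if "0 \<le> k" for k
  proof -
    have "\<bar>?r powr (- k) - ?r' powr (- k)\<bar> \<le> k * \<bar>?r - ?r'\<bar> * (?r / 2) powr (- k - 1)"
      using r r' that by (intro abs_powr_diff_le) auto
    also have "\<dots> \<le> k * ?d * (?r / 2) powr (- k - 1)"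
      using d that by (intro mult_right_mono mult_left_mono) auto
    also have "(?r / 2) powr (- k - 1) = 2 powr (k + 1) * ?r powr (- (k + 1))"
      using half[of "k + 1"] by simp
    finally show ?thesis .
  qed
  have "t\<^sup>2 * ?r powr (- (N + 4)) \<le> ?r\<^sup>2 * ?r powr (- (N + 4))"
    using le_rho[of t x] t by (intro mult_right_mono power_mono) auto
  also have "\<dots> = ?r powr (- (N + 2))"
    by (rule power2_mult_powr[OF r]) simp
  finally have t2: "t\<^sup>2 * ?r powr (- (N + 4)) \<le> ?r powr (- (N + 2))" .
  have "dker t x - dker t y = poisson_const DIM('a) * ((?r powr (- (N + 1)) - ?r' powr (- (N + 1))) -
      (N + 1) * t\<^sup>2 * (?r powr (- (N + 3)) - ?r' powr (- (N + 3))))"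
    by (simp add: dker_def N_def algebra_simps)
  then have "\<bar>dker t x - dker t y\<bar> = poisson_const DIM('a) * \<bar>(?r powr (- (N + 1)) - ?r' powr (- (N + 1))) -
      (N + 1) * t\<^sup>2 * (?r powr (- (N + 3)) - ?r' powr (- (N + 3)))\<bar>"
    using poisson_const_pos[of "DIM('a)"] by (simp add: abs_mult)
  also have "\<dots> \<le> poisson_const DIM('a) * (\<bar>?r powr (- (N + 1)) - ?r' powr (- (N + 1))\<bar> +
      (N + 1) * t\<^sup>2 * \<bar>?r powr (- (N + 3)) - ?r' powr (- (N + 3))\<bar>)"
    using poisson_const_pos[of "DIM('a)"] N
    by (intro mult_left_mono order_trans[OF abs_triangle_ineq4]) (auto simp: abs_mult)
  also have "\<dots> \<le> poisson_const DIM('a) * ((N + 1) * ?d * (2 powr (N + 2) * ?r powr (- (N + 2))) +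
      (N + 1) * t\<^sup>2 * ((N + 3) * ?d * (2 powr (N + 4) * ?r powr (- (N + 4)))))"
    using *[of "N + 1"] *[of "N + 3"] N poisson_const_pos[of "DIM('a)"]
    by (intro mult_left_mono add_mono) (auto simp: add.assoc)
  also have "\<dots> = poisson_const DIM('a) * ((N + 1) * ?d * (2 powr (N + 2) * ?r powr (- (N + 2))) +
      (N + 1) * (N + 3) * ?d * 2 powr (N + 4) * (t\<^sup>2 * ?r powr (- (N + 4))))"
    by (simp add: ac_simps)
  also have "\<dots> \<le> poisson_const DIM('a) * ((N + 1) * ?d * (2 powr (N + 2) * ?r powr (- (N + 2))) +
      (N + 1) * (N + 3) * ?d * 2 powr (N + 4) * ?r powr (- (N + 2)))"
    using t2 N poisson_const_pos[of "DIM('a)"] by (intro mult_left_mono add_left_mono) auto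
  also have "\<dots> = poisson_const DIM('a) * ((N + 1) * 2 powr (N + 2) + (N + 1) * (N + 3) * 2 powr (N + 4)) * ?d * ?r powr (- (N + 2))"
    by (simp add: distrib_left distrib_right mult_ac)
  finally show ?thesis .
qed

text \<open>The power of \<open>rho\<close> is written as an integral over the radii r \<ge>
  \<open>rho\<close>, which reduces the potential to integrals of h over balls around y. Growth of
  these is assumed only for r > R. The choice R = t gives the ordinary potential estimate, and R
  equal to the distance of y from \<open>E\<close> the one needed for small t.\<close>

lemma nn_integral_rho_powr_le:
  fixes h :: "'a::euclidean_space \<Rightarrow> ennreal"
  assumes [measurable]: "h \<in> borel_measurable borel" and t: "0 < t" "t \<le> R" and a: "0 < a" and A: "0 \<le> A"
    and h: "\<And>r. R < r \<Longrightarrow> (\<integral>\<^sup>+z\<in>ball y r. h z \<partial>lborel) \<le> ennreal (A * r powr real DIM('a))"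
  defines "N \<equiv> real DIM('a)"
  shows "(\<integral>\<^sup>+z. h z * ennreal (rho t (y - z) powr (- (N + a))) \<partial>lborel)
     \<le> ennreal ((2 powr N + (N + a) / a) * A * R powr N * t powr (- (N + a)))"
proof -
  have N: "0 < N" by (simp add: N_def)
  have R: "0 < R" using t by simp
  have cake: "ennreal (x powr (- (N + a))) = (\<integral>\<^sup>+r. ennreal ((N + a) * r powr (- (N + a) - 1)) * (if x \<le> r then 1 else 0) \<partial>lborel)"
    if "0 < x" for x
  proof -
    have "(\<integral>\<^sup>+r. ennreal ((N + a) * r powr (- (N + a) - 1)) * (if x \<le> r then 1 else 0) \<partial>lborel)
      = (\<integral>\<^sup>+r. ennreal (N + a) * (ennreal (r powr (- (N + a) - 1)) * indicator {x..} r) \<partial>lborel)"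
      using N a by (intro nn_integral_cong) (auto simp: indicator_def ennreal_mult)
    also have "\<dots> = ennreal (N + a) * ennreal (x powr (- (N + a)) / (N + a))"
      using nn_integral_powr_atLeast[of x "N + a"] that N a by (subst nn_integral_cmult) auto
    also have "\<dots> = ennreal (x powr (- (N + a)))"
      using N a by (subst ennreal_mult''[symmetric]) auto
    finally show ?thesis by simp
  qed
  have "(\<integral>\<^sup>+z. h z * ennreal (rho t (y - z) powr (- (N + a))) \<partial>lborel)
     = (\<integral>\<^sup>+z. \<integral>\<^sup>+r. h z * (ennreal ((N + a) * r powr (- (N + a) - 1)) * (if rho t (y - z) \<le> r then 1 else 0)) \<partial>lborel \<partial>lborel)"
  proof (intro nn_integral_cong)
    fix z
    show "h z * ennreal (rho t (y - z) powr (- (N + a))) =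
      (\<integral>\<^sup>+r. h z * (ennreal ((N + a) * r powr (- (N + a) - 1)) * (if rho t (y - z) \<le> r then 1 else 0)) \<partial>lborel)"
      unfolding cake[OF rho_pos[OF t(1)]] by (rule nn_integral_cmult[symmetric]) measurable
  qed
  also have "\<dots> = (\<integral>\<^sup>+r. \<integral>\<^sup>+z. h z * (ennreal ((N + a) * r powr (- (N + a) - 1)) * (if rho t (y - z) \<le> r then 1 else 0)) \<partial>lborel \<partial>lborel)"
    by (intro lborel_pair.Fubini') measurable
  also have "\<dots> \<le> (\<integral>\<^sup>+r. ennreal (A * (2 * R) powr N * (N + a)) * (ennreal (r powr (- (N + a) - 1)) * indicator {t..} r) +
      ennreal (A * (N + a)) * (ennreal (r powr (- a - 1)) * indicator {R..} r) \<partial>lborel)"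
  proof (intro nn_integral_mono)
    fix r :: real
    let ?I = "\<integral>\<^sup>+z. h z * (ennreal ((N + a) * r powr (- (N + a) - 1)) * (if rho t (y - z) \<le> r then 1 else 0)) \<partial>lborel"
    have sub: "z \<in> ball y r \<and> t \<le> r" if "rho t (y - z) \<le> r" for z
      using that norm_less_rho[OF t(1), of "y - z"] le_rho[of t "y - z"] by (simp add: dist_norm)
    have "?I \<le> (\<integral>\<^sup>+z. ennreal ((N + a) * r powr (- (N + a) - 1)) * indicator {t..} r * (h z * indicator (ball y r) z) \<partial>lborel)"
      using sub by (intro nn_integral_mono) (auto simp: indicator_def ac_simps)
    also have "\<dots> = ennreal ((N + a) * r powr (- (N + a) - 1)) * indicator {t..} r * (\<integral>\<^sup>+z\<in>ball y r. h z \<partial>lborel)"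
      by (subst nn_integral_cmult) auto
    finally have I: "?I \<le> ennreal ((N + a) * r powr (- (N + a) - 1)) * indicator {t..} r * (\<integral>\<^sup>+z\<in>ball y r. h z \<partial>lborel)" .
    show "?I \<le> ennreal (A * (2 * R) powr N * (N + a)) * (ennreal (r powr (- (N + a) - 1)) * indicator {t..} r) +
      ennreal (A * (N + a)) * (ennreal (r powr (- a - 1)) * indicator {R..} r)"
    proof (cases "r \<le> R")
      \<comment> \<open>Radii in [t, R] are outside the assumption on h, so the ball is enlarged to
        radius 2 R; this is the origin of 2^N in the constant.\<close>
      case True
      have "(\<integral>\<^sup>+z\<in>ball y r. h z \<partial>lborel) \<le> (\<integral>\<^sup>+z\<in>ball y (2 * R). h z \<partial>lborel)"
        using True R by (intro nn_integral_mono) (auto simp: indicator_def)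
      also have "\<dots> \<le> ennreal (A * (2 * R) powr N)"
        unfolding N_def using R by (intro h) auto
      finally have "?I \<le> ennreal ((N + a) * r powr (- (N + a) - 1)) * indicator {t..} r * ennreal (A * (2 * R) powr N)"
        by (intro order_trans[OF I] mult_left_mono) auto
      also have "\<dots> = ennreal (A * (2 * R) powr N * (N + a)) * (ennreal (r powr (- (N + a) - 1)) * indicator {t..} r)"
        using N a A by (simp add: ennreal_mult' ennreal_mult'' ac_simps)
      finally show ?thesis
        by (rule order_trans) auto
    next
      case False
      have "?I \<le> ennreal ((N + a) * r powr (- (N + a) - 1)) * indicator {t..} r * ennreal (A * r powr N)"
        using False unfolding N_def by (intro order_trans[OF I[unfolded N_def]] mult_left_mono h) auto
      also have "\<dots> = ennreal (A * (N + a) * (r powr (- (N + a) - 1) * r powr N))"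
        using False t N a A by (simp add: ac_simps flip: ennreal_mult'')
      also have "r powr (- (N + a) - 1) * r powr N = r powr (- a - 1)"
        unfolding powr_add[symmetric] by simp
      also have "ennreal (A * (N + a) * r powr (- a - 1)) = ennreal (A * (N + a)) * (ennreal (r powr (- a - 1)) * indicator {R..} r)"
        using False by (simp add: ennreal_mult'')
      finally show ?thesis
        by (rule order_trans) auto
    qed
  qed
  also have "\<dots> = ennreal (A * (2 * R) powr N * (N + a)) * ennreal (t powr (- (N + a)) / (N + a)) + ennreal (A * (N + a)) * ennreal (R powr (- a) / a)"
    using nn_integral_powr_atLeast[of t "N + a"] nn_integral_powr_atLeast[of R a] t R N a
    by (simp add: nn_integral_add nn_integral_cmult)
  also have "\<dots> = ennreal (A * (2 * R) powr N * t powr (- (N + a)) + A * (N + a) / a * R powr (- a))"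
    using N a A by (simp flip: ennreal_mult'' ennreal_plus)
  also have "\<dots> \<le> ennreal ((2 powr N + (N + a) / a) * A * R powr N * t powr (- (N + a)))"
  proof (intro ennreal_leI)
    have "R powr (- a) = R powr N * R powr (- (N + a))"
      unfolding powr_add[symmetric] by simp
    also have "\<dots> \<le> R powr N * t powr (- (N + a))"
      using t N a by (intro mult_left_mono powr_mono2') auto
    finally have "A * (N + a) / a * R powr (- a) \<le> A * (N + a) / a * (R powr N * t powr (- (N + a)))"
      using N a A by (intro mult_left_mono) auto
    then show "A * (2 * R) powr N * t powr (- (N + a)) + A * (N + a) / a * R powr (- a) \<le> (2 powr N + (N + a) / a) * A * R powr N * t powr (- (N + a))"
      using R by (simp add: powr_mult algebra_simps)
  qed
  finally show ?thesis .
qed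

lemma nn_integral_rho_powr_le_1:
  fixes y :: "'a::euclidean_space"
  assumes t: "0 < t" and a: "0 < a"
  defines "N \<equiv> real DIM('a)"
  shows "(\<integral>\<^sup>+z. ennreal (rho t (y - z) powr (- (N + a))) \<partial>lborel)
    \<le> ennreal ((2 powr N + (N + a) / a) * unit_ball_vol N * t powr (- a))"
proof -
  have "(\<integral>\<^sup>+z. 1 * ennreal (rho t (y - z) powr (- (N + a))) \<partial>lborel)
    \<le> ennreal ((2 powr N + (N + a) / a) * unit_ball_vol N * t powr N * t powr (- (N + a)))"
    unfolding N_def
  proof (rule nn_integral_rho_powr_le)
    fix r assume "t < r"
    then show "(\<integral>\<^sup>+z\<in>ball y r. 1 \<partial>lborel) \<le> ennreal (unit_ball_vol (real DIM('a)) * r powr real DIM('a))"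
      using t by (simp add: emeasure_ball powr_realpow)
  qed (use t a in auto)
  moreover have "t powr N * t powr (- (N + a)) = t powr (- a)"
    unfolding powr_add[symmetric] by simp
  ultimately show ?thesis by (simp add: mult.assoc)
qed

lemma nn_integral_lborel_reflect:
  fixes f :: "'a::euclidean_space \<Rightarrow> ennreal"
  assumes [measurable]: "f \<in> borel_measurable borel"
  shows "(\<integral>\<^sup>+z. f (y - z) \<partial>lborel) = (\<integral>\<^sup>+z. f z \<partial>lborel)"
proof -
  have "lborel = distr lborel borel (\<lambda>x. y + (- 1) *\<^sub>R x)"
    using lborel_affine[of "- 1" y] by (simp add: density_1)
  then have "(\<integral>\<^sup>+z. f z \<partial>lborel) = (\<integral>\<^sup>+z. f z \<partial>distr lborel borel (\<lambda>x. y + (- 1) *\<^sub>R x))"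
    by simp
  also have "\<dots> = (\<integral>\<^sup>+z. f (y + (- 1) *\<^sub>R z) \<partial>lborel)"
    by (rule nn_integral_distr) measurable
  finally show ?thesis by simp
qed

section \<open>Differentiation under the integral sign, and the cancellation of the kernel\<close>

lemma poisson_kernel_diff_le:
  fixes x :: "'a::euclidean_space"
  assumes "0 < t" "t / 2 < t'"
  shows "\<bar>poisson_kernel t' x - poisson_kernel t x\<bar> \<le>
     poisson_const DIM('a) * (real DIM('a) + 2) * rho (t / 2) x powr (- (real DIM('a) + 1)) * \<bar>t' - t\<bar>"
proof -
  have "norm (poisson_kernel t' x - poisson_kernel t x) \<le>
     poisson_const DIM('a) * (real DIM('a) + 2) * rho (t / 2) x powr (- (real DIM('a) + 1)) * norm (t' - t)"
  proof (rule field_differentiable_bound[of "{t/2<..}" _ "\<lambda>\<tau>. dker \<tau> x"])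
    fix \<tau> assume "\<tau> \<in> {t/2<..}"
    then have \<tau>: "t / 2 < \<tau>" "0 < \<tau>" using assms by auto
    show "((\<lambda>\<tau>. poisson_kernel \<tau> x) has_field_derivative dker \<tau> x) (at \<tau> within {t/2<..})"
      by (intro has_field_derivative_at_within[OF has_derivative_poisson_kernel] \<tau>)
    have "rho \<tau> x powr (- (real DIM('a) + 1)) \<le> rho (t / 2) x powr (- (real DIM('a) + 1))"
      using \<tau> assms by (intro powr_mono2' rho_mono rho_pos) auto
    then show "norm (dker \<tau> x) \<le> poisson_const DIM('a) * (real DIM('a) + 2) * rho (t / 2) x powr (- (real DIM('a) + 1))"
      using abs_dker_le[OF \<tau>(2), of x] poisson_const_pos[of "DIM('a)"]
      by (auto elim!: order_trans intro!: mult_left_mono)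
  qed (use assms in auto)
  then show ?thesis by simp
qed

text \<open>Dominated convergence of the difference quotients along sequences. The majorant lives at
  height t/2, which is why finiteness is assumed for every positive height and not only at
  t.\<close>

lemma poisson_integral_has_derivative:
  fixes f :: "'a::euclidean_space \<Rightarrow> real"
  assumes [measurable]: "f \<in> borel_measurable borel"
    and fin: "\<And>t. 0 < t \<Longrightarrow> (\<integral>\<^sup>+z. ennreal (\<bar>f z\<bar> * rho t (y - z) powr (- (real DIM('a) + 1))) \<partial>lborel) < \<infinity>"
    and t: "0 < t"
  shows "((\<lambda>\<tau>. poisson_integral f y \<tau>) has_real_derivative (\<integral>z. f z * dker t (y - z) \<partial>lborel)) (at t)"
proof -
  let ?N = "real DIM('a)" and ?c = "poisson_const DIM('a)"
  have int_rho: "integrable lborel (\<lambda>z. f z * rho \<tau> (y - z) powr (- (?N + 1)))" if "0 < \<tau>" for \<tau>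
    using fin[OF that] by (intro integrableI_bounded) (auto simp: abs_mult)
  have int_P: "integrable lborel (\<lambda>z. f z * poisson_kernel \<tau> (y - z))" if "0 < \<tau>" for \<tau>
  proof -
    have "integrable lborel (\<lambda>z. (?c * \<tau>) * (f z * rho \<tau> (y - z) powr (- (?N + 1))))"
      by (intro integrable_mult_right int_rho that)
    then show ?thesis
      using that by (simp add: poisson_kernel_eq ac_simps)
  qed
  have pi: "poisson_integral f y \<tau> = (\<integral>z. f z * poisson_kernel \<tau> (y - z) \<partial>lborel)" for \<tau>
    unfolding poisson_integral_def by (intro integral_completion) measurable
  \<comment> \<open>Increments in this window keep t + h above t/2, where
    \<open>poisson_kernel_diff_le\<close> gives one majorant for all of them. As 0 is an interior
    point, nothing is lost for the limit.\<close>
  let ?S = "{- t/2<..<t/2}"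
  have "((\<lambda>h. (poisson_integral f y (t + h) - poisson_integral f y t) / h) \<longlongrightarrow> (\<integral>z. f z * dker t (y - z) \<partial>lborel)) (at 0 within ?S)"
    unfolding tendsto_at_iff_sequentially
  proof (intro allI impI)
    fix X :: "nat \<Rightarrow> real" assume X: "\<forall>i. X i \<in> ?S - {0}" and lim: "X \<longlonglongrightarrow> 0"
    have Xi: "- t / 2 < X i" "X i < t / 2" "X i \<noteq> 0" for i
      using X[rule_format, of i] by auto
    have eq: "((\<lambda>h. (poisson_integral f y (t + h) - poisson_integral f y t) / h) \<circ> X) =
       (\<lambda>i. \<integral>z. f z * ((poisson_kernel (t + X i) (y - z) - poisson_kernel t (y - z)) / X i) \<partial>lborel)"
    proof
      fix i
      have "0 < t + X i" using Xi(1)[of i] t by linarith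
      then have "poisson_integral f y (t + X i) - poisson_integral f y t =
         (\<integral>z. f z * poisson_kernel (t + X i) (y - z) - f z * poisson_kernel t (y - z) \<partial>lborel)"
        unfolding pi using t by (intro Bochner_Integration.integral_diff[symmetric] int_P)
      then show "((\<lambda>h. (poisson_integral f y (t + h) - poisson_integral f y t) / h) \<circ> X) i =
         (\<integral>z. f z * ((poisson_kernel (t + X i) (y - z) - poisson_kernel t (y - z)) / X i) \<partial>lborel)"
        by (simp add: right_diff_distrib flip: integral_divide_zero)
    qed
    show "((\<lambda>h. (poisson_integral f y (t + h) - poisson_integral f y t) / h) \<circ> X) \<longlonglongrightarrow> (\<integral>z. f z * dker t (y - z) \<partial>lborel)"
      unfolding eq
    proof (rule integral_dominated_convergence[where w = "\<lambda>z. (?c * (?N + 2)) * \<bar>f z * rho (t / 2) (y - z) powr (- (?N + 1))\<bar>"])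
      show "integrable lborel (\<lambda>z. (?c * (?N + 2)) * \<bar>f z * rho (t / 2) (y - z) powr (- (?N + 1))\<bar>)"
        using t by (intro integrable_mult_right integrable_abs int_rho) auto
      show "AE z in lborel. (\<lambda>i. f z * ((poisson_kernel (t + X i) (y - z) - poisson_kernel t (y - z)) / X i)) \<longlonglongrightarrow> f z * dker t (y - z)"
      proof (intro AE_I2 tendsto_mult_left)
        fix z
        have "((\<lambda>h. (poisson_kernel (t + h) (y - z) - poisson_kernel t (y - z)) / h) \<longlongrightarrow> dker t (y - z)) (at 0)"
          using has_derivative_poisson_kernel[OF t, of "y - z"] by (simp add: DERIV_def)
        then show "(\<lambda>i. (poisson_kernel (t + X i) (y - z) - poisson_kernel t (y - z)) / X i) \<longlonglongrightarrow> dker t (y - z)"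
          using lim Xi(3) unfolding tendsto_at_iff_sequentially by (auto simp: o_def)
      qed
      show "AE z in lborel. norm (f z * ((poisson_kernel (t + X i) (y - z) - poisson_kernel t (y - z)) / X i))
         \<le> (?c * (?N + 2)) * \<bar>f z * rho (t / 2) (y - z) powr (- (?N + 1))\<bar>" for i
      proof (intro AE_I2)
        fix z
        have "\<bar>poisson_kernel (t + X i) (y - z) - poisson_kernel t (y - z)\<bar> \<le> ?c * (?N + 2) * rho (t / 2) (y - z) powr (- (?N + 1)) * \<bar>t + X i - t\<bar>"
          using Xi(1)[of i] by (intro poisson_kernel_diff_le t) auto
        then have "\<bar>poisson_kernel (t + X i) (y - z) - poisson_kernel t (y - z)\<bar> / \<bar>X i\<bar> \<le> ?c * (?N + 2) * rho (t / 2) (y - z) powr (- (?N + 1))"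
          using Xi(3)[of i] by (simp add: divide_le_eq)
        then have "\<bar>f z\<bar> * (\<bar>poisson_kernel (t + X i) (y - z) - poisson_kernel t (y - z)\<bar> / \<bar>X i\<bar>) \<le> \<bar>f z\<bar> * (?c * (?N + 2) * rho (t / 2) (y - z) powr (- (?N + 1)))"
          by (intro mult_left_mono) auto
        then show "norm (f z * ((poisson_kernel (t + X i) (y - z) - poisson_kernel t (y - z)) / X i))
         \<le> (?c * (?N + 2)) * \<bar>f z * rho (t / 2) (y - z) powr (- (?N + 1))\<bar>"
          by (simp add: abs_mult mult_ac)
      qed
    qed measurable
  qed
  moreover have "at 0 within ?S = at 0"
    using t by (intro at_within_open) auto
  ultimately show ?thesis
    by (simp add: DERIV_def)
qed

text \<open>The substitution of t r for r in polar coordinates. That the mass does not depend on t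
  is what makes the integral of its t-derivative vanish.\<close>

lemma nn_integral_poisson_kernel:
  assumes t: "0 < t"
  shows "(\<integral>\<^sup>+x. ennreal (poisson_kernel t (x::'a::euclidean_space)) \<partial>lborel) = (\<integral>\<^sup>+x. ennreal (poisson_kernel 1 (x::'a)) \<partial>lborel)"
proof -
  let ?N = "real DIM('a)" and ?c = "poisson_const DIM('a)" and ?w = "unit_ball_vol (real DIM('a))"
  define \<phi> where "\<phi> = (\<lambda>t r. ennreal (?c * t * (t\<^sup>2 + r\<^sup>2) powr (- (?N + 1) / 2)))"
  have [measurable]: "\<phi> t \<in> borel_measurable borel" for t
    unfolding \<phi>_def by measurable
  have k: "ennreal (poisson_kernel t (x::'a)) = \<phi> t (norm x)" for t x
    by (simp add: poisson_kernel_def \<phi>_def)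
  have "(\<integral>\<^sup>+x. ennreal (poisson_kernel t (x::'a)) \<partial>lborel) = (\<integral>\<^sup>+r. ennreal (?N * ?w * r powr (?N - 1)) * indicator {0<..} r * \<phi> t r \<partial>lborel)"
    unfolding k by (intro nn_integral_norm) measurable
  also have "\<dots> = ennreal \<bar>t\<bar> * (\<integral>\<^sup>+r. ennreal (?N * ?w * (0 + t * r) powr (?N - 1)) * indicator {0<..} (0 + t * r) * \<phi> t (0 + t * r) \<partial>lborel)"
    using t by (intro nn_integral_real_affine) auto
  also have "\<dots> = (\<integral>\<^sup>+r. ennreal t * (ennreal (?N * ?w * (t * r) powr (?N - 1)) * indicator {0<..} (t * r) * \<phi> t (t * r)) \<partial>lborel)"
    using t by (subst nn_integral_cmult) auto
  also have "\<dots> = (\<integral>\<^sup>+r. ennreal (?N * ?w * r powr (?N - 1)) * indicator {0<..} r * \<phi> 1 r \<partial>lborel)"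
  proof (intro nn_integral_cong)
    fix r
    show "ennreal t * (ennreal (?N * ?w * (t * r) powr (?N - 1)) * indicator {0<..} (t * r) * \<phi> t (t * r)) =
       ennreal (?N * ?w * r powr (?N - 1)) * indicator {0<..} r * \<phi> 1 r"
    proof (cases "0 < r")
      case True
      have s: "t\<^sup>2 + (t * r)\<^sup>2 = t\<^sup>2 * (1\<^sup>2 + r\<^sup>2)"
        by (simp add: power_mult_distrib algebra_simps)
      have p: "(t\<^sup>2 * (1\<^sup>2 + r\<^sup>2)) powr (- (?N + 1) / 2) = t powr (- (?N + 1)) * (1\<^sup>2 + r\<^sup>2) powr (- (?N + 1) / 2)"
      proof -
        have "(t\<^sup>2) powr (- (?N + 1) / 2) = t powr (- (?N + 1))"
        proof -
          have "(t\<^sup>2) powr (- (?N + 1) / 2) = (t powr 2) powr (- (?N + 1) / 2)"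
            using t by simp
          also have "\<dots> = t powr (2 * (- (?N + 1) / 2))"
            by (rule powr_powr)
          finally show ?thesis by (simp only: nonzero_mult_div_cancel_left times_divide_eq_right)
        qed
        then show ?thesis
          by (simp add: powr_mult)
      qed
      have tt: "t * t powr (?N - 1) * t * t powr (- (?N + 1)) = 1"
      proof -
        have "t * t powr (?N - 1) * t * t powr (- (?N + 1)) = t powr 1 * t powr (?N - 1) * t powr 1 * t powr (- (?N + 1))"
          using t by simp
        also have "\<dots> = 1"
          unfolding powr_add[symmetric] using t by simp
        finally show ?thesis .
      qed
      have "t * (?N * ?w * (t * r) powr (?N - 1)) * (?c * t * (t\<^sup>2 + (t * r)\<^sup>2) powr (- (?N + 1) / 2))
        = (t * t powr (?N - 1) * t * t powr (- (?N + 1))) * ((?N * ?w * r powr (?N - 1)) * (?c * 1 * (1\<^sup>2 + r\<^sup>2) powr (- (?N + 1) / 2)))"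
        unfolding s p using t True by (simp only: powr_mult mult_ac)
      also have "\<dots> = (?N * ?w * r powr (?N - 1)) * (?c * 1 * (1\<^sup>2 + r\<^sup>2) powr (- (?N + 1) / 2))"
        unfolding tt by simp
      finally have "ennreal (t * (?N * ?w * (t * r) powr (?N - 1)) * (?c * t * (t\<^sup>2 + (t * r)\<^sup>2) powr (- (?N + 1) / 2)))
        = ennreal ((?N * ?w * r powr (?N - 1)) * (?c * 1 * (1\<^sup>2 + r\<^sup>2) powr (- (?N + 1) / 2)))"
        by (rule arg_cong)
      moreover have "0 \<le> ?c * t * (t\<^sup>2 + (t * r)\<^sup>2) powr (- (?N + 1) / 2)" "0 \<le> ?c * 1 * (1\<^sup>2 + r\<^sup>2) powr (- (?N + 1) / 2)"
        "0 \<le> ?N * ?w * (t * r) powr (?N - 1)"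
        using poisson_const_pos[of "DIM('a)"] t by (auto intro!: mult_nonneg_nonneg)
      ultimately show ?thesis
        using True t unfolding \<phi>_def by (simp only: ennreal_mult'' mult_1_right indicator_def) (simp add: mult.assoc)
    qed (use t in \<open>auto simp: indicator_def zero_less_mult_iff\<close>)
  qed
  also have "\<dots> = (\<integral>\<^sup>+x. ennreal (poisson_kernel 1 (x::'a)) \<partial>lborel)"
    unfolding k by (intro nn_integral_norm[symmetric]) measurable
  finally show ?thesis .
qed

text \<open>The Poisson extension of the constant 1 is constant in t, whereas differentiating under
  the integral sign gives the integral of \<open>dker\<close>.\<close>

lemma integral_dker_eq_0:
  fixes y :: "'a::euclidean_space"
  assumes t: "0 < t"
  shows "(\<integral>z. dker t (y - z) \<partial>lborel) = 0"
proof -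
  have fin: "(\<integral>\<^sup>+z. ennreal (\<bar>1\<bar> * rho t (y - z) powr (- (real DIM('a) + 1))) \<partial>lborel) < \<infinity>" if "0 < t" for t
    using nn_integral_rho_powr_le_1[OF that, of 1 y] by (simp add: order_le_less_trans)
  have c: "poisson_integral (\<lambda>_. 1) y \<tau> = enn2real (\<integral>\<^sup>+x. ennreal (poisson_kernel 1 (x::'a)) \<partial>lborel)" if "0 < \<tau>" for \<tau>
  proof -
    have "poisson_integral (\<lambda>_. 1) y \<tau> = (\<integral>z. poisson_kernel \<tau> (y - z) \<partial>lborel)"
      unfolding poisson_integral_def by (subst integral_completion) auto
    also have "\<dots> = enn2real (\<integral>\<^sup>+z. ennreal (poisson_kernel \<tau> (y - z)) \<partial>lborel)"
      using poisson_kernel_nonneg[OF that] by (intro integral_eq_nn_integral) auto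
    also have "(\<integral>\<^sup>+z. ennreal (poisson_kernel \<tau> (y - z)) \<partial>lborel) = (\<integral>\<^sup>+z. ennreal (poisson_kernel \<tau> (z::'a)) \<partial>lborel)"
      by (rule nn_integral_lborel_reflect) measurable
    finally show ?thesis
      by (simp add: nn_integral_poisson_kernel[OF that])
  qed
  have "((\<lambda>\<tau>. poisson_integral (\<lambda>_. 1) y \<tau>) has_real_derivative (\<integral>z. 1 * dker t (y - z) \<partial>lborel)) (at t)"
    by (rule poisson_integral_has_derivative[OF _ fin t]) auto
  moreover have "((\<lambda>\<tau>. poisson_integral (\<lambda>_. 1) y \<tau>) has_real_derivative 0) (at t)"
  proof (rule DERIV_cong_ev[THEN iffD1, OF refl _ refl DERIV_const])
    show "\<forall>\<^sub>F x in nhds t. enn2real (\<integral>\<^sup>+x. ennreal (poisson_kernel 1 (x::'a)) \<partial>lborel) = poisson_integral (\<lambda>_. 1) y x"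
      using c eventually_nhds_in_open[of "{0<..}" t] t by (auto elim!: eventually_mono)
  qed
  ultimately show ?thesis
    using DERIV_unique by fastforce
qed

text \<open>The square roots are deliberate. As \<open>dker\<close> decays like |x|^(-n-1), its
  first absolute moment diverges logarithmically, while the moment of order 1/2 is finite. The last
  bound is the matching Holder continuity of order 1/2 of translation in L^1. Together they give a
  power gain in the convolution of two kernels.\<close>

lemma dker_bounds:
  obtains C where "0 < C" "\<And>t x. 0 < t \<Longrightarrow> \<bar>dker t (x::'a::euclidean_space)\<bar> \<le> C * rho t x powr (- (real DIM('a) + 1))"
    "\<And>t x y. 0 < t \<Longrightarrow> norm (x - y) \<le> rho t x / 2 \<Longrightarrow>
        \<bar>dker t (x::'a) - dker t y\<bar> \<le> C * norm (x - y) * rho t x powr (- (real DIM('a) + 2))"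
    "\<And>t y. 0 < t \<Longrightarrow> (\<integral>\<^sup>+z. ennreal \<bar>dker t ((y::'a) - z)\<bar> \<partial>lborel) \<le> ennreal (C / t)"
    "\<And>t y. 0 < t \<Longrightarrow> (\<integral>\<^sup>+z. ennreal (\<bar>dker t ((y::'a) - z)\<bar> * sqrt (norm (y - z))) \<partial>lborel) \<le> ennreal (C / sqrt t)"
    "\<And>t a b. 0 < t \<Longrightarrow> (\<integral>\<^sup>+x. ennreal \<bar>dker t (x - (a::'a)) - dker t (x - b)\<bar> \<partial>lborel) \<le> ennreal (C * sqrt (norm (a - b)) / (t * sqrt t))"
proof -
  let ?N = "real DIM('a)" and ?c = "poisson_const DIM('a)" and ?w = "unit_ball_vol (real DIM('a))"
  define C1 where "C1 = ?c * (?N + 2)"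
  define C2 where "C2 = ?c * ((?N + 1) * 2 powr (?N + 2) + (?N + 1) * (?N + 3) * 2 powr (?N + 4))"
  define k where "k = (\<lambda>a. (2 powr ?N + (?N + a) / a) * ?w)"
  have pos: "0 < C1" "0 < C2" "0 < k 1" "0 < k 2" "0 < k (1/2)"
    using poisson_const_pos[of "DIM('a)"] by (auto simp: C1_def C2_def k_def intro!: mult_pos_pos add_pos_pos)
  have b1: "\<bar>dker t (x::'a)\<bar> \<le> C1 * rho t x powr (- (?N + 1))" if "0 < t" for t x
    using abs_dker_le[OF that, of x] by (simp add: C1_def)
  have b2: "\<bar>dker t (x::'a) - dker t y\<bar> \<le> C2 * norm (x - y) * rho t x powr (- (?N + 2))"
    if "0 < t" "norm (x - y) \<le> rho t x / 2" for t x y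
    using abs_dker_diff_le[OF that] by (simp add: C2_def)
  have I: "(\<integral>\<^sup>+z. ennreal (m * rho t ((y::'a) - z) powr (- (?N + a))) \<partial>lborel) \<le> ennreal (m * k a * t powr (- a))"
    if "0 < t" "0 < a" "0 \<le> m" for t y a m
  proof -
    have "(\<integral>\<^sup>+z. ennreal (m * rho t (y - z) powr (- (?N + a))) \<partial>lborel) = ennreal m * (\<integral>\<^sup>+z. ennreal (rho t (y - z) powr (- (?N + a))) \<partial>lborel)"
      using that by (subst nn_integral_cmult[symmetric]) (auto simp: ennreal_mult)
    also have "\<dots> \<le> ennreal m * ennreal (k a * t powr (- a))"
      unfolding k_def by (intro mult_left_mono nn_integral_rho_powr_le_1 that) auto
    also have "\<dots> = ennreal (m * k a * t powr (- a))"
      using that by (simp add: mult.assoc ennreal_mult')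
    finally show ?thesis .
  qed
  have i1: "(\<integral>\<^sup>+z. ennreal \<bar>dker t ((y::'a) - z)\<bar> \<partial>lborel) \<le> ennreal (C1 * k 1 / t)" if "0 < t" for t y
  proof -
    have "(\<integral>\<^sup>+z. ennreal \<bar>dker t (y - z)\<bar> \<partial>lborel) \<le> (\<integral>\<^sup>+z. ennreal (C1 * rho t (y - z) powr (- (?N + 1))) \<partial>lborel)"
      by (intro nn_integral_mono ennreal_leI b1 that)
    also have "\<dots> \<le> ennreal (C1 * k 1 * t powr (- 1))"
      using pos by (intro I that) auto
    finally show ?thesis
      using that by (simp add: powr_minus_divide)
  qed
  have i2: "(\<integral>\<^sup>+z. ennreal (\<bar>dker t ((y::'a) - z)\<bar> * sqrt (norm (y - z))) \<partial>lborel) \<le> ennreal (C1 * k (1/2) / sqrt t)" if t: "0 < t" for t y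
  proof -
    have "(\<integral>\<^sup>+z. ennreal (\<bar>dker t (y - z)\<bar> * sqrt (norm (y - z))) \<partial>lborel) \<le> (\<integral>\<^sup>+z. ennreal (C1 * rho t (y - z) powr (- (?N + 1/2))) \<partial>lborel)"
    proof (intro nn_integral_mono ennreal_leI)
      fix z
      let ?r = "rho t (y - z)"
      have "\<bar>dker t (y - z)\<bar> * sqrt (norm (y - z)) \<le> (C1 * ?r powr (- (?N + 1))) * ?r powr (1/2)"
        using norm_le_rho[of "y - z" t] pos by (intro mult_mono b1 t) (auto simp: powr_half_sqrt)
      also have "\<dots> = C1 * ?r powr (- (?N + 1/2))"
        unfolding mult.assoc powr_add[symmetric]
        by (rule arg_cong[where f = "\<lambda>e. C1 * ?r powr e"]) simp
      finally show "\<bar>dker t (y - z)\<bar> * sqrt (norm (y - z)) \<le> C1 * ?r powr (- (?N + 1/2))" .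
    qed
    also have "\<dots> \<le> ennreal (C1 * k (1/2) * t powr (- (1/2)))"
      using pos by (intro I t) auto
    finally show ?thesis
      using t by (simp add: powr_minus_divide powr_half_sqrt)
  qed
  have i3: "(\<integral>\<^sup>+x. ennreal \<bar>dker t (x - (a::'a)) - dker t (x - b)\<bar> \<partial>lborel) \<le> ennreal ((C2 * k 2 + 4 * C1 * k 1) * sqrt (norm (a - b)) / (t * sqrt t))"
    if t: "0 < t" for t a b
  \<comment> \<open>For a shift of at most t/2 \<le> \<open>rho\<close> / 2 the pointwise difference
    bound applies, and one of the two roots of |a - b| is traded for that of t. For a larger shift
    the triangle inequality suffices, because sqrt t / 2 \<le> sqrt |a - b|; this costs the factor
    4.\<close>
  proof (cases "norm (a - b) \<le> t / 2")
    case True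
    let ?d = "norm (a - b)"
    have "(\<integral>\<^sup>+x. ennreal \<bar>dker t (x - a) - dker t (x - b)\<bar> \<partial>lborel) \<le> (\<integral>\<^sup>+x. ennreal ((C2 * ?d) * rho t (a - x) powr (- (?N + 2))) \<partial>lborel)"
    proof (intro nn_integral_mono ennreal_leI)
      fix x
      have "norm (x - a - (x - b)) = ?d"
        by (simp add: norm_minus_commute)
      then show "\<bar>dker t (x - a) - dker t (x - b)\<bar> \<le> (C2 * ?d) * rho t (a - x) powr (- (?N + 2))"
        using b2[OF t, of "x - a" "x - b"] True le_rho[of t "x - a"] by (simp add: rho_minus_commute[of t a x])
    qed
    also have "\<dots> \<le> ennreal ((C2 * ?d) * k 2 * t powr (- 2))"
      using pos by (intro I t) auto
    also have "\<dots> \<le> ennreal ((C2 * k 2 + 4 * C1 * k 1) * sqrt ?d / (t * sqrt t))"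
    proof (intro ennreal_leI)
      have s: "sqrt ?d \<le> sqrt t" using True t by (intro real_sqrt_le_mono) auto
      have "?d * t powr (- 2) = sqrt ?d * sqrt ?d / (t * (sqrt t * sqrt t))"
        using t by (simp add: powr_minus_divide power2_eq_square)
      also have "\<dots> \<le> sqrt ?d * sqrt t / (t * (sqrt t * sqrt t))"
        using s t by (intro divide_right_mono mult_left_mono) auto
      also have "\<dots> = sqrt ?d / (t * sqrt t)"
        using t by (simp only: mult.assoc[symmetric]) simp
      finally have "?d * t powr (- 2) \<le> sqrt ?d / (t * sqrt t)" .
      then have "(C2 * k 2) * (?d * t powr (- 2)) \<le> (C2 * k 2 + 4 * C1 * k 1) * (sqrt ?d / (t * sqrt t))"
        using pos t by (intro mult_mono) auto
      then show "C2 * ?d * k 2 * t powr (- 2) \<le> (C2 * k 2 + 4 * C1 * k 1) * sqrt ?d / (t * sqrt t)"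
        by (simp add: mult_ac)
    qed
    finally show ?thesis .
  next
    case False
    let ?d = "norm (a - b)"
    have "(\<integral>\<^sup>+x. ennreal \<bar>dker t (x - a) - dker t (x - b)\<bar> \<partial>lborel) \<le> (\<integral>\<^sup>+x. ennreal \<bar>dker t (a - x)\<bar> + ennreal \<bar>dker t (b - x)\<bar> \<partial>lborel)"
      by (intro nn_integral_mono) (auto simp: dker_minus_commute[of t a] dker_minus_commute[of t b] simp flip: ennreal_plus intro!: ennreal_leI)
    also have "\<dots> = (\<integral>\<^sup>+x. ennreal \<bar>dker t (a - x)\<bar> \<partial>lborel) + (\<integral>\<^sup>+x. ennreal \<bar>dker t (b - x)\<bar> \<partial>lborel)"
      by (intro nn_integral_add) auto
    also have "\<dots> \<le> ennreal (C1 * k 1 / t) + ennreal (C1 * k 1 / t)"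
      by (intro add_mono i1 t)
    also have "\<dots> = ennreal (2 * C1 * k 1 / t)"
      using pos t by (simp flip: ennreal_plus)
    also have "\<dots> \<le> ennreal ((C2 * k 2 + 4 * C1 * k 1) * sqrt ?d / (t * sqrt t))"
    proof (intro ennreal_leI)
      have "sqrt t / 2 = sqrt (t / 4)"
        by (simp add: real_sqrt_divide)
      also have "\<dots> \<le> sqrt ?d"
        using False t by (intro real_sqrt_le_mono) auto
      finally have s: "sqrt t / 2 \<le> sqrt ?d" .
      have "2 * C1 * k 1 / t = (4 * C1 * k 1) * ((sqrt t / 2) / (t * sqrt t))"
        using t by simp
      also have "\<dots> \<le> (C2 * k 2 + 4 * C1 * k 1) * (sqrt ?d / (t * sqrt t))"
        using s t pos by (intro mult_mono divide_right_mono) auto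
      finally show "2 * C1 * k 1 / t \<le> (C2 * k 2 + 4 * C1 * k 1) * sqrt ?d / (t * sqrt t)"
        by simp
    qed
    finally show ?thesis .
  qed
  define C where "C = C1 + C2 + C1 * k 1 + C1 * k (1/2) + (C2 * k 2 + 4 * C1 * k 1)"
  have Cp: "0 < C1 * k 1" "0 < C1 * k (1/2)" "0 < C2 * k 2"
    using pos by auto
  then have C: "0 < C" "C1 \<le> C" "C2 \<le> C" "C1 * k 1 \<le> C" "C1 * k (1/2) \<le> C" "C2 * k 2 + 4 * C1 * k 1 \<le> C"
    using pos unfolding C_def by linarith+
  show thesis
  proof (rule that[OF C(1)])
    show "\<bar>dker t (x::'a)\<bar> \<le> C * rho t x powr (- (?N + 1))" if "0 < t" for t x
      using b1[OF that, of x] C by (auto elim!: order_trans intro!: mult_right_mono)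
    show "\<bar>dker t (x::'a) - dker t y\<bar> \<le> C * norm (x - y) * rho t x powr (- (?N + 2))"
      if "0 < t" "norm (x - y) \<le> rho t x / 2" for t x y
      using b2[OF that] C by (auto elim!: order_trans intro!: mult_right_mono)
    show "(\<integral>\<^sup>+z. ennreal \<bar>dker t ((y::'a) - z)\<bar> \<partial>lborel) \<le> ennreal (C / t)" if "0 < t" for t y
      using that C by (intro order_trans[OF i1] ennreal_leI divide_right_mono) auto
    show "(\<integral>\<^sup>+z. ennreal (\<bar>dker t ((y::'a) - z)\<bar> * sqrt (norm (y - z))) \<partial>lborel) \<le> ennreal (C / sqrt t)" if "0 < t" for t y
      using that C by (intro order_trans[OF i2] ennreal_leI divide_right_mono) auto
    show "(\<integral>\<^sup>+x. ennreal \<bar>dker t (x - (a::'a)) - dker t (x - b)\<bar> \<partial>lborel) \<le> ennreal (C * sqrt (norm (a - b)) / (t * sqrt t))" if "0 < t" for t a b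
      using that C by (intro order_trans[OF i3] ennreal_leI divide_right_mono mult_right_mono) auto
  qed
qed

section \<open>Boundedness of the Littlewood-Paley operator\<close>

text \<open>Almost orthogonality. The kernel at the smaller height has integral zero, so a value of
  the other kernel may be subtracted for free; the difference is small in L^1 by Holder continuity,
  and the half moment of the concentrated kernel measures by how much. After multiplication by t t'
  the bound is the square root of the ratio of the smaller to the larger height. \<open>key\<close>
  is for t \<le> t', \<open>key2\<close> for the opposite case.\<close>

lemma dker_convolution_bound:
  obtains C where "0 < C" "\<And>t t' y. 0 < t \<Longrightarrow> 0 < t' \<Longrightarrow>
     (\<integral>\<^sup>+y'. ennreal \<bar>\<integral>z. dker t ((y::'a::euclidean_space) - z) * dker t' (y' - z) \<partial>lborel\<bar> \<partial>lborel)
       \<le> ennreal (C * (if t \<le> t' then 1 / (sqrt t * (t' * sqrt t')) else 1 / (sqrt t' * (t * sqrt t))))"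
proof -
  obtain C where C: "0 < C" "\<And>t x. 0 < t \<Longrightarrow> \<bar>dker t (x::'a::euclidean_space)\<bar> \<le> C * rho t x powr (- (real DIM('a) + 1))"
    and L1: "\<And>t y. 0 < t \<Longrightarrow> (\<integral>\<^sup>+z. ennreal \<bar>dker t ((y::'a) - z)\<bar> \<partial>lborel) \<le> ennreal (C / t)"
    and half: "\<And>t y. 0 < t \<Longrightarrow> (\<integral>\<^sup>+z. ennreal (\<bar>dker t ((y::'a) - z)\<bar> * sqrt (norm (y - z))) \<partial>lborel) \<le> ennreal (C / sqrt t)"
    and lip: "\<And>t a b. 0 < t \<Longrightarrow> (\<integral>\<^sup>+x. ennreal \<bar>dker t (x - (a::'a)) - dker t (x - b)\<bar> \<partial>lborel) \<le> ennreal (C * sqrt (norm (a - b)) / (t * sqrt t))"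
    by (rule dker_bounds) blast
  have int: "integrable lborel (\<lambda>z. dker t ((y::'a) - z))" if "0 < t" for t y
    using L1[OF that, of y] by (intro integrableI_bounded) (auto simp: order_le_less_trans)
  have bdd: "\<bar>dker t (x::'a)\<bar> \<le> C * t powr (- (real DIM('a) + 1))" if "0 < t" for t x
    using C(2)[OF that, of x] C(1) le_rho[of t x] that
    by (auto elim!: order_trans intro!: mult_left_mono powr_mono2')
  have int2: "integrable lborel (\<lambda>z. dker t ((y::'a) - z) * dker t' (y' - z))" if "0 < t" "0 < t'" for t t' y y'
  proof (rule Bochner_Integration.integrable_bound[OF integrable_mult_left[OF integrable_abs[OF int[OF that(1), of y]], of "C * t' powr (- (real DIM('a) + 1))"]])
    show "AE z in lborel. norm (dker t (y - z) * dker t' (y' - z)) \<le> norm (\<bar>dker t (y - z)\<bar> * (C * t' powr (- (real DIM('a) + 1))))"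
      using bdd[OF that(2)] C(1) by (intro AE_I2) (auto simp: abs_mult intro!: mult_left_mono)
  qed measurable
  have key: "(\<integral>\<^sup>+y'. ennreal \<bar>\<integral>z. dker t ((y::'a) - z) * dker t' (y' - z) \<partial>lborel\<bar> \<partial>lborel) \<le> ennreal (C * C * (1 / (sqrt t * (t' * sqrt t'))))"
    if t: "0 < t" "0 < t'" for t t' y
  proof -
    have "ennreal \<bar>\<integral>z. dker t (y - z) * dker t' (y' - z) \<partial>lborel\<bar> \<le> (\<integral>\<^sup>+z. ennreal \<bar>dker t (y - z)\<bar> * ennreal \<bar>dker t' (y' - z) - dker t' (y' - y)\<bar> \<partial>lborel)" for y'
    proof -
      have "(\<integral>z. dker t (y - z) * dker t' (y' - z) \<partial>lborel)
        = (\<integral>z. dker t (y - z) * dker t' (y' - z) \<partial>lborel) - (\<integral>z. dker t (y - z) * dker t' (y' - y) \<partial>lborel)"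
        using integral_dker_eq_0[OF t(1), of y] by simp
      also have "\<dots> = (\<integral>z. dker t (y - z) * dker t' (y' - z) - dker t (y - z) * dker t' (y' - y) \<partial>lborel)"
        using t by (intro Bochner_Integration.integral_diff[symmetric] int2 integrable_mult_left int)
      also have "\<dots> = (\<integral>z. dker t (y - z) * (dker t' (y' - z) - dker t' (y' - y)) \<partial>lborel)"
        by (simp add: right_diff_distrib)
      finally have "(\<integral>z. dker t (y - z) * dker t' (y' - z) \<partial>lborel) = (\<integral>z. dker t (y - z) * (dker t' (y' - z) - dker t' (y' - y)) \<partial>lborel)" .
      then show ?thesis
        using abs_integral_le_nn_integral[of lborel "\<lambda>z. dker t (y - z) * (dker t' (y' - z) - dker t' (y' - y))"]
        by (simp add: abs_mult ennreal_mult)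
    qed
    then have "(\<integral>\<^sup>+y'. ennreal \<bar>\<integral>z. dker t (y - z) * dker t' (y' - z) \<partial>lborel\<bar> \<partial>lborel)
      \<le> (\<integral>\<^sup>+y'. \<integral>\<^sup>+z. ennreal \<bar>dker t (y - z)\<bar> * ennreal \<bar>dker t' (y' - z) - dker t' (y' - y)\<bar> \<partial>lborel \<partial>lborel)"
      by (intro nn_integral_mono)
    also have "\<dots> = (\<integral>\<^sup>+z. \<integral>\<^sup>+y'. ennreal \<bar>dker t (y - z)\<bar> * ennreal \<bar>dker t' (y' - z) - dker t' (y' - y)\<bar> \<partial>lborel \<partial>lborel)"
      by (rule lborel_pair.Fubini') measurable
    also have "\<dots> \<le> (\<integral>\<^sup>+z. ennreal (C / (t' * sqrt t')) * ennreal (\<bar>dker t (y - z)\<bar> * sqrt (norm (y - z))) \<partial>lborel)"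
    proof (intro nn_integral_mono)
      fix z
      have "(\<integral>\<^sup>+y'. ennreal \<bar>dker t (y - z)\<bar> * ennreal \<bar>dker t' (y' - z) - dker t' (y' - y)\<bar> \<partial>lborel)
        = ennreal \<bar>dker t (y - z)\<bar> * (\<integral>\<^sup>+y'. ennreal \<bar>dker t' (y' - z) - dker t' (y' - y)\<bar> \<partial>lborel)"
        by (rule nn_integral_cmult) measurable
      also have "\<dots> \<le> ennreal \<bar>dker t (y - z)\<bar> * ennreal (C * sqrt (norm (z - y)) / (t' * sqrt t'))"
        by (intro mult_left_mono lip t) auto
      also have "\<dots> = ennreal (C / (t' * sqrt t')) * ennreal (\<bar>dker t (y - z)\<bar> * sqrt (norm (y - z)))"
        using C(1) t by (simp add: norm_minus_commute[of z y] mult_ac flip: ennreal_mult)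
      finally show "(\<integral>\<^sup>+y'. ennreal \<bar>dker t (y - z)\<bar> * ennreal \<bar>dker t' (y' - z) - dker t' (y' - y)\<bar> \<partial>lborel)
        \<le> ennreal (C / (t' * sqrt t')) * ennreal (\<bar>dker t (y - z)\<bar> * sqrt (norm (y - z)))" .
    qed
    also have "\<dots> = ennreal (C / (t' * sqrt t')) * (\<integral>\<^sup>+z. ennreal (\<bar>dker t (y - z)\<bar> * sqrt (norm (y - z))) \<partial>lborel)"
      by (rule nn_integral_cmult) measurable
    also have "\<dots> \<le> ennreal (C / (t' * sqrt t')) * ennreal (C / sqrt t)"
      by (intro mult_left_mono half t) auto
    also have "\<dots> = ennreal (C * C * (1 / (sqrt t * (t' * sqrt t'))))"
      using C(1) t by (simp add: mult_ac flip: ennreal_mult)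
    finally show ?thesis .
  qed
  have key2: "(\<integral>\<^sup>+y'. ennreal \<bar>\<integral>z. dker t ((y::'a) - z) * dker t' (y' - z) \<partial>lborel\<bar> \<partial>lborel) \<le> ennreal (C * C * (1 / (sqrt t' * (t * sqrt t))))"
    if t: "0 < t" "0 < t'" for t t' y
  proof -
    have "ennreal \<bar>\<integral>z. dker t (y - z) * dker t' (y' - z) \<partial>lborel\<bar> \<le> (\<integral>\<^sup>+w. ennreal \<bar>dker t' w\<bar> * ennreal \<bar>dker t (y - (y' - w)) - dker t (y - y')\<bar> \<partial>lborel)" for y'
    proof -
      have "(\<integral>z. dker t (y - z) * dker t' (y' - z) \<partial>lborel)
        = (\<integral>z. dker t (y - z) * dker t' (y' - z) \<partial>lborel) - (\<integral>z. dker t (y - y') * dker t' (y' - z) \<partial>lborel)"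
        using integral_dker_eq_0[OF t(2), of y'] by simp
      also have "\<dots> = (\<integral>z. dker t (y - z) * dker t' (y' - z) - dker t (y - y') * dker t' (y' - z) \<partial>lborel)"
        using t by (intro Bochner_Integration.integral_diff[symmetric] int2 integrable_mult_right int)
      also have "\<dots> = (\<integral>z. dker t' (y' - z) * (dker t (y - z) - dker t (y - y')) \<partial>lborel)"
        by (simp add: algebra_simps)
      finally have "(\<integral>z. dker t (y - z) * dker t' (y' - z) \<partial>lborel) = (\<integral>z. dker t' (y' - z) * (dker t (y - z) - dker t (y - y')) \<partial>lborel)" .
      then have "ennreal \<bar>\<integral>z. dker t (y - z) * dker t' (y' - z) \<partial>lborel\<bar> \<le> (\<integral>\<^sup>+z. ennreal \<bar>dker t' (y' - z)\<bar> * ennreal \<bar>dker t (y - (y' - (y' - z))) - dker t (y - y')\<bar> \<partial>lborel)"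
        using abs_integral_le_nn_integral[of lborel "\<lambda>z. dker t' (y' - z) * (dker t (y - z) - dker t (y - y'))"]
        by (simp add: abs_mult ennreal_mult)
      also have "\<dots> = (\<integral>\<^sup>+w. ennreal \<bar>dker t' w\<bar> * ennreal \<bar>dker t (y - (y' - w)) - dker t (y - y')\<bar> \<partial>lborel)"
        by (rule nn_integral_lborel_reflect[where f = "\<lambda>w. ennreal \<bar>dker t' w\<bar> * ennreal \<bar>dker t (y - (y' - w)) - dker t (y - y')\<bar>"]) measurable
      finally show ?thesis .
    qed
    then have "(\<integral>\<^sup>+y'. ennreal \<bar>\<integral>z. dker t (y - z) * dker t' (y' - z) \<partial>lborel\<bar> \<partial>lborel)
      \<le> (\<integral>\<^sup>+y'. \<integral>\<^sup>+w. ennreal \<bar>dker t' w\<bar> * ennreal \<bar>dker t (y - (y' - w)) - dker t (y - y')\<bar> \<partial>lborel \<partial>lborel)"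
      by (intro nn_integral_mono)
    also have "\<dots> = (\<integral>\<^sup>+w. \<integral>\<^sup>+y'. ennreal \<bar>dker t' w\<bar> * ennreal \<bar>dker t (y - (y' - w)) - dker t (y - y')\<bar> \<partial>lborel \<partial>lborel)"
      by (rule lborel_pair.Fubini') measurable
    also have "\<dots> \<le> (\<integral>\<^sup>+w. ennreal (C / (t * sqrt t)) * ennreal (\<bar>dker t' ((0::'a) - w)\<bar> * sqrt (norm ((0::'a) - w))) \<partial>lborel)"
    proof (intro nn_integral_mono)
      fix w :: 'a
      \<comment> \<open>The kernel is even, so as functions of y' both terms are translates of one
        kernel, by y + w and by y, and \<open>lip\<close> applies to the displacement w.\<close>
      have e: "dker t (y - (y' - w)) = dker t (y' - (y + w))" "dker t (y - y') = dker t (y' - y)" for y'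
        using dker_minus_commute[of t "y + w" y'] dker_minus_commute[of t y y'] by (simp_all add: algebra_simps)
      have eq: "\<bar>dker t (y - (y' - w)) - dker t (y - y')\<bar> = \<bar>dker t (y' - (y + w)) - dker t (y' - y)\<bar>" for y'
        unfolding e(1)[of y'] e(2)[of y'] ..
      have "(\<integral>\<^sup>+y'. ennreal \<bar>dker t' w\<bar> * ennreal \<bar>dker t (y - (y' - w)) - dker t (y - y')\<bar> \<partial>lborel)
        = ennreal \<bar>dker t' w\<bar> * (\<integral>\<^sup>+y'. ennreal \<bar>dker t (y' - (y + w)) - dker t (y' - y)\<bar> \<partial>lborel)"
        unfolding eq by (rule nn_integral_cmult) measurable
      also have "\<dots> \<le> ennreal \<bar>dker t' w\<bar> * ennreal (C * sqrt (norm (y + w - y)) / (t * sqrt t))"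
        by (intro mult_left_mono lip t) auto
      also have "\<dots> = ennreal (C / (t * sqrt t)) * ennreal (\<bar>dker t' (0 - w)\<bar> * sqrt (norm (0 - w)))"
        using C(1) t by (simp add: dker_minus mult_ac flip: ennreal_mult)
      finally show "(\<integral>\<^sup>+y'. ennreal \<bar>dker t' w\<bar> * ennreal \<bar>dker t (y - (y' - w)) - dker t (y - y')\<bar> \<partial>lborel)
        \<le> ennreal (C / (t * sqrt t)) * ennreal (\<bar>dker t' (0 - w)\<bar> * sqrt (norm (0 - w)))" .
    qed
    also have "\<dots> = ennreal (C / (t * sqrt t)) * (\<integral>\<^sup>+w. ennreal (\<bar>dker t' ((0::'a) - w)\<bar> * sqrt (norm ((0::'a) - w))) \<partial>lborel)"
      by (rule nn_integral_cmult) measurable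
    also have "\<dots> \<le> ennreal (C / (t * sqrt t)) * ennreal (C / sqrt t')"
      by (intro mult_left_mono half t) auto
    also have "\<dots> = ennreal (C * C * (1 / (sqrt t' * (t * sqrt t))))"
      using C(1) t by (simp add: mult_ac flip: ennreal_mult)
    finally show ?thesis .
  qed
  show thesis
  proof (rule that[of "C * C"])
    show "0 < C * C" using C(1) by simp
  qed (use key key2 in auto)
qed

text \<open>This is t times the t-derivative of the Poisson extension of g. The factor t makes its
  kernel bounded in L^1 uniformly in t, as befits the measure dt/t.\<close>

definition Tp :: "('a::euclidean_space \<Rightarrow> real) \<Rightarrow> real \<Rightarrow> 'a \<Rightarrow> real" where
  "Tp g t y = t * (\<integral>z. dker t (y - z) * g z \<partial>lborel)"

lemma Tp_measurable [measurable]: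
  assumes [measurable]: "g \<in> borel_measurable borel" "f \<in> borel_measurable M" "h \<in> borel_measurable M"
  shows "(\<lambda>x. Tp g (f x) (h x)) \<in> borel_measurable M"
  unfolding Tp_def by measurable

text \<open>The measure dy dt/t on the upper half-space, extended by zero to t \<le> 0.\<close>

definition half_space :: "(real \<times> 'a::euclidean_space) measure" where
  "half_space = density (lborel \<Otimes>\<^sub>M lborel) (\<lambda>w. ennreal (1 / fst w) * indicator {0<..} (fst w))"

lemma sets_half_space [measurable_cong]: "sets half_space = sets (lborel \<Otimes>\<^sub>M lborel)"
  by (simp add: half_space_def)

lemma space_half_space [simp]: "space half_space = UNIV"
  by (simp add: half_space_def space_pair_measure)

lemma sigma_finite_half_space: "sigma_finite_measure half_space"
proof -
  have "sigma_finite_measure (lborel \<Otimes>\<^sub>M lborel :: (real \<times> 'a) measure)"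
    by (simp add: lborel_prod lborel.sigma_finite_measure_axioms)
  then show ?thesis
    unfolding half_space_def
    by (subst sigma_finite_measure.sigma_finite_iff_density_finite) (auto simp: indicator_def ennreal_mult_eq_top_iff)
qed

lemma AE_half_space: "AE w in half_space. 0 < fst w"
  unfolding half_space_def by (subst AE_density) (auto simp: indicator_def)

lemma nn_integral_half_space:
  assumes [measurable]: "f \<in> borel_measurable (lborel \<Otimes>\<^sub>M lborel)"
  shows "(\<integral>\<^sup>+w. f w \<partial>half_space) = (\<integral>\<^sup>+t. \<integral>\<^sup>+y. ennreal (1 / t) * indicator {0<..} t * f (t, y) \<partial>lborel \<partial>lborel)"
  unfolding half_space_def
  by (subst nn_integral_density) (auto simp: lborel.nn_integral_fst[symmetric] split_beta')

text \<open>Schur's test is run on bounded pieces of the half-space, where the measure is finite and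
  the kernel bounded. Its constant is the same for all pieces, so they can be exhausted by monotone
  convergence.\<close>

lemma Tp_L2_bound:
  obtains A where "0 < A" "\<And>(g::'a::euclidean_space \<Rightarrow> real) G. g \<in> borel_measurable borel \<Longrightarrow> (\<And>z. \<bar>g z\<bar> \<le> G) \<Longrightarrow>
     (\<integral>\<^sup>+z. ennreal ((g z)\<^sup>2) \<partial>lborel) < \<infinity> \<Longrightarrow>
     (\<integral>\<^sup>+w. ennreal ((Tp g (fst w) (snd w))\<^sup>2) \<partial>half_space) \<le> ennreal A * (\<integral>\<^sup>+z. ennreal ((g z)\<^sup>2) \<partial>lborel)"
proof -
  obtain C where C: "0 < C" "\<And>t x. 0 < t \<Longrightarrow> \<bar>dker t (x::'a::euclidean_space)\<bar> \<le> C * rho t x powr (- (real DIM('a) + 1))"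
    and L1: "\<And>t y. 0 < t \<Longrightarrow> (\<integral>\<^sup>+z. ennreal \<bar>dker t ((y::'a) - z)\<bar> \<partial>lborel) \<le> ennreal (C / t)"
    by (rule dker_bounds) blast
  obtain J where J: "0 < J" "\<And>t t' y. 0 < t \<Longrightarrow> 0 < t' \<Longrightarrow>
     (\<integral>\<^sup>+y'. ennreal \<bar>\<integral>z. dker t ((y::'a::euclidean_space) - z) * dker t' (y' - z) \<partial>lborel\<bar> \<partial>lborel)
       \<le> ennreal (J * (if t \<le> t' then 1 / (sqrt t * (t' * sqrt t')) else 1 / (sqrt t' * (t * sqrt t))))"
    by (rule dker_convolution_bound) blast
  have bound: "(\<integral>\<^sup>+w. ennreal ((Tp g (fst w) (snd w))\<^sup>2) \<partial>half_space) \<le> ennreal (4 * J) * (\<integral>\<^sup>+z. ennreal ((g z)\<^sup>2) \<partial>lborel)"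
    if [measurable]: "g \<in> borel_measurable borel" and G: "\<And>z. \<bar>g z\<bar> \<le> G" and g2: "(\<integral>\<^sup>+z. ennreal ((g z)\<^sup>2) \<partial>lborel) < \<infinity>"
    for g :: "'a \<Rightarrow> real" and G
  proof -
    \<comment> \<open>Boxes that stay away from t = 0 and from infinity and exhaust the
      half-space.\<close>
    define S where "S = (\<lambda>k::nat. {1 / (real k + 1)<..<real k + 1} \<times> ball (0::'a) (real k + 1))"
    have S_sets [measurable]: "S k \<in> sets (lborel \<Otimes>\<^sub>M lborel)" for k
      unfolding S_def by measurable
    define M where "M = (\<lambda>k. density (half_space :: (real \<times> 'a) measure) (indicator (S k)))"
    have M_sets [measurable_cong]: "sets (M k) = sets (lborel \<Otimes>\<^sub>M lborel)" for k
      by (simp add: M_def sets_half_space)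
    have M_space: "space (M k) = UNIV" for k
      by (simp add: M_def)
    have nn_M: "(\<integral>\<^sup>+w. f w \<partial>M k) = (\<integral>\<^sup>+t. \<integral>\<^sup>+y. ennreal (1 / t) * indicator {0<..} t * (indicator (S k) (t, y) * f (t, y)) \<partial>lborel \<partial>lborel)"
      if [measurable]: "f \<in> borel_measurable (lborel \<Otimes>\<^sub>M lborel)" for f k
    proof -
      have "(\<integral>\<^sup>+w. f w \<partial>M k) = (\<integral>\<^sup>+w. indicator (S k) w * f w \<partial>half_space)"
        unfolding M_def by (rule nn_integral_density) measurable
      also have "\<dots> = (\<integral>\<^sup>+t. \<integral>\<^sup>+y. ennreal (1 / t) * indicator {0<..} t * (indicator (S k) (t, y) * f (t, y)) \<partial>lborel \<partial>lborel)"
        by (rule nn_integral_half_space) measurable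
      finally show ?thesis .
    qed
    define \<Psi> where "\<Psi> = (\<lambda>k w z. indicator (S k) w * (fst w * dker (fst w) (snd w - z)) :: real)"
    have "(\<integral>\<^sup>+w. ennreal ((\<integral>z. \<Psi> k w z * g z \<partial>lborel)\<^sup>2) \<partial>M k) \<le> ennreal (4 * J) * (\<integral>\<^sup>+z. ennreal ((g z)\<^sup>2) \<partial>lborel)" for k
    proof (rule nn_integral_TT_star_le[where B = "(real k + 1) * (C * (1 / (real k + 1)) powr (- (real DIM('a) + 1)))" and L = C and G = G])
      show "finite_measure (M k)"
      proof
        have "emeasure (M k) (space (M k)) = (\<integral>\<^sup>+w. 1 \<partial>M k)"
          by simp
        also have "\<dots> = (\<integral>\<^sup>+t. \<integral>\<^sup>+y. ennreal (1 / t) * indicator {0<..} t * (indicator (S k) (t, y) * 1) \<partial>lborel \<partial>lborel)"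
          by (rule nn_M) measurable
        also have "\<dots> \<le> (\<integral>\<^sup>+t. \<integral>\<^sup>+y. ennreal (real k + 1) * (indicator {0..real k + 1} t * indicator (ball (0::'a) (real k + 1)) y) \<partial>lborel \<partial>lborel)"
        proof (intro nn_integral_mono)
          fix t :: real and y :: 'a
          have "ennreal (1 / t) \<le> ennreal (real k + 1)" if "1 / (real k + 1) < t" "0 < t"
            using that by (intro ennreal_leI) (simp add: field_simps)
          then show "ennreal (1 / t) * indicator {0<..} t * (indicator (S k) (t, y) * 1) \<le> ennreal (real k + 1) * (indicator {0..real k + 1} t * indicator (ball (0::'a) (real k + 1)) y)"
            by (auto simp: S_def indicator_def simp del: ennreal_plus)
        qed
        also have "\<dots> = ennreal (real k + 1) * (emeasure lborel {0..real k + 1} * emeasure lborel (ball (0::'a) (real k + 1)))"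
          by (simp add: nn_integral_cmult nn_integral_multc)
        also have "\<dots> < \<infinity>"
          by (simp add: emeasure_ball ennreal_mult_less_top)
        finally show "emeasure (M k) (space (M k)) \<noteq> \<infinity>"
          by simp
      qed
      show "sigma_finite_measure (lborel :: 'a measure)"
        by (rule lborel.sigma_finite_measure_axioms)
      show "(\<lambda>(w, z). \<Psi> k w z) \<in> borel_measurable (M k \<Otimes>\<^sub>M lborel)"
        unfolding \<Psi>_def by measurable
      show "\<bar>\<Psi> k w z\<bar> \<le> (real k + 1) * (C * (1 / (real k + 1)) powr (- (real DIM('a) + 1)))" for w z
      proof (cases "w \<in> S k")
        case True
        then have t: "1 / (real k + 1) < fst w" "fst w < real k + 1"
          by (auto simp: S_def)
        then have t0: "0 < fst w"
          by (meson less_trans zero_less_divide_1_iff add_nonneg_pos of_nat_0_le_iff zero_less_one)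
        have "rho (fst w) (snd w - z) powr (- (real DIM('a) + 1)) \<le> (1 / (real k + 1)) powr (- (real DIM('a) + 1))"
          using t le_rho[of "fst w" "snd w - z"] by (intro powr_mono2') auto
        then have "\<bar>dker (fst w) (snd w - z)\<bar> \<le> C * (1 / (real k + 1)) powr (- (real DIM('a) + 1))"
          using C(2)[OF t0, of "snd w - z"] C(1) by (auto elim!: order_trans intro!: mult_left_mono)
        then show ?thesis
          using True t t0 unfolding \<Psi>_def by (auto simp: abs_mult intro!: mult_mono)
      qed (use C(1) in \<open>auto simp: \<Psi>_def\<close>)
      show "(\<integral>\<^sup>+z. ennreal \<bar>\<Psi> k w z\<bar> \<partial>lborel) \<le> ennreal C" for w
      proof (cases "w \<in> S k")
        case True
        then have "0 < fst w"
          by (auto simp: S_def intro: less_trans[rotated])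
        have "(\<integral>\<^sup>+z. ennreal \<bar>\<Psi> k w z\<bar> \<partial>lborel) = (\<integral>\<^sup>+z. ennreal (fst w) * ennreal \<bar>dker (fst w) (snd w - z)\<bar> \<partial>lborel)"
          using True \<open>0 < fst w\<close> by (intro nn_integral_cong) (auto simp: \<Psi>_def abs_mult ennreal_mult)
        also have "\<dots> \<le> ennreal (fst w) * ennreal (C / fst w)"
          by (subst nn_integral_cmult) (auto intro!: mult_left_mono L1 \<open>0 < fst w\<close>)
        also have "\<dots> = ennreal C"
          using \<open>0 < fst w\<close> C(1) by (simp flip: ennreal_mult)
        finally show ?thesis .
      qed (auto simp: \<Psi>_def)
      show "0 \<le> C" "0 < 4 * J" using C J by auto
      show "(\<integral>\<^sup>+w'. ennreal \<bar>\<integral>z. \<Psi> k w z * \<Psi> k w' z \<partial>lborel\<bar> \<partial>M k) \<le> ennreal (4 * J)" for w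
      proof (cases "w \<in> S k")
        case True
        define t y where "t = fst w" and "y = snd w"
        have t: "0 < t"
          using True by (auto simp: S_def t_def intro: less_trans[rotated])
        have [measurable]: "(\<lambda>w'. ennreal \<bar>\<integral>z. \<Psi> k w z * \<Psi> k w' z \<partial>lborel\<bar>) \<in> borel_measurable (lborel \<Otimes>\<^sub>M lborel)"
          unfolding \<Psi>_def by measurable
        have "(\<integral>\<^sup>+w'. ennreal \<bar>\<integral>z. \<Psi> k w z * \<Psi> k w' z \<partial>lborel\<bar> \<partial>M k)
          = (\<integral>\<^sup>+t'. \<integral>\<^sup>+y'. ennreal (1 / t') * indicator {0<..} t' * (indicator (S k) (t', y') * ennreal \<bar>\<integral>z. \<Psi> k w z * \<Psi> k (t', y') z \<partial>lborel\<bar>) \<partial>lborel \<partial>lborel)"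
          by (rule nn_M) measurable
        \<comment> \<open>Up to the factor J this is the integral against dt'/t' of the square root
          of the ratio of heights. Each of the ranges t' \<ge> t and t' \<le> t contributes 2 J,
          hence the constant 4 J.\<close>
        also have "\<dots> \<le> (\<integral>\<^sup>+t'. ennreal (J * sqrt t) * (ennreal (t' powr (- (1/2) - 1)) * indicator {t..} t') + ennreal (J / sqrt t) * (ennreal (t' powr (1/2 - 1)) * indicator {0..t} t') \<partial>lborel)"
        proof (intro nn_integral_mono)
          fix t' :: real
          show "(\<integral>\<^sup>+y'. ennreal (1 / t') * indicator {0<..} t' * (indicator (S k) (t', y') * ennreal \<bar>\<integral>z. \<Psi> k w z * \<Psi> k (t', y') z \<partial>lborel\<bar>) \<partial>lborel)
            \<le> ennreal (J * sqrt t) * (ennreal (t' powr (- (1/2) - 1)) * indicator {t..} t') + ennreal (J / sqrt t) * (ennreal (t' powr (1/2 - 1)) * indicator {0..t} t')"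
          proof (cases "0 < t'")
            case t': True
            have "(\<integral>\<^sup>+y'. ennreal (1 / t') * indicator {0<..} t' * (indicator (S k) (t', y') * ennreal \<bar>\<integral>z. \<Psi> k w z * \<Psi> k (t', y') z \<partial>lborel\<bar>) \<partial>lborel)
              \<le> (\<integral>\<^sup>+y'. ennreal t * ennreal \<bar>\<integral>z. dker t (y - z) * dker t' (y' - z) \<partial>lborel\<bar> \<partial>lborel)"
            proof (intro nn_integral_mono)
              fix y'
              have "(\<integral>z. \<Psi> k w z * \<Psi> k (t', y') z \<partial>lborel) = (t * t') * (\<integral>z. dker t (y - z) * dker t' (y' - z) \<partial>lborel)" if "(t', y') \<in> S k"
                using that True unfolding \<Psi>_def t_def y_def by (subst integral_mult_right_zero[symmetric]) (simp add: mult_ac)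
              then show "ennreal (1 / t') * indicator {0<..} t' * (indicator (S k) (t', y') * ennreal \<bar>\<integral>z. \<Psi> k w z * \<Psi> k (t', y') z \<partial>lborel\<bar>)
                \<le> ennreal t * ennreal \<bar>\<integral>z. dker t (y - z) * dker t' (y' - z) \<partial>lborel\<bar>"
                using t t' by (cases "(t', y') \<in> S k") (auto simp: abs_mult simp flip: ennreal_mult)
            qed
            also have "\<dots> = ennreal t * (\<integral>\<^sup>+y'. ennreal \<bar>\<integral>z. dker t (y - z) * dker t' (y' - z) \<partial>lborel\<bar> \<partial>lborel)"
              by (rule nn_integral_cmult) measurable
            also have "\<dots> \<le> ennreal t * ennreal (J * (if t \<le> t' then 1 / (sqrt t * (t' * sqrt t')) else 1 / (sqrt t' * (t * sqrt t))))"
              by (intro mult_left_mono J t t') auto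
            also have "\<dots> \<le> ennreal (J * sqrt t) * (ennreal (t' powr (- (1/2) - 1)) * indicator {t..} t') + ennreal (J / sqrt t) * (ennreal (t' powr (1/2 - 1)) * indicator {0..t} t')"
            proof (cases "t \<le> t'")
              case le: True
              have "t' powr (- (1/2) - 1) = 1 / (t' * sqrt t')"
                unfolding powr_diff using t' by (simp add: powr_minus_divide powr_half_sqrt)
              moreover have "t / sqrt t = sqrt t"
                using t by (simp add: real_div_sqrt)
              ultimately have "t * (J * (1 / (sqrt t * (t' * sqrt t')))) = J * sqrt t * t' powr (- (1/2) - 1)"
                by (metis (no_types, opaque_lifting) divide_divide_eq_left mult.commute times_divide_eq_right mult_1)
              then have "ennreal t * ennreal (J * (1 / (sqrt t * (t' * sqrt t')))) = ennreal (J * sqrt t) * ennreal (t' powr (- (1/2) - 1))"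
                using t t' J(1) by (simp flip: ennreal_mult)
              then show ?thesis
                using le by (simp add: indicator_def)
            next
              case le: False
              have "t' powr (1/2 - 1) = 1 / sqrt t'"
                using t' powr_minus_divide[of t' "1/2"] by (simp add: powr_half_sqrt)
              then have "t * (J * (1 / (sqrt t' * (t * sqrt t)))) = J / sqrt t * t' powr (1/2 - 1)"
                using t by (simp add: field_simps)
              then have "ennreal t * ennreal (J * (1 / (sqrt t' * (t * sqrt t)))) = ennreal (J / sqrt t) * ennreal (t' powr (1/2 - 1))"
                using t t' J(1) by (simp flip: ennreal_mult)
              then show ?thesis
                using le t' by (simp add: indicator_def)
            qed
            finally show ?thesis .
          qed simp
        qed
        also have "\<dots> = ennreal (J * sqrt t) * ennreal (t powr (- (1/2)) / (1/2)) + ennreal (J / sqrt t) * ennreal (t powr (1/2) / (1/2))"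
          using nn_integral_powr_atLeast[of t "1/2"] nn_integral_powr_atMost[of t "1/2"] t
          by (simp add: nn_integral_add nn_integral_cmult)
        also have "\<dots> = ennreal (4 * J)"
        proof -
          have "J * sqrt t * (t powr (- (1/2)) / (1/2)) = 2 * J" "J / sqrt t * (t powr (1/2) / (1/2)) = 2 * J"
            using t by (simp_all add: powr_minus_divide powr_half_sqrt)
          then show ?thesis
            using J(1) t by (simp flip: ennreal_mult ennreal_plus)
        qed
        finally show ?thesis .
      qed (simp add: \<Psi>_def)
    qed (use G g2 in auto)
    note Mk = this
    \<comment> \<open>With the integrand built into a measure, passing to the limit over the boxes
      is continuity of that measure from below.\<close>
    define Q where "Q = density (half_space :: (real \<times> 'a) measure) (\<lambda>w. ennreal ((Tp g (fst w) (snd w))\<^sup>2))"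
    have Q_sets: "sets Q = sets (lborel \<Otimes>\<^sub>M lborel)"
      by (simp add: Q_def sets_half_space)
    have "emeasure Q (S k) \<le> ennreal (4 * J) * (\<integral>\<^sup>+z. ennreal ((g z)\<^sup>2) \<partial>lborel)" for k
    proof -
      have "emeasure Q (S k) = (\<integral>\<^sup>+w. ennreal ((Tp g (fst w) (snd w))\<^sup>2) * indicator (S k) w \<partial>half_space)"
        unfolding Q_def by (rule emeasure_density) measurable
      also have "\<dots> = (\<integral>\<^sup>+w. indicator (S k) w * ennreal ((\<integral>z. \<Psi> k w z * g z \<partial>lborel)\<^sup>2) \<partial>half_space)"
      proof (intro nn_integral_cong)
        fix w :: "real \<times> 'a"
        have "(\<integral>z. \<Psi> k w z * g z \<partial>lborel) = Tp g (fst w) (snd w)" if "w \<in> S k"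
          using that unfolding \<Psi>_def Tp_def by (subst integral_mult_right_zero[symmetric]) (simp add: mult_ac)
        then show "ennreal ((Tp g (fst w) (snd w))\<^sup>2) * indicator (S k) w = indicator (S k) w * ennreal ((\<integral>z. \<Psi> k w z * g z \<partial>lborel)\<^sup>2)"
          by (cases "w \<in> S k") auto
      qed
      also have "\<dots> = (\<integral>\<^sup>+w. ennreal ((\<integral>z. \<Psi> k w z * g z \<partial>lborel)\<^sup>2) \<partial>M k)"
        unfolding M_def \<Psi>_def by (rule nn_integral_density[symmetric]) measurable
      also have "\<dots> \<le> ennreal (4 * J) * (\<integral>\<^sup>+z. ennreal ((g z)\<^sup>2) \<partial>lborel)"
        by (rule Mk)
      finally show ?thesis .
    qed
    then have "(SUP k. emeasure Q (S k)) \<le> ennreal (4 * J) * (\<integral>\<^sup>+z. ennreal ((g z)\<^sup>2) \<partial>lborel)"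
      by (intro SUP_least)
    also have "(SUP k. emeasure Q (S k)) = emeasure Q (\<Union>k. S k)"
    proof (rule SUP_emeasure_incseq)
      show "incseq S"
      proof (rule incseq_SucI)
        fix k
        have "1 / (real (Suc k) + 1) \<le> 1 / (real k + 1)"
          by (intro divide_left_mono) auto
        then show "S k \<subseteq> S (Suc k)"
          by (auto simp: S_def)
      qed
      show "range S \<subseteq> sets Q"
        unfolding Q_sets using S_sets by blast
    qed
    also have "(\<Union>k. S k) = {0<..} \<times> UNIV"
    proof (intro set_eqI iffI)
      fix w :: "real \<times> 'a" assume "w \<in> {0<..} \<times> UNIV"
      then have w: "0 < fst w" by auto
      obtain k :: nat where k: "max (1 / fst w) (max (fst w) (norm (snd w))) < real k"
        using reals_Archimedean2 by blast
      then have "1 / fst w < real k + 1" "fst w < real k + 1" "norm (snd w) < real k + 1"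
        by auto
      then have "w \<in> S k"
        using w by (auto simp: S_def field_simps mem_Times_iff)
      then show "w \<in> (\<Union>k. S k)" by auto
    qed (auto simp: S_def intro: less_trans[rotated])
    also have "emeasure Q ({0<..} \<times> UNIV) = (\<integral>\<^sup>+w. ennreal ((Tp g (fst w) (snd w))\<^sup>2) * indicator ({0<..} \<times> UNIV) w \<partial>half_space)"
      unfolding Q_def by (rule emeasure_density) measurable
    also have "\<dots> = (\<integral>\<^sup>+w. ennreal ((Tp g (fst w) (snd w))\<^sup>2) \<partial>half_space)"
      using AE_half_space by (intro nn_integral_cong_AE) (auto elim!: eventually_mono simp: indicator_def mem_Times_iff)
    finally show ?thesis .
  qed
  show thesis
  proof (rule that[of "4 * J"])
    show "0 < 4 * J" using J by simp
  qed (rule bound)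
qed

lemma integrable_dker_mult:
  fixes g :: "'a::euclidean_space \<Rightarrow> real"
  assumes t: "0 < t" and [measurable]: "g \<in> borel_measurable borel" and G: "\<And>z. \<bar>g z\<bar> \<le> G"
  shows "integrable lborel (\<lambda>z. dker t (y - z) * g z)"
proof -
  obtain C where C: "\<And>t y. 0 < t \<Longrightarrow> (\<integral>\<^sup>+z. ennreal \<bar>dker t ((y::'a) - z)\<bar> \<partial>lborel) \<le> ennreal (C / t)"
    by (rule dker_bounds) blast
  have int: "integrable lborel (\<lambda>z. dker t (y - z))"
    using C[OF t, of y] by (intro integrableI_bounded) (auto simp: order_le_less_trans)
  show ?thesis
  proof (rule Bochner_Integration.integrable_bound[OF integrable_mult_left[OF integrable_abs[OF int], of G]])
    show "AE z in lborel. norm (dker t (y - z) * g z) \<le> norm (\<bar>dker t (y - z)\<bar> * G)"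
      using G by (intro AE_I2) (auto simp: abs_mult intro!: mult_left_mono order_trans[OF G abs_ge_self])
  qed measurable
qed

lemma Tp_bounded:
  obtains C where "0 < C" "\<And>(g::'a::euclidean_space \<Rightarrow> real) G t y. g \<in> borel_measurable borel \<Longrightarrow> (\<And>z. \<bar>g z\<bar> \<le> G) \<Longrightarrow> 0 < t \<Longrightarrow>
     \<bar>Tp g t y\<bar> \<le> C * G"
proof -
  obtain C where C: "0 < C" "\<And>t y. 0 < t \<Longrightarrow> (\<integral>\<^sup>+z. ennreal \<bar>dker t ((y::'a) - z)\<bar> \<partial>lborel) \<le> ennreal (C / t)"
    by (rule dker_bounds) blast
  have "\<bar>Tp g t y\<bar> \<le> C * G" if [measurable]: "g \<in> borel_measurable borel" and G: "\<And>z. \<bar>g z\<bar> \<le> G" and t: "0 < t" for g :: "'a \<Rightarrow> real" and G t y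
  proof -
    have G0: "0 \<le> G" using G[of 0] by linarith
    have "ennreal \<bar>\<integral>z. dker t (y - z) * g z \<partial>lborel\<bar> \<le> (\<integral>\<^sup>+z. ennreal \<bar>dker t (y - z) * g z\<bar> \<partial>lborel)"
      by (rule abs_integral_le_nn_integral)
    also have "\<dots> \<le> (\<integral>\<^sup>+z. ennreal G * ennreal \<bar>dker t (y - z)\<bar> \<partial>lborel)"
      using G G0 by (intro nn_integral_mono) (auto simp: abs_mult mult.commute[of _ "\<bar>g _\<bar>"] simp flip: ennreal_mult intro!: ennreal_leI mult_right_mono)
    also have "\<dots> \<le> ennreal G * ennreal (C / t)"
      by (subst nn_integral_cmult) (auto intro!: mult_left_mono C t)
    finally have "ennreal \<bar>\<integral>z. dker t (y - z) * g z \<partial>lborel\<bar> \<le> ennreal (G * (C / t))"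
      using G0 t C(1) by (subst ennreal_mult) auto
    then have "\<bar>\<integral>z. dker t (y - z) * g z \<partial>lborel\<bar> \<le> G * (C / t)"
      using G0 t C(1) by (subst (asm) ennreal_le_iff) auto
    then have "t * \<bar>\<integral>z. dker t (y - z) * g z \<partial>lborel\<bar> \<le> t * (G * (C / t))"
      using t by (intro mult_left_mono) auto
    then show ?thesis
      using t by (simp add: Tp_def abs_mult mult.commute)
  qed
  then show thesis using C(1) that by blast
qed

lemma Tp_add:
  fixes g h :: "'a::euclidean_space \<Rightarrow> real"
  assumes "0 < t" "g \<in> borel_measurable borel" "\<And>z. \<bar>g z\<bar> \<le> G" "h \<in> borel_measurable borel" "\<And>z. \<bar>h z\<bar> \<le> G"
  shows "Tp (\<lambda>z. g z + h z) t y = Tp g t y + Tp h t y"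
proof -
  have "(\<integral>z. dker t (y - z) * (g z + h z) \<partial>lborel) = (\<integral>z. dker t (y - z) * g z + dker t (y - z) * h z \<partial>lborel)"
    by (simp add: distrib_left)
  also have "\<dots> = (\<integral>z. dker t (y - z) * g z \<partial>lborel) + (\<integral>z. dker t (y - z) * h z \<partial>lborel)"
    using assms by (intro Bochner_Integration.integral_add integrable_dker_mult) auto
  finally show ?thesis
    by (simp add: Tp_def distrib_left)
qed

text \<open>Interpolation between L^2 and the bound for bounded functions. At each height l the
  function is cut at c l: the small part changes \<open>Tp\<close> by at most l/2, and the large
  part is in L^2, since on it |g|^2 \<le> (c l)^(2-q) |g|^q. For it the L^2 bound and Chebyshev's
  inequality at l/2 apply. The case q = 2 stands apart because the interpolation lemma demands r <
  q.\<close>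

lemma Tp_Lq_bound:
  assumes q: "2 \<le> q"
  obtains A where "0 < A" "\<And>(g::'a::euclidean_space \<Rightarrow> real) G. g \<in> borel_measurable borel \<Longrightarrow> (\<And>z. \<bar>g z\<bar> \<le> G) \<Longrightarrow>
     (\<integral>\<^sup>+z. ennreal (\<bar>g z\<bar> powr q) \<partial>lborel) < \<infinity> \<Longrightarrow>
     (\<integral>\<^sup>+w. ennreal (\<bar>Tp g (fst w) (snd w)\<bar> powr q) \<partial>half_space) \<le> ennreal A * (\<integral>\<^sup>+z. ennreal (\<bar>g z\<bar> powr q) \<partial>lborel)"
proof -
  obtain A where A: "0 < A" "\<And>(g::'a::euclidean_space \<Rightarrow> real) G. g \<in> borel_measurable borel \<Longrightarrow> (\<And>z. \<bar>g z\<bar> \<le> G) \<Longrightarrow>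
     (\<integral>\<^sup>+z. ennreal ((g z)\<^sup>2) \<partial>lborel) < \<infinity> \<Longrightarrow>
     (\<integral>\<^sup>+w. ennreal ((Tp g (fst w) (snd w))\<^sup>2) \<partial>half_space) \<le> ennreal A * (\<integral>\<^sup>+z. ennreal ((g z)\<^sup>2) \<partial>lborel)"
    by (rule Tp_L2_bound) blast
  have sq: "\<bar>x\<bar> powr 2 = x\<^sup>2" for x :: real
    by simp
  show thesis
  proof (cases "q = 2")
    case True
    show thesis
    proof (rule that[OF A(1)])
      fix g :: "'a \<Rightarrow> real" and G
      assume "g \<in> borel_measurable borel" "\<And>z. \<bar>g z\<bar> \<le> G" "(\<integral>\<^sup>+z. ennreal (\<bar>g z\<bar> powr q) \<partial>lborel) < \<infinity>"
      then show "(\<integral>\<^sup>+w. ennreal (\<bar>Tp g (fst w) (snd w)\<bar> powr q) \<partial>half_space) \<le> ennreal A * (\<integral>\<^sup>+z. ennreal (\<bar>g z\<bar> powr q) \<partial>lborel)"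
        using A(2)[of g G] unfolding True sq by blast
    qed
  next
    case False
    then have q: "2 < q" using q by simp
    obtain C where C: "0 < C" "\<And>(g::'a::euclidean_space \<Rightarrow> real) G t y. g \<in> borel_measurable borel \<Longrightarrow> (\<And>z. \<bar>g z\<bar> \<le> G) \<Longrightarrow> 0 < t \<Longrightarrow>
     \<bar>Tp g t y\<bar> \<le> C * G"
      by (rule Tp_bounded) blast
    \<comment> \<open>Chosen so that C (c l) = l/2, half of the height in question.\<close>
    define c where "c = 1 / (2 * C)"
    have c: "0 < c" using C(1) by (simp add: c_def)
    let ?K = "4 * A * q / (q - 2) * c powr (2 - q)"
    show thesis
    proof (rule that[of ?K])
      show "0 < ?K" using A(1) q c by simp
      fix g :: "'a \<Rightarrow> real" and G
      assume g_meas [measurable]: "g \<in> borel_measurable borel" and G: "\<And>z. \<bar>g z\<bar> \<le> G" and fin: "(\<integral>\<^sup>+z. ennreal (\<bar>g z\<bar> powr q) \<partial>lborel) < \<infinity>"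
      have "(\<integral>\<^sup>+w. enn_powr (ennreal \<bar>Tp g (fst w) (snd w)\<bar>) q \<partial>half_space) \<le> ennreal ?K * (\<integral>\<^sup>+z. ennreal (\<bar>g z\<bar> powr q) \<partial>lborel)"
      proof (rule nn_integral_Marcinkiewicz[where f = "\<lambda>z. \<bar>g z\<bar>"])
        fix l :: real assume l: "0 < l"
        define g1 where "g1 = (\<lambda>z. if c * l < \<bar>g z\<bar> then g z else 0)"
        define g2 where "g2 = (\<lambda>z. if c * l < \<bar>g z\<bar> then 0 else g z)"
        have [measurable]: "g1 \<in> borel_measurable borel" "g2 \<in> borel_measurable borel"
          unfolding g1_def g2_def by measurable
        have G12: "\<bar>g1 z\<bar> \<le> G" "\<bar>g2 z\<bar> \<le> G" "\<bar>g2 z\<bar> \<le> c * l" for z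
          using G[of z] c l by (auto simp: g1_def g2_def intro: order_trans[OF abs_ge_zero])
        have g1sq: "ennreal ((g1 z)\<^sup>2) = ennreal (\<bar>g z\<bar> powr 2) * indicator {c * l<..} \<bar>g z\<bar>" for z
          by (auto simp: g1_def)
        have fin1: "(\<integral>\<^sup>+z. ennreal ((g1 z)\<^sup>2) \<partial>lborel) < \<infinity>"
        proof -
          have "(\<integral>\<^sup>+z. ennreal ((g1 z)\<^sup>2) \<partial>lborel) \<le> (\<integral>\<^sup>+z. ennreal ((c * l) powr (2 - q)) * ennreal (\<bar>g z\<bar> powr q) \<partial>lborel)"
          proof (intro nn_integral_mono)
            fix z
            have "\<bar>g z\<bar> powr 2 \<le> (c * l) powr (2 - q) * \<bar>g z\<bar> powr q" if "c * l < \<bar>g z\<bar>"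
            proof -
              have "\<bar>g z\<bar> powr 2 = \<bar>g z\<bar> powr (2 - q) * \<bar>g z\<bar> powr q"
                unfolding powr_add[symmetric] by simp
              also have "\<dots> \<le> (c * l) powr (2 - q) * \<bar>g z\<bar> powr q"
                using that c l q by (intro mult_right_mono powr_mono2') auto
              finally show ?thesis .
            qed
            then show "ennreal ((g1 z)\<^sup>2) \<le> ennreal ((c * l) powr (2 - q)) * ennreal (\<bar>g z\<bar> powr q)"
              unfolding g1sq by (auto simp: indicator_def simp flip: ennreal_mult intro!: ennreal_leI)
          qed
          also have "\<dots> = ennreal ((c * l) powr (2 - q)) * (\<integral>\<^sup>+z. ennreal (\<bar>g z\<bar> powr q) \<partial>lborel)"
            by (rule nn_integral_cmult) measurable
          also have "\<dots> < \<infinity>"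
            using fin by (simp add: ennreal_mult_less_top)
          finally show ?thesis .
        qed
        have "emeasure half_space {w \<in> space half_space. ennreal l < ennreal \<bar>Tp g (fst w) (snd w)\<bar>}
          = (\<integral>\<^sup>+w. indicator {w \<in> space half_space. ennreal l < ennreal \<bar>Tp g (fst w) (snd w)\<bar>} w \<partial>half_space)"
          by (rule nn_integral_indicator[symmetric]) measurable
        also have "\<dots> \<le> (\<integral>\<^sup>+w. ennreal (4 / l\<^sup>2) * ennreal ((Tp g1 (fst w) (snd w))\<^sup>2) \<partial>half_space)"
        proof (intro nn_integral_mono_AE eventually_mono[OF AE_half_space])
          fix w :: "real \<times> 'a" assume w: "0 < fst w"
          show "indicator {w \<in> space half_space. ennreal l < ennreal \<bar>Tp g (fst w) (snd w)\<bar>} w \<le> ennreal (4 / l\<^sup>2) * ennreal ((Tp g1 (fst w) (snd w))\<^sup>2)"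
          proof (cases "l < \<bar>Tp g (fst w) (snd w)\<bar>")
            case True
            have "Tp g (fst w) (snd w) = Tp (\<lambda>z. g1 z + g2 z) (fst w) (snd w)"
              unfolding g1_def g2_def by (rule arg_cong[where f = "\<lambda>g. Tp g (fst w) (snd w)"]) auto
            also have "\<dots> = Tp g1 (fst w) (snd w) + Tp g2 (fst w) (snd w)"
              using w G12 by (intro Tp_add) auto
            finally have "\<bar>Tp g (fst w) (snd w)\<bar> \<le> \<bar>Tp g1 (fst w) (snd w)\<bar> + \<bar>Tp g2 (fst w) (snd w)\<bar>"
              by linarith
            moreover have "\<bar>Tp g2 (fst w) (snd w)\<bar> \<le> C * (c * l)"
              using w G12 by (intro C) auto
            moreover have "C * (c * l) = l / 2"
              using C(1) by (simp add: c_def)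
            ultimately have "l / 2 \<le> \<bar>Tp g1 (fst w) (snd w)\<bar>"
              using True by linarith
            then have "(l / 2)\<^sup>2 \<le> (Tp g1 (fst w) (snd w))\<^sup>2"
              using l by (simp add: abs_le_square_iff[symmetric])
            then have "1 \<le> 4 / l\<^sup>2 * (Tp g1 (fst w) (snd w))\<^sup>2"
              using l by (simp add: field_simps power2_eq_square)
            then have "ennreal 1 \<le> ennreal (4 / l\<^sup>2 * (Tp g1 (fst w) (snd w))\<^sup>2)"
              by (rule ennreal_leI)
            then show ?thesis
              by (auto simp: indicator_def simp flip: ennreal_mult)
          qed (use l in \<open>auto simp: indicator_def ennreal_less_iff\<close>)
        qed
        also have "\<dots> = ennreal (4 / l\<^sup>2) * (\<integral>\<^sup>+w. ennreal ((Tp g1 (fst w) (snd w))\<^sup>2) \<partial>half_space)"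
          by (rule nn_integral_cmult) measurable
        also have "\<dots> \<le> ennreal (4 / l\<^sup>2) * (ennreal A * (\<integral>\<^sup>+z. ennreal ((g1 z)\<^sup>2) \<partial>lborel))"
          using G12 fin1 by (intro mult_left_mono A) auto
        also have "\<dots> = ennreal (4 * A * l powr (- 2)) * (\<integral>\<^sup>+z. ennreal ((g1 z)\<^sup>2) \<partial>lborel)"
        proof -
          have "4 / l\<^sup>2 * A = 4 * A * l powr (- 2)"
            using l by (simp add: powr_minus_divide)
          then show ?thesis
            using A(1) by (simp add: mult.assoc[symmetric] flip: ennreal_mult)
        qed
        finally show "emeasure half_space {w \<in> space half_space. ennreal l < ennreal \<bar>Tp g (fst w) (snd w)\<bar>}
          \<le> ennreal (4 * A * l powr (- 2)) * (\<integral>\<^sup>+z. ennreal (\<bar>g z\<bar> powr 2) * indicator {c * l<..} \<bar>g z\<bar> \<partial>lborel)"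
          unfolding g1sq .
      qed (use q c A(1) in \<open>simp_all add: sigma_finite_half_space lborel.sigma_finite_measure_axioms\<close>)
      then show "(\<integral>\<^sup>+w. ennreal (\<bar>Tp g (fst w) (snd w)\<bar> powr q) \<partial>half_space) \<le> ennreal ?K * (\<integral>\<^sup>+z. ennreal (\<bar>g z\<bar> powr q) \<partial>lborel)"
        by (simp only: enn_powr_ennreal abs_ge_zero)
    qed
  qed
qed

section \<open>The exceptional set\<close>

lemma enn_powr_le_imp_le:
  assumes "enn_powr a p \<le> ennreal (x powr p)" "0 < p" "0 \<le> x"
  shows "a \<le> ennreal x"
proof (cases a)
  case (real y)
  then have "y powr p \<le> x powr p"
    using assms by (simp add: enn_powr_ennreal)
  then have "y \<le> x"
    using assms real by (meson not_le powr_less_mono2)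
  then show ?thesis using real by (simp add: ennreal_leI)
qed (use assms in \<open>simp add: top_unique\<close>)

text \<open>Where |x| > \<alpha>, the decreasing power satisfies |x|^(1-p) \<le> \<alpha>^(1-p).
  This passes from p-th powers to the first power at height \<alpha> with the right
  homogeneity.\<close>

lemma abs_le_add_powr:
  fixes x \<alpha> p :: real
  assumes "0 < \<alpha>" "1 < p"
  shows "\<bar>x\<bar> \<le> \<alpha> + \<alpha> powr (1 - p) * \<bar>x\<bar> powr p"
proof (cases "\<bar>x\<bar> \<le> \<alpha>")
  case False
  have "\<bar>x\<bar> = \<bar>x\<bar> powr (1 - p) * \<bar>x\<bar> powr p"
    unfolding powr_add[symmetric] using False assms by simp
  also have "\<dots> \<le> \<alpha> powr (1 - p) * \<bar>x\<bar> powr p"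
    using False assms by (intro mult_right_mono powr_mono2') auto
  finally show ?thesis using assms by linarith
qed (use assms in \<open>simp add: add_increasing2\<close>)

text \<open>\<open>E\<close> is the complement of the exceptional set of \<open>f\<close> at height \<open>\<alpha>\<close>. In the bound for its
  measure, \<open>5\<^sup>n\<close> comes from the Vitali covering lemma and \<open>2\<close> from an open neighbourhood
  of the set where \<open>\<bar>f\<bar> > \<alpha>\<close>; including the latter makes Lebesgue differentiation unnecessary.\<close>

definition level_set :: "real \<Rightarrow> ('a::euclidean_space \<Rightarrow> real) \<Rightarrow> real \<Rightarrow> 'a set \<Rightarrow> bool" where
  "level_set p f \<alpha> E \<longleftrightarrow> f \<in> borel_measurable borel \<and> 0 < \<alpha> \<and> closed E \<and> E \<noteq> {} \<and>
     (\<forall>x\<in>E. \<bar>f x\<bar> \<le> \<alpha>) \<and>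
     (\<forall>e\<in>E. \<forall>c r. e \<in> ball c r \<longrightarrow> (\<integral>\<^sup>+z\<in>ball c r. ennreal (\<bar>f z\<bar> powr p) \<partial>lborel) \<le>
        ennreal (\<alpha> powr p * (unit_ball_vol (real DIM('a)) * r powr real DIM('a)))) \<and>
     emeasure lborel (- E) \<le> ennreal ((5 ^ DIM('a) + 2) * \<alpha> powr (- p)) * (\<integral>\<^sup>+z. ennreal (\<bar>f z\<bar> powr p) \<partial>lborel) \<and>
     (\<integral>\<^sup>+z. ennreal (\<bar>f z\<bar> powr p) \<partial>lborel) < \<infinity>"

lemma level_setD:
  assumes "level_set p f \<alpha> E"
  shows "f \<in> borel_measurable borel" "0 < \<alpha>" "closed E" "E \<noteq> {}" "\<And>x. x \<in> E \<Longrightarrow> \<bar>f x\<bar> \<le> \<alpha>"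
    "emeasure lborel (- E) \<le> ennreal ((5 ^ DIM('a) + 2) * \<alpha> powr (- p)) * (\<integral>\<^sup>+z. ennreal (\<bar>f z\<bar> powr p) \<partial>(lborel :: 'a::euclidean_space measure))"
    "(\<integral>\<^sup>+z. ennreal (\<bar>f z\<bar> powr p) \<partial>lborel) < \<infinity>"
  using assms by (auto simp: level_set_def)

lemma infdist_measurable [measurable]:
  assumes [measurable]: "g \<in> borel_measurable M"
  shows "(\<lambda>x. infdist (g x :: 'a::euclidean_space) E) \<in> borel_measurable M"
proof -
  have "(\<lambda>x::'a. infdist x E) \<in> borel_measurable borel"
    by (intro borel_measurable_continuous_onI continuous_on_infdist continuous_on_id)
  then show ?thesis
    using measurable_compose[OF assms] by simp
qed

lemma infdist_eq_0_iff_closed: "closed E \<Longrightarrow> E \<noteq> {} \<Longrightarrow> infdist x E = 0 \<longleftrightarrow> x \<in> E"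
  using in_closed_iff_infdist_zero by blast

lemma infdist_less_obtain:
  assumes "E \<noteq> {}" "infdist y E < r"
  obtains e where "e \<in> E" "dist y e < r"
proof -
  have "\<not> r \<le> infdist y E" using assms by simp
  then have "\<exists>e\<in>E. \<not> r \<le> dist y e"
    using assms(1) unfolding infdist_def by (auto intro: cINF_greatest)
  then show thesis using that by (auto simp: not_le)
qed

text \<open>A radius exceeding the distance to \<open>E\<close> forces the ball to contain a point
  of \<open>E\<close>, and there the averages are controlled. The first power costs a factor 2
  through \<open>abs_le_add_powr\<close>.\<close>

lemma nn_integral_ball_le:
  fixes f :: "'a::euclidean_space \<Rightarrow> real"
  assumes L: "level_set p f \<alpha> E" and p: "1 < p" and r: "infdist y E < r"
  shows "(\<integral>\<^sup>+z\<in>ball y r. ennreal (\<bar>f z\<bar> powr p) \<partial>lborel) \<le> ennreal (\<alpha> powr p * unit_ball_vol (real DIM('a)) * r powr real DIM('a))"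
    and "(\<integral>\<^sup>+z\<in>ball y r. ennreal \<bar>f z\<bar> \<partial>lborel) \<le> ennreal (2 * \<alpha> * unit_ball_vol (real DIM('a)) * r powr real DIM('a))"
proof -
  let ?w = "unit_ball_vol (real DIM('a))"
  note [measurable] = level_setD(1)[OF L]
  have \<alpha>: "0 < \<alpha>" by (rule level_setD[OF L])
  have r0: "0 < r" using r infdist_nonneg[of y E] by linarith
  obtain e where "e \<in> E" "dist y e < r"
    using infdist_less_obtain level_setD(4)[OF L] r by metis
  then show 1: "(\<integral>\<^sup>+z\<in>ball y r. ennreal (\<bar>f z\<bar> powr p) \<partial>lborel) \<le> ennreal (\<alpha> powr p * ?w * r powr real DIM('a))"
    using L unfolding level_set_def by (simp add: mult.assoc)
  have "(\<integral>\<^sup>+z\<in>ball y r. ennreal \<bar>f z\<bar> \<partial>lborel)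
    \<le> (\<integral>\<^sup>+z. ennreal \<alpha> * indicator (ball y r) z + ennreal (\<alpha> powr (1 - p)) * (ennreal (\<bar>f z\<bar> powr p) * indicator (ball y r) z) \<partial>lborel)"
    using abs_le_add_powr[OF \<alpha> p] \<alpha> by (intro nn_integral_mono) (auto simp: indicator_def simp flip: ennreal_mult ennreal_plus intro!: ennreal_leI)
  also have "\<dots> = ennreal \<alpha> * emeasure lborel (ball y r) + ennreal (\<alpha> powr (1 - p)) * (\<integral>\<^sup>+z\<in>ball y r. ennreal (\<bar>f z\<bar> powr p) \<partial>lborel)"
    by (simp add: nn_integral_add nn_integral_cmult)
  also have "\<dots> \<le> ennreal \<alpha> * ennreal (?w * r powr real DIM('a)) + ennreal (\<alpha> powr (1 - p)) * ennreal (\<alpha> powr p * ?w * r powr real DIM('a))"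
    using r0 1 by (intro add_mono mult_left_mono) (auto simp: emeasure_ball powr_realpow)
  also have "\<dots> = ennreal (\<alpha> * (?w * r powr real DIM('a)) + (\<alpha> powr (1 - p) * \<alpha> powr p) * (?w * r powr real DIM('a)))"
    using \<alpha> by (simp add: mult.assoc flip: ennreal_mult ennreal_plus)
  also have "\<alpha> powr (1 - p) * \<alpha> powr p = \<alpha>"
    unfolding powr_add[symmetric] using \<alpha> by simp
  finally show "(\<integral>\<^sup>+z\<in>ball y r. ennreal \<bar>f z\<bar> \<partial>lborel) \<le> ennreal (2 * \<alpha> * ?w * r powr real DIM('a))"
    by (simp add: algebra_simps)
qed

text \<open>The constant of \<open>nn_integral_rho_powr_le_1\<close> for a = 1, that is, for the
  decay N + 1 of \<open>dker\<close>.\<close>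

definition rho_const :: "real \<Rightarrow> real" where
  "rho_const N = (2 powr N + (N + 1)) * unit_ball_vol N"

lemma rho_const_pos: "0 \<le> N \<Longrightarrow> 0 < rho_const N"
  unfolding rho_const_def by (intro mult_pos_pos add_pos_nonneg) auto

lemma potential_le_far:
  fixes f :: "'a::euclidean_space \<Rightarrow> real"
  assumes L: "level_set p f \<alpha> E" and p: "1 < p" and t: "0 < t" "infdist y E \<le> t"
  defines "N \<equiv> real DIM('a)"
  shows "(\<integral>\<^sup>+z. ennreal \<bar>f z\<bar> * ennreal (rho t (y - z) powr (- (N + 1))) \<partial>lborel) \<le> ennreal (2 * rho_const N * \<alpha> / t)"
proof -
  note [measurable] = level_setD(1)[OF L]
  have \<alpha>: "0 < \<alpha>" by (rule level_setD[OF L])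
  have "(\<integral>\<^sup>+z. ennreal \<bar>f z\<bar> * ennreal (rho t (y - z) powr (- (N + 1))) \<partial>lborel)
     \<le> ennreal ((2 powr N + (N + 1) / 1) * (2 * \<alpha> * unit_ball_vol N) * t powr N * t powr (- (N + 1)))"
    unfolding N_def
  proof (rule nn_integral_rho_powr_le)
    fix r assume "t < r"
    then show "(\<integral>\<^sup>+z\<in>ball y r. ennreal \<bar>f z\<bar> \<partial>lborel) \<le> ennreal (2 * \<alpha> * unit_ball_vol (real DIM('a)) * r powr real DIM('a))"
      using t by (intro nn_integral_ball_le[OF L p]) auto
  qed (use t \<alpha> in auto)
  also have "(2 powr N + (N + 1) / 1) * (2 * \<alpha> * unit_ball_vol N) * t powr N * t powr (- (N + 1)) = 2 * rho_const N * \<alpha> * (t powr N * t powr (- (N + 1)))"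
    by (simp add: rho_const_def)
  also have "t powr N * t powr (- (N + 1)) = 1 / t"
    unfolding powr_add[symmetric] using t by (simp add: powr_minus_divide)
  finally show ?thesis by simp
qed

lemma potential_le_maximal:
  fixes f :: "'a::euclidean_space \<Rightarrow> real"
  assumes [measurable]: "f \<in> borel_measurable borel" and t: "0 < t" and m: "maximal_fun (\<lambda>z. ennreal \<bar>f z\<bar>) y \<le> ennreal m" "0 \<le> m"
  defines "N \<equiv> real DIM('a)"
  shows "(\<integral>\<^sup>+z. ennreal \<bar>f z\<bar> * ennreal (rho t (y - z) powr (- (N + 1))) \<partial>lborel) \<le> ennreal (rho_const N * m / t)"
proof -
  have "(\<integral>\<^sup>+z. ennreal \<bar>f z\<bar> * ennreal (rho t (y - z) powr (- (N + 1))) \<partial>lborel)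
     \<le> ennreal ((2 powr N + (N + 1) / 1) * (m * unit_ball_vol N) * t powr N * t powr (- (N + 1)))"
    unfolding N_def
  proof (rule nn_integral_rho_powr_le)
    fix r assume r: "t < r"
    have "(\<integral>\<^sup>+z\<in>ball y r. ennreal \<bar>f z\<bar> \<partial>lborel) \<le> maximal_fun (\<lambda>z. ennreal \<bar>f z\<bar>) y * emeasure lborel (ball y r)"
      using r t by (intro nn_integral_ball_le_maximal_fun) auto
    also have "\<dots> \<le> ennreal m * emeasure lborel (ball y r)"
      by (intro mult_right_mono m) auto
    finally show "(\<integral>\<^sup>+z\<in>ball y r. ennreal \<bar>f z\<bar> \<partial>lborel) \<le> ennreal (m * unit_ball_vol (real DIM('a)) * r powr real DIM('a))"
      using r t m by (simp add: emeasure_ball powr_realpow ennreal_mult mult.assoc)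
  qed (use t m in auto)
  also have "(2 powr N + (N + 1) / 1) * (m * unit_ball_vol N) * t powr N * t powr (- (N + 1)) = rho_const N * m * (t powr N * t powr (- (N + 1)))"
    by (simp add: rho_const_def)
  also have "t powr N * t powr (- (N + 1)) = 1 / t"
    unfolding powr_add[symmetric] using t by (simp add: powr_minus_divide)
  finally show ?thesis by simp
qed

text \<open>Jensen's inequality with the potential as weight, of mass at most k/t, reduces to the
  potential of |f|^p. Its balls are controlled only beyond the distance to \<open>E\<close>, so
  \<open>nn_integral_rho_powr_le\<close> is used with R equal to that distance. Taking the p-th root
  of (k/t)^(p-1) k \<alpha>^p d^N t^(-N-1) gives the stated bound.\<close>

lemma potential_le_near:
  fixes f :: "'a::euclidean_space \<Rightarrow> real"
  assumes L: "level_set p f \<alpha> E" and p: "1 < p" and t: "0 < t" "t \<le> infdist y E"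
  defines "N \<equiv> real DIM('a)"
  shows "(\<integral>\<^sup>+z. ennreal \<bar>f z\<bar> * ennreal (rho t (y - z) powr (- (N + 1))) \<partial>lborel)
     \<le> ennreal (rho_const N * \<alpha> * infdist y E powr (N / p) * t powr (- 1 - N / p))" (is "?V \<le> ennreal ?x")
proof (rule enn_powr_le_imp_le)
  note [measurable] = level_setD(1)[OF L]
  have \<alpha>: "0 < \<alpha>" by (rule level_setD[OF L])
  let ?d = "infdist y E" and ?k = "rho_const N"
  have N: "0 \<le> N" by (simp add: N_def)
  have k: "0 < ?k" using N by (rule rho_const_pos)
  show "0 < p" using p by simp
  show "0 \<le> ?x" using k \<alpha> by simp
  have W: "(\<integral>\<^sup>+z. ennreal (rho t (y - z) powr (- (N + 1))) \<partial>lborel) \<le> ennreal (?k * t powr (- 1))"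
    using nn_integral_rho_powr_le_1[OF t(1), of 1 y] by (simp add: rho_const_def N_def)
  have P: "(\<integral>\<^sup>+z. ennreal (\<bar>f z\<bar> powr p) * ennreal (rho t (y - z) powr (- (N + 1))) \<partial>lborel)
     \<le> ennreal ((2 powr N + (N + 1) / 1) * (\<alpha> powr p * unit_ball_vol N) * ?d powr N * t powr (- (N + 1)))"
    unfolding N_def
  proof (rule nn_integral_rho_powr_le)
    fix r assume "?d < r"
    then show "(\<integral>\<^sup>+z\<in>ball y r. ennreal (\<bar>f z\<bar> powr p) \<partial>lborel) \<le> ennreal (\<alpha> powr p * unit_ball_vol (real DIM('a)) * r powr real DIM('a))"
      by (intro nn_integral_ball_le[OF L p])
  qed (use t in auto)
  have "enn_powr ?V p = enn_powr (\<integral>\<^sup>+z. ennreal (rho t (y - z) powr (- (N + 1))) * ennreal \<bar>f z\<bar> \<partial>lborel) p"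
    by (simp add: mult.commute)
  also have "\<dots> \<le> ennreal ((?k * t powr (- 1)) powr (p - 1)) * (\<integral>\<^sup>+z. ennreal (rho t (y - z) powr (- (N + 1))) * enn_powr (ennreal \<bar>f z\<bar>) p \<partial>lborel)"
    using k by (intro nn_integral_Jensen_powr p W) auto
  also have "\<dots> = ennreal ((?k * t powr (- 1)) powr (p - 1)) * (\<integral>\<^sup>+z. ennreal (\<bar>f z\<bar> powr p) * ennreal (rho t (y - z) powr (- (N + 1))) \<partial>lborel)"
    by (simp add: enn_powr_ennreal mult.commute)
  also have "\<dots> \<le> ennreal ((?k * t powr (- 1)) powr (p - 1)) * ennreal ((2 powr N + (N + 1) / 1) * (\<alpha> powr p * unit_ball_vol N) * ?d powr N * t powr (- (N + 1)))"
    by (intro mult_left_mono P) auto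
  also have "\<dots> = ennreal ((?k * t powr (- 1)) powr (p - 1) * ((2 powr N + (N + 1) / 1) * (\<alpha> powr p * unit_ball_vol N) * ?d powr N * t powr (- (N + 1))))"
    by (rule ennreal_mult'[symmetric]) simp
  also have "(?k * t powr (- 1)) powr (p - 1) * ((2 powr N + (N + 1) / 1) * (\<alpha> powr p * unit_ball_vol N) * ?d powr N * t powr (- (N + 1))) = ?x powr p"
  proof -
    have e1: "(?k * t powr (- 1)) powr (p - 1) = ?k powr (p - 1) * t powr (- (p - 1))"
      using powr_powr[of t "- 1" "p - 1"] by (simp only: powr_mult mult_minus1)
    have e2: "(2 powr N + (N + 1) / 1) * (\<alpha> powr p * unit_ball_vol N) * ?d powr N * t powr (- (N + 1)) = ?k * \<alpha> powr p * ?d powr N * t powr (- (N + 1))"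
      by (simp add: rho_const_def)
    have e3: "?x powr p = ?k powr p * \<alpha> powr p * ?d powr N * t powr ((- 1 - N / p) * p)"
      using k \<alpha> p by (simp add: powr_mult powr_powr)
    have e4: "?k powr (p - 1) * ?k = ?k powr p"
      using k by (simp add: powr_diff)
    have e5: "t powr (- (p - 1)) * t powr (- (N + 1)) = t powr ((- 1 - N / p) * p)"
      unfolding powr_add[symmetric] using p by (intro arg_cong[where f = "\<lambda>e. t powr e"]) (simp add: field_simps)
    have "(?k * t powr (- 1)) powr (p - 1) * ((2 powr N + (N + 1) / 1) * (\<alpha> powr p * unit_ball_vol N) * ?d powr N * t powr (- (N + 1)))
      = (?k powr (p - 1) * t powr (- (p - 1))) * (?k * \<alpha> powr p * ?d powr N * t powr (- (N + 1)))"
      by (simp only: e1 e2)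
    also have "\<dots> = (?k powr (p - 1) * ?k) * \<alpha> powr p * ?d powr N * (t powr (- (p - 1)) * t powr (- (N + 1)))"
      by (simp only: mult_ac)
    also have "\<dots> = ?x powr p"
      by (simp only: e3 e4 e5)
    finally show ?thesis .
  qed
  finally show "enn_powr ?V p \<le> ennreal (?x powr p)" .
qed

lemma potential_finite:
  fixes f :: "'a::euclidean_space \<Rightarrow> real"
  assumes L: "level_set p f \<alpha> E" and p: "1 < p" and t: "0 < t"
  shows "(\<integral>\<^sup>+z. ennreal (\<bar>f z\<bar> * rho t (y - z) powr (- (real DIM('a) + 1))) \<partial>lborel) < \<infinity>"
proof -
  have "(\<integral>\<^sup>+z. ennreal \<bar>f z\<bar> * ennreal (rho t (y - z) powr (- (real DIM('a) + 1))) \<partial>lborel) < \<infinity>"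
    using potential_le_far[OF L p t, of y] potential_le_near[OF L p t, of y]
    by (cases "infdist y E \<le> t") (auto intro: order_le_less_trans)
  then show ?thesis
    by (simp add: ennreal_mult)
qed

lemma deriv_poisson_integral:
  fixes f :: "'a::euclidean_space \<Rightarrow> real"
  assumes L: "level_set p f \<alpha> E" and p: "1 < p" and t: "0 < t"
  shows "deriv (\<lambda>\<tau>. poisson_integral f y \<tau>) t = Tp f t y / t"
proof -
  have "((\<lambda>\<tau>. poisson_integral f y \<tau>) has_real_derivative (\<integral>z. f z * dker t (y - z) \<partial>lborel)) (at t)"
    by (rule poisson_integral_has_derivative[OF level_setD(1)[OF L] potential_finite[OF L p] t])
  then show ?thesis
    using t by (simp add: DERIV_imp_deriv Tp_def mult.commute)
qed

lemma integrable_dker_level_set: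
  fixes f :: "'a::euclidean_space \<Rightarrow> real"
  assumes L: "level_set p f \<alpha> E" and p: "1 < p" and t: "0 < t"
  shows "integrable lborel (\<lambda>z. dker t (y - z) * f z)"
proof -
  obtain C where C0: "0 < C" and C: "\<And>t x. 0 < t \<Longrightarrow> \<bar>dker t (x::'a::euclidean_space)\<bar> \<le> C * rho t x powr (- (real DIM('a) + 1))"
    by (rule dker_bounds) blast
  note [measurable] = level_setD(1)[OF L]
  have "integrable lborel (\<lambda>z. \<bar>f z\<bar> * rho t (y - z) powr (- (real DIM('a) + 1)))"
    using potential_finite[OF L p t, of y] by (intro integrableI_bounded) (auto simp: abs_mult)
  then have "integrable lborel (\<lambda>z. C * (\<bar>f z\<bar> * rho t (y - z) powr (- (real DIM('a) + 1))))"
    by simp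
  then show ?thesis
  proof (rule Bochner_Integration.integrable_bound)
    show "AE z in lborel. norm (dker t (y - z) * f z) \<le> norm (C * (\<bar>f z\<bar> * rho t (y - z) powr (- (real DIM('a) + 1))))"
    proof (intro AE_I2)
      fix z
      have "\<bar>dker t (y - z)\<bar> * \<bar>f z\<bar> \<le> C * rho t (y - z) powr (- (real DIM('a) + 1)) * \<bar>f z\<bar>"
        by (intro mult_right_mono C t) auto
      then show "norm (dker t (y - z) * f z) \<le> norm (C * (\<bar>f z\<bar> * rho t (y - z) powr (- (real DIM('a) + 1))))"
        using C0 by (simp add: abs_mult mult_ac)
    qed
  qed measurable
qed

lemma abs_Tp_le_potential:
  obtains C where "0 < C" "\<And>(f::'a::euclidean_space \<Rightarrow> real) t y. 0 < t \<Longrightarrow> f \<in> borel_measurable borel \<Longrightarrow>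
    ennreal (\<bar>Tp f t y\<bar> / t) \<le> ennreal C * (\<integral>\<^sup>+z. ennreal \<bar>f z\<bar> * ennreal (rho t (y - z) powr (- (real DIM('a) + 1))) \<partial>lborel)"
proof -
  obtain C where C: "0 < C" "\<And>t x. 0 < t \<Longrightarrow> \<bar>dker t (x::'a::euclidean_space)\<bar> \<le> C * rho t x powr (- (real DIM('a) + 1))"
    by (rule dker_bounds) blast
  show thesis
  proof (rule that[OF C(1)])
    fix f :: "'a \<Rightarrow> real" and t :: real and y :: 'a assume t: "0 < t" and [measurable]: "f \<in> borel_measurable borel"
    have "ennreal (\<bar>Tp f t y\<bar> / t) = ennreal \<bar>\<integral>z. dker t (y - z) * f z \<partial>lborel\<bar>"
      using t by (simp add: Tp_def abs_mult)
    also have "\<dots> \<le> (\<integral>\<^sup>+z. ennreal \<bar>dker t (y - z) * f z\<bar> \<partial>lborel)"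
      by (rule abs_integral_le_nn_integral)
    also have "\<dots> \<le> (\<integral>\<^sup>+z. ennreal C * (ennreal \<bar>f z\<bar> * ennreal (rho t (y - z) powr (- (real DIM('a) + 1)))) \<partial>lborel)"
    proof (intro nn_integral_mono)
      fix z
      have "\<bar>dker t (y - z) * f z\<bar> \<le> C * rho t (y - z) powr (- (real DIM('a) + 1)) * \<bar>f z\<bar>"
        unfolding abs_mult by (intro mult_right_mono C t) auto
      then show "ennreal \<bar>dker t (y - z) * f z\<bar> \<le> ennreal C * (ennreal \<bar>f z\<bar> * ennreal (rho t (y - z) powr (- (real DIM('a) + 1))))"
        using C(1) by (simp add: mult_ac flip: ennreal_mult)
    qed
    also have "\<dots> = ennreal C * (\<integral>\<^sup>+z. ennreal \<bar>f z\<bar> * ennreal (rho t (y - z) powr (- (real DIM('a) + 1))) \<partial>lborel)"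
      by (rule nn_integral_cmult) measurable
    finally show "ennreal (\<bar>Tp f t y\<bar> / t) \<le> ennreal C * (\<integral>\<^sup>+z. ennreal \<bar>f z\<bar> * ennreal (rho t (y - z) powr (- (real DIM('a) + 1))) \<partial>lborel)" .
  qed
qed

lemma ennreal_mult_mult:
  fixes X :: ennreal
  assumes "0 \<le> a" "0 \<le> b" "a * b = c"
  shows "ennreal a * (ennreal b * X) = ennreal c * X"
  using assms by (auto simp: ennreal_mult mult.assoc)

lemma powr_divide_eq: "0 < (x::real) \<Longrightarrow> 0 < y \<Longrightarrow> (x / y) powr a = x powr a * y powr (- a)"
  by (simp add: powr_divide powr_minus_divide)

text \<open>Here m is any bound for the maximal function at y that is at least \<alpha>. The bound
  m/t is integrated against t^s near 0, where s > 0 gives convergence. The other bound decays like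
  t^(-1-N/q) after multiplication by t^s, because s - N/p = -N/q, and is integrated away from
  0.\<close>

lemma near_part_pointwise:
  fixes p q s :: real
  assumes p: "1 < p" "p < q" and s: "s = real DIM('a::euclidean_space) * (1 / p - 1 / q)" "0 < s"
  obtains K where "0 < K" "\<And>(f::'a \<Rightarrow> real) \<alpha> E y m. level_set p f \<alpha> E \<Longrightarrow> 0 < infdist y E \<Longrightarrow> \<alpha> \<le> m \<Longrightarrow>
     maximal_fun (\<lambda>z. ennreal \<bar>f z\<bar>) y \<le> ennreal m \<Longrightarrow>
     (\<integral>\<^sup>+t. ennreal (\<bar>Tp f t y\<bar> / t * t powr s) * indicator {0<..<infdist y E} t \<partial>lborel)
       \<le> ennreal (K * (infdist y E powr s * m powr (p / q) * \<alpha> powr (1 - p / q)))"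
proof -
  let ?N = "real DIM('a)"
  define k where "k = rho_const ?N"
  have k: "0 < k" unfolding k_def by (intro rho_const_pos) simp
  have N: "0 < ?N" by simp
  have q: "0 < q" using p by simp
  obtain C where C: "0 < C" "\<And>(f::'a::euclidean_space \<Rightarrow> real) t y. 0 < t \<Longrightarrow> f \<in> borel_measurable borel \<Longrightarrow>
    ennreal (\<bar>Tp f t y\<bar> / t) \<le> ennreal C * (\<integral>\<^sup>+z. ennreal \<bar>f z\<bar> * ennreal (rho t (y - z) powr (- (real DIM('a) + 1))) \<partial>lborel)"
    by (rule abs_Tp_le_potential) blast
  let ?K = "C * k * (1 / s + q / ?N)"
  show thesis
  proof (rule that[of ?K])
    show "0 < ?K" using C k s q N by (intro mult_pos_pos add_pos_pos) auto
    fix f :: "'a \<Rightarrow> real" and \<alpha> m :: real and E y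
    assume L: "level_set p f \<alpha> E" and d: "0 < infdist y E" and m: "\<alpha> \<le> m" "maximal_fun (\<lambda>z. ennreal \<bar>f z\<bar>) y \<le> ennreal m"
    note [measurable] = level_setD(1)[OF L]
    have \<alpha>: "0 < \<alpha>" by (rule level_setD[OF L])
    have m0: "0 < m" using \<alpha> m by linarith
    let ?d = "infdist y E"
    \<comment> \<open>The height at which m/t equals \<alpha> d^(N/p) t^(-1-N/p). At this r both
      integrals are multiples of the same quantity \<open>Z\<close>; \<open>e1\<close> and
      \<open>e2\<close> compute it from either side.\<close>
    define r where "r = ?d * (\<alpha> / m) powr (p / ?N)"
    have r: "0 < r" using d \<alpha> m0 by (simp add: r_def)
    define Z where "Z = ?d powr s * m powr (p / q) * \<alpha> powr (1 - p / q)"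
    have sN: "p / ?N * s = 1 - p / q"
      using N p by (simp add: s field_simps)
    have e1: "m * r powr s = Z"
    proof -
      have "r powr s = ?d powr s * (\<alpha> / m) powr (1 - p / q)"
        unfolding r_def powr_mult powr_powr sN ..
      also have "(\<alpha> / m) powr (1 - p / q) = \<alpha> powr (1 - p / q) * m powr (- (1 - p / q))"
        using \<alpha> m0 by (rule powr_divide_eq)
      finally have "m * r powr s = ?d powr s * \<alpha> powr (1 - p / q) * (m powr 1 * m powr (- (1 - p / q)))"
        using m0 by (simp add: mult_ac)
      also have "m powr 1 * m powr (- (1 - p / q)) = m powr (p / q)"
        unfolding powr_add[symmetric] by simp
      finally show ?thesis by (simp add: Z_def mult_ac)
    qed
    have e2: "\<alpha> * ?d powr (?N / p) * r powr (- (?N / q)) = Z"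
    proof -
      have *: "p / ?N * - (?N / q) = - (p / q)" using N by simp
      have "r powr (- (?N / q)) = ?d powr (- (?N / q)) * (\<alpha> / m) powr (- (p / q))"
        unfolding r_def powr_mult powr_powr * ..
      also have "(\<alpha> / m) powr (- (p / q)) = \<alpha> powr (- (p / q)) * m powr (p / q)"
        using powr_divide_eq[OF \<alpha> m0, of "- (p / q)"] by simp
      finally have "\<alpha> * ?d powr (?N / p) * r powr (- (?N / q)) = (?d powr (?N / p) * ?d powr (- (?N / q))) * m powr (p / q) * (\<alpha> powr 1 * \<alpha> powr (- (p / q)))"
        using \<alpha> by (simp add: mult_ac)
      also have "?d powr (?N / p) * ?d powr (- (?N / q)) = ?d powr s"
        unfolding powr_add[symmetric] s(1) by (intro arg_cong[where f = "\<lambda>e. ?d powr e"]) (simp add: algebra_simps)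
      also have "\<alpha> powr 1 * \<alpha> powr (- (p / q)) = \<alpha> powr (1 - p / q)"
        unfolding powr_add[symmetric] by simp
      finally show ?thesis by (simp add: Z_def)
    qed
    have "(\<integral>\<^sup>+t. ennreal (\<bar>Tp f t y\<bar> / t * t powr s) * indicator {0<..<?d} t \<partial>lborel)
      \<le> (\<integral>\<^sup>+t. ennreal (C * k * m) * (ennreal (t powr (s - 1)) * indicator {0..r} t) +
          ennreal (C * k * (\<alpha> * ?d powr (?N / p))) * (ennreal (t powr (- (?N / q) - 1)) * indicator {r..} t) \<partial>lborel)"
    proof (intro nn_integral_mono)
      fix t :: real
      show "ennreal (\<bar>Tp f t y\<bar> / t * t powr s) * indicator {0<..<?d} t \<le> ennreal (C * k * m) * (ennreal (t powr (s - 1)) * indicator {0..r} t) +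
          ennreal (C * k * (\<alpha> * ?d powr (?N / p))) * (ennreal (t powr (- (?N / q) - 1)) * indicator {r..} t)"
      proof (cases "0 < t \<and> t < ?d")
        case True
        let ?V = "\<integral>\<^sup>+z. ennreal \<bar>f z\<bar> * ennreal (rho t (y - z) powr (- (real DIM('a) + 1))) \<partial>lborel"
        have "ennreal (\<bar>Tp f t y\<bar> / t * t powr s) = ennreal (\<bar>Tp f t y\<bar> / t) * ennreal (t powr s)"
          by (rule ennreal_mult'') simp
        also have "\<dots> \<le> (ennreal C * ?V) * ennreal (t powr s)"
          using True by (intro mult_right_mono C) auto
        finally have *: "ennreal (\<bar>Tp f t y\<bar> / t * t powr s) \<le> (ennreal C * ?V) * ennreal (t powr s)" .
        show ?thesis
        proof (cases "t \<le> r")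
          case le: True
          have "?V \<le> ennreal (k * m / t)"
            unfolding k_def using True m m0 by (intro potential_le_maximal) auto
          then have "(ennreal C * ?V) * ennreal (t powr s) \<le> (ennreal C * ennreal (k * m / t)) * ennreal (t powr s)"
            by (intro mult_right_mono mult_left_mono) auto
          also have "\<dots> = ennreal (C * (k * m / t) * t powr s)"
            using C(1) k m0 True by (simp flip: ennreal_mult)
          also have "C * (k * m / t) * t powr s = C * k * m * t powr (s - 1)"
            using True by (simp add: powr_diff)
          also have "ennreal (C * k * m * t powr (s - 1)) = ennreal (C * k * m) * (ennreal (t powr (s - 1)) * indicator {0..r} t)"
            using le True by (simp add: ennreal_mult'')
          finally have "ennreal (\<bar>Tp f t y\<bar> / t * t powr s) \<le> ennreal (C * k * m) * (ennreal (t powr (s - 1)) * indicator {0..r} t)"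
            by (rule order_trans[OF *])
          also have "\<dots> \<le> ennreal (C * k * m) * (ennreal (t powr (s - 1)) * indicator {0..r} t) + ennreal (C * k * (\<alpha> * ?d powr (?N / p))) * (ennreal (t powr (- (?N / q) - 1)) * indicator {r..} t)"
            by simp
          finally show ?thesis
            using True by simp
        next
          case le: False
          have "?V \<le> ennreal (k * \<alpha> * ?d powr (?N / p) * t powr (- 1 - ?N / p))"
            unfolding k_def using True by (intro potential_le_near[OF L p(1)]) auto
          then have "(ennreal C * ?V) * ennreal (t powr s) \<le> (ennreal C * ennreal (k * \<alpha> * ?d powr (?N / p) * t powr (- 1 - ?N / p))) * ennreal (t powr s)"
            by (intro mult_right_mono mult_left_mono) auto
          also have "\<dots> = ennreal (C * (k * \<alpha> * ?d powr (?N / p) * t powr (- 1 - ?N / p)) * t powr s)"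
            using C(1) k \<alpha> by (simp flip: ennreal_mult)
          also have "C * (k * \<alpha> * ?d powr (?N / p) * t powr (- 1 - ?N / p)) * t powr s = C * k * (\<alpha> * ?d powr (?N / p)) * (t powr (- 1 - ?N / p) * t powr s)"
            by simp
          also have "t powr (- 1 - ?N / p) * t powr s = t powr (- (?N / q) - 1)"
            unfolding powr_add[symmetric] s(1) by (intro arg_cong[where f = "\<lambda>e. t powr e"]) (simp add: algebra_simps)
          also have "ennreal (C * k * (\<alpha> * ?d powr (?N / p)) * t powr (- (?N / q) - 1)) = ennreal (C * k * (\<alpha> * ?d powr (?N / p))) * (ennreal (t powr (- (?N / q) - 1)) * indicator {r..} t)"
            using le by (simp add: ennreal_mult'')
          finally have "ennreal (\<bar>Tp f t y\<bar> / t * t powr s) \<le> ennreal (C * k * (\<alpha> * ?d powr (?N / p))) * (ennreal (t powr (- (?N / q) - 1)) * indicator {r..} t)"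
            by (rule order_trans[OF *])
          also have "\<dots> \<le> ennreal (C * k * m) * (ennreal (t powr (s - 1)) * indicator {0..r} t) + ennreal (C * k * (\<alpha> * ?d powr (?N / p))) * (ennreal (t powr (- (?N / q) - 1)) * indicator {r..} t)"
            by simp
          finally show ?thesis
            using True by simp
        qed
      qed auto
    qed
    also have "\<dots> = ennreal (C * k * m) * ennreal (r powr s / s) + ennreal (C * k * (\<alpha> * ?d powr (?N / p))) * ennreal (r powr (- (?N / q)) / (?N / q))"
      using nn_integral_powr_atMost[of r s] nn_integral_powr_atLeast[of r "?N / q"] r s(2) N q
      by (simp add: nn_integral_add nn_integral_cmult)
    also have "\<dots> = ennreal (C * k * m * (r powr s / s) + C * k * (\<alpha> * ?d powr (?N / p)) * (r powr (- (?N / q)) / (?N / q)))"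
      using C(1) k m0 \<alpha> s(2) q N by (simp flip: ennreal_mult ennreal_plus)
    also have "C * k * m * (r powr s / s) + C * k * (\<alpha> * ?d powr (?N / p)) * (r powr (- (?N / q)) / (?N / q))
      = C * k * (m * r powr s) / s + C * k * (\<alpha> * ?d powr (?N / p) * r powr (- (?N / q))) * q / ?N"
      by simp
    also have "\<dots> = ?K * Z"
      unfolding e1 e2 by (simp add: algebra_simps)
    finally show "(\<integral>\<^sup>+t. ennreal (\<bar>Tp f t y\<bar> / t * t powr s) * indicator {0<..<?d} t \<partial>lborel)
       \<le> ennreal (?K * (?d powr s * m powr (p / q) * \<alpha> powr (1 - p / q)))"
      unfolding Z_def .
  qed
qed

text \<open>In the q-th power of the pointwise bound the factor d^(sq) cancels the weight, and
  \<alpha>^(q-p) m^p remains. With m = max \<alpha> (M f) one has m^p \<le> (M f)^p + \<alpha>^p,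
  and the second term occurs only off \<open>E\<close>, a set of finite measure.\<close>

lemma near_part_bound:
  fixes p q s :: real
  assumes p: "1 < p" "p < q" and s: "s = real DIM('a::euclidean_space) * (1 / p - 1 / q)" "0 < s"
  obtains K where "0 < K" "\<And>(f::'a \<Rightarrow> real) \<alpha> E. level_set p f \<alpha> E \<Longrightarrow>
     (\<integral>\<^sup>+y. ennreal (infdist y E powr (- (s * q))) *
        enn_powr (\<integral>\<^sup>+t. ennreal (\<bar>Tp f t y\<bar> / t * t powr s) * indicator {0<..<infdist y E} t \<partial>lborel) q \<partial>lborel)
       \<le> ennreal (K * \<alpha> powr (q - p)) * (\<integral>\<^sup>+z. ennreal (\<bar>f z\<bar> powr p) \<partial>lborel)"
proof -
  have q: "0 < q" using p by simp
  obtain K where K: "0 < K" "\<And>(f::'a \<Rightarrow> real) \<alpha> E y m. level_set p f \<alpha> E \<Longrightarrow> 0 < infdist y E \<Longrightarrow> \<alpha> \<le> m \<Longrightarrow>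
     maximal_fun (\<lambda>z. ennreal \<bar>f z\<bar>) y \<le> ennreal m \<Longrightarrow>
     (\<integral>\<^sup>+t. ennreal (\<bar>Tp f t y\<bar> / t * t powr s) * indicator {0<..<infdist y E} t \<partial>lborel)
       \<le> ennreal (K * (infdist y E powr s * m powr (p / q) * \<alpha> powr (1 - p / q)))"
    by (rule near_part_pointwise[OF p s]) blast
  define CM where "CM = 2 * 5 ^ DIM('a) * p / (p - 1) * (1 / 2) powr (1 - p)"
  have CM: "0 < CM" using p by (simp add: CM_def)
  let ?K = "K powr q * (CM + (5 ^ DIM('a) + 2))"
  show thesis
  proof (rule that[of ?K])
    show "0 < ?K" using K CM by (intro mult_pos_pos add_pos_pos) auto
    fix f :: "'a \<Rightarrow> real" and \<alpha> :: real and E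
    assume L: "level_set p f \<alpha> E"
    note [measurable] = level_setD(1)[OF L]
    have \<alpha>: "0 < \<alpha>" by (rule level_setD[OF L])
    have E: "closed E" "E \<noteq> {}" using level_setD[OF L] by auto
    have [measurable]: "- E \<in> sets borel" using E by (simp add: borel_open)
    let ?X = "\<integral>\<^sup>+z. ennreal (\<bar>f z\<bar> powr p) \<partial>lborel"
    let ?M = "maximal_fun (\<lambda>z. ennreal \<bar>f z\<bar>)"
    let ?I = "\<lambda>y. \<integral>\<^sup>+t. ennreal (\<bar>Tp f t y\<bar> / t * t powr s) * indicator {0<..<infdist y E} t \<partial>lborel"
    have "(\<integral>\<^sup>+y. ennreal (infdist y E powr (- (s * q))) * enn_powr (?I y) q \<partial>lborel)
      \<le> (\<integral>\<^sup>+y. ennreal (K powr q * \<alpha> powr (q - p)) * (enn_powr (?M y) p + ennreal (\<alpha> powr p) * indicator (- E) y) \<partial>lborel)"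
    proof (intro nn_integral_mono)
      fix y
      show "ennreal (infdist y E powr (- (s * q))) * enn_powr (?I y) q \<le> ennreal (K powr q * \<alpha> powr (q - p)) * (enn_powr (?M y) p + ennreal (\<alpha> powr p) * indicator (- E) y)"
      proof (cases "y \<in> E")
        case True
        \<comment> \<open>On \<open>E\<close> the weight is a negative power of 0, which by
          convention is 0, so such points contribute nothing.\<close>
        then have "infdist y E = 0" by simp
        then show ?thesis by simp
      next
        case False
        then have d: "0 < infdist y E"
          using infdist_eq_0_iff_closed[OF E, of y] infdist_nonneg[of y E] by linarith
        show ?thesis
        proof (cases "?M y")
          case top
          then show ?thesis
            using K(1) \<alpha> by (simp add: ennreal_mult_top)
        next
          case (real m')
          define m where "m = max \<alpha> m'"
          have m: "\<alpha> \<le> m" "?M y \<le> ennreal m" "0 < m" using real \<alpha> by (auto simp: m_def intro: ennreal_leI)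
          let ?d = "infdist y E"
          let ?Z = "?d powr s * m powr (p / q) * \<alpha> powr (1 - p / q)"
          have "enn_powr (?I y) q \<le> enn_powr (ennreal (K * ?Z)) q"
            using q by (intro enn_powr_mono K L d m) auto
          also have "\<dots> = ennreal ((K * ?Z) powr q)"
            using K(1) by (intro enn_powr_ennreal) auto
          also have "(K * ?Z) powr q = K powr q * (?d powr (s * q) * m powr p * \<alpha> powr (q - p))"
          proof -
            have "(1 - p / q) * q = q - p" using q by (simp add: field_simps)
            then show ?thesis
              using K(1) q by (simp add: powr_mult powr_powr)
          qed
          finally have "ennreal (?d powr (- (s * q))) * enn_powr (?I y) q \<le> ennreal (?d powr (- (s * q))) * ennreal (K powr q * (?d powr (s * q) * m powr p * \<alpha> powr (q - p)))"
            by (intro mult_left_mono) auto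
          also have "\<dots> = ennreal (K powr q * \<alpha> powr (q - p) * m powr p)"
          proof -
            have "?d powr (- (s * q)) * ?d powr (s * q) = 1"
              unfolding powr_add[symmetric] using d by simp
            have "?d powr (- (s * q)) * (K powr q * (?d powr (s * q) * m powr p * \<alpha> powr (q - p))) = K powr q * \<alpha> powr (q - p) * m powr p"
            proof -
              have "?d powr (- (s * q)) * (K powr q * (?d powr (s * q) * m powr p * \<alpha> powr (q - p)))
                = (?d powr (- (s * q)) * ?d powr (s * q)) * (K powr q * \<alpha> powr (q - p) * m powr p)"
                by (simp only: mult_ac)
              then show ?thesis
                by (simp only: \<open>?d powr (- (s * q)) * ?d powr (s * q) = 1\<close> mult_1)
            qed
            then show ?thesis by (subst ennreal_mult[symmetric]) auto
          qed
          also have "\<dots> \<le> ennreal (K powr q * \<alpha> powr (q - p) * (m' powr p + \<alpha> powr p))"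
            by (intro ennreal_leI mult_left_mono) (auto simp: m_def max_def)
          also have "\<dots> = ennreal (K powr q * \<alpha> powr (q - p)) * (enn_powr (?M y) p + ennreal (\<alpha> powr p) * indicator (- E) y)"
            using False real by (simp add: enn_powr_ennreal ennreal_mult flip: ennreal_plus)
          finally show ?thesis .
        qed
      qed
    qed
    also have "\<dots> = ennreal (K powr q * \<alpha> powr (q - p)) * ((\<integral>\<^sup>+y. enn_powr (?M y) p \<partial>lborel) + ennreal (\<alpha> powr p) * emeasure lborel (- E))"
      by (simp add: nn_integral_add nn_integral_cmult)
    also have "\<dots> \<le> ennreal (K powr q * \<alpha> powr (q - p)) * (ennreal CM * ?X + ennreal (\<alpha> powr p) * (ennreal ((5 ^ DIM('a) + 2) * \<alpha> powr (- p)) * ?X))"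
      unfolding CM_def using p by (intro mult_left_mono add_mono nn_integral_maximal_fun_powr_le level_setD(6)[OF L]) auto
    \<comment> \<open>The factor \<alpha>^p cancels the \<alpha>^(-p) in the measure of the
      complement of \<open>E\<close>.\<close>
    also have "ennreal (\<alpha> powr p) * (ennreal ((5 ^ DIM('a) + 2) * \<alpha> powr (- p)) * ?X) = ennreal (5 ^ DIM('a) + 2) * ?X"
    proof -
      have "\<alpha> powr p * ((5 ^ DIM('a) + 2) * \<alpha> powr (- p)) = (5 ^ DIM('a) + 2) * (\<alpha> powr p * \<alpha> powr (- p))"
        by simp
      also have "\<alpha> powr p * \<alpha> powr (- p) = 1"
        unfolding powr_add[symmetric] using \<alpha> by simp
      finally show ?thesis
        by (intro ennreal_mult_mult) auto
    qed
    also have "ennreal (K powr q * \<alpha> powr (q - p)) * (ennreal CM * ?X + ennreal (5 ^ DIM('a) + 2) * ?X) = ennreal (?K * \<alpha> powr (q - p)) * ?X"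
    proof -
      have "ennreal CM * ?X + ennreal (5 ^ DIM('a) + 2) * ?X = ennreal (CM + (5 ^ DIM('a) + 2)) * ?X"
        using CM by (subst ennreal_plus) (auto simp: distrib_right)
      then show ?thesis
        using CM by (simp only:) (intro ennreal_mult_mult, auto simp: mult_ac)
    qed
    finally show "(\<integral>\<^sup>+y. ennreal (infdist y E powr (- (s * q))) * enn_powr (?I y) q \<partial>lborel) \<le> ennreal (?K * \<alpha> powr (q - p)) * ?X" .
  qed
qed

section \<open>Spreading the mass of the exceptional set\<close>

text \<open>\<open>smear E w\<close> is the uniform probability density on the ball around \<open>w\<close> whose radius is a quarter
  of the distance from \<open>w\<close> to \<open>E\<close>. Spreading the values of \<open>f\<close> off \<open>E\<close> with it replaces the
  averaging over Calderon-Zygmund cubes.\<close>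

definition smear :: "'a::euclidean_space set \<Rightarrow> 'a \<Rightarrow> 'a \<Rightarrow> real" where
  "smear E w z = (if dist w z < infdist w E / 4
     then 1 / (unit_ball_vol (real DIM('a)) * (infdist w E / 4) powr real DIM('a)) else 0)"

lemma smear_measurable [measurable]:
  assumes [measurable]: "f \<in> borel_measurable M" "g \<in> borel_measurable M"
  shows "(\<lambda>x. smear E (f x) (g x)) \<in> borel_measurable M"
  unfolding smear_def by measurable

lemma smear_nonneg [simp]: "0 \<le> smear E w z"
  by (simp add: smear_def)

lemma smear_on_E: "w \<in> E \<Longrightarrow> smear E w z = 0"
  by (simp add: smear_def)

lemma nn_integral_smear:
  fixes w :: "'a::euclidean_space"
  assumes d: "0 < infdist w E"
  shows "(\<integral>\<^sup>+z. ennreal (smear E w z) \<partial>lborel) = 1"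
proof -
  let ?v = "unit_ball_vol (real DIM('a)) * (infdist w E / 4) powr real DIM('a)"
  have v: "0 < ?v" using d by simp
  have "(\<integral>\<^sup>+z. ennreal (smear E w z) \<partial>lborel) = (\<integral>\<^sup>+z. ennreal (1 / ?v) * indicator (ball w (infdist w E / 4)) z \<partial>lborel)"
    by (intro nn_integral_cong) (auto simp: smear_def indicator_def)
  also have "\<dots> = ennreal (1 / ?v) * ennreal ?v"
    using d by (subst nn_integral_cmult) (auto simp: emeasure_ball powr_realpow)
  also have "\<dots> = 1"
    using v by (subst ennreal_mult[symmetric]) auto
  finally show ?thesis .
qed

text \<open>The bound is recast in terms of z, since the integral in \<open>good_part\<close> runs
  over w. The distance to \<open>E\<close> is 1-Lipschitz, so |w - z| < d(w)/4 forces d(z)/5 \<le>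
  d(w)/4 and puts w into the ball around z of radius 2 d(z). That radius exceeds d(z), so f has
  controlled average there.\<close>

lemma smear_le:
  fixes w z :: "'a::euclidean_space"
  defines "N \<equiv> real DIM('a)"
  shows "smear E w z \<le> 1 / (unit_ball_vol N * (infdist z E / 5) powr N) * indicator (ball z (2 * infdist z E)) w"
proof (cases "dist w z < infdist w E / 4")
  case True
  have 1: "infdist w E \<le> infdist z E + dist w z"
    by (rule infdist_triangle)
  have 2: "infdist z E \<le> infdist w E + dist w z"
    using infdist_triangle[of z E w] by (simp add: dist_commute)
  have d: "0 < infdist w E" using True zero_le_dist[of w z] by linarith
  have le: "infdist z E / 5 \<le> infdist w E / 4" using True 2 by linarith
  have dz: "0 < infdist z E" using True 1 d by linarith
  have "dist w z < 2 * infdist z E" using True 1 dz by linarith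
  moreover have "1 / (unit_ball_vol N * (infdist w E / 4) powr N) \<le> 1 / (unit_ball_vol N * (infdist z E / 5) powr N)"
    using le dz d by (intro divide_left_mono mult_left_mono powr_mono2) (auto simp: N_def)
  ultimately show ?thesis
    using True by (simp add: smear_def N_def dist_commute)
qed (simp add: smear_def N_def)

text \<open>The ratio of the radii 2 d(z) and d(z)/5 is 10, which gives 10^N; the factor 2 comes
  from the average of |f|. For z in \<open>E\<close> the ball in \<open>smear_le\<close> is empty,
  so no mass is ever spread onto \<open>E\<close>.\<close>

lemma nn_integral_smear_le:
  fixes f :: "'a::euclidean_space \<Rightarrow> real"
  assumes L: "level_set p f \<alpha> E" and p: "1 < p"
  shows "(\<integral>\<^sup>+w. ennreal (\<bar>f w\<bar> * smear E w z) \<partial>lborel) \<le> ennreal (2 * 10 powr real DIM('a) * \<alpha>) * indicator (- E) z"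
proof (cases "z \<in> E")
  case True
  then have "smear E w z = 0" for w
    using smear_le[of E w z] smear_nonneg[of E w z] by (intro antisym) auto
  then show ?thesis by simp
next
  case False
  note [measurable] = level_setD(1)[OF L]
  have \<alpha>: "0 < \<alpha>" by (rule level_setD[OF L])
  let ?d = "infdist z E" and ?N = "real DIM('a)" and ?w = "unit_ball_vol (real DIM('a))"
  have d: "0 < ?d"
    using False infdist_eq_0_iff_closed[OF level_setD(3,4)[OF L], of z] infdist_nonneg[of z E] by linarith
  have "(\<integral>\<^sup>+w. ennreal (\<bar>f w\<bar> * smear E w z) \<partial>lborel)
    \<le> (\<integral>\<^sup>+w. ennreal (1 / (?w * (?d / 5) powr ?N)) * (ennreal \<bar>f w\<bar> * indicator (ball z (2 * ?d)) w) \<partial>lborel)"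
  proof (intro nn_integral_mono)
    fix w
    have "\<bar>f w\<bar> * smear E w z \<le> \<bar>f w\<bar> * (1 / (?w * (?d / 5) powr ?N) * indicator (ball z (2 * ?d)) w)"
      by (intro mult_left_mono smear_le) auto
    then have "ennreal (\<bar>f w\<bar> * smear E w z) \<le> ennreal (\<bar>f w\<bar> * (1 / (?w * (?d / 5) powr ?N) * indicator (ball z (2 * ?d)) w))"
      by (rule ennreal_leI)
    also have "\<dots> = ennreal (1 / (?w * (?d / 5) powr ?N)) * (ennreal \<bar>f w\<bar> * indicator (ball z (2 * ?d)) w)"
      by (cases "w \<in> ball z (2 * ?d)") (auto simp: mult.commute simp flip: ennreal_mult)
    finally show "ennreal (\<bar>f w\<bar> * smear E w z) \<le> ennreal (1 / (?w * (?d / 5) powr ?N)) * (ennreal \<bar>f w\<bar> * indicator (ball z (2 * ?d)) w)" .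
  qed
  also have "\<dots> = ennreal (1 / (?w * (?d / 5) powr ?N)) * (\<integral>\<^sup>+w\<in>ball z (2 * ?d). ennreal \<bar>f w\<bar> \<partial>lborel)"
    by (rule nn_integral_cmult) measurable
  also have "\<dots> \<le> ennreal (1 / (?w * (?d / 5) powr ?N)) * ennreal (2 * \<alpha> * ?w * (2 * ?d) powr ?N)"
    using d by (intro mult_left_mono nn_integral_ball_le[OF L p]) auto
  also have "\<dots> = ennreal (1 / (?w * (?d / 5) powr ?N) * (2 * \<alpha> * ?w * (2 * ?d) powr ?N))"
    using \<alpha> by (intro ennreal_mult[symmetric]) auto
  also have "1 / (?w * (?d / 5) powr ?N) * (2 * \<alpha> * ?w * (2 * ?d) powr ?N) = 2 * 10 powr ?N * \<alpha>"
  proof -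
    have "(2 * ?d) powr ?N = (10 * (?d / 5)) powr ?N"
      by simp
    also have "\<dots> = 10 powr ?N * (?d / 5) powr ?N"
      by (rule powr_mult)
    finally have *: "(2 * ?d) powr ?N = 10 powr ?N * (?d / 5) powr ?N" .
    have "(?d / 5) powr ?N \<noteq> 0" using d by simp
    moreover have "?w \<noteq> 0" using unit_ball_vol_pos[of ?N] by (metis less_irrefl of_nat_0_le_iff)
    ultimately show ?thesis unfolding * by (simp add: field_simps)
  qed
  finally show ?thesis using False by simp
qed

text \<open>Since \<open>smear E w\<close> vanishes for w in \<open>E\<close>, the integral
  redistributes only the values of f off \<open>E\<close>, and it vanishes for z in
  \<open>E\<close>. The two summands therefore have disjoint supports.\<close>

definition good_part :: "('a::euclidean_space \<Rightarrow> real) \<Rightarrow> 'a set \<Rightarrow> 'a \<Rightarrow> real" where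
  "good_part f E z = f z * indicator E z + (\<integral>w. f w * smear E w z \<partial>lborel)"

lemma smear_integral_le:
  fixes f :: "'a::euclidean_space \<Rightarrow> real"
  assumes L: "level_set p f \<alpha> E" and p: "1 < p"
  shows "\<bar>\<integral>w. f w * smear E w z \<partial>lborel\<bar> \<le> 2 * 10 powr real DIM('a) * \<alpha> * indicator (- E) z"
proof -
  have \<alpha>: "0 < \<alpha>" by (rule level_setD[OF L])
  have "ennreal \<bar>\<integral>w. f w * smear E w z \<partial>lborel\<bar> \<le> (\<integral>\<^sup>+w. ennreal \<bar>f w * smear E w z\<bar> \<partial>lborel)"
    by (rule abs_integral_le_nn_integral)
  also have "\<dots> = (\<integral>\<^sup>+w. ennreal (\<bar>f w\<bar> * smear E w z) \<partial>lborel)"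
    by (simp add: abs_mult)
  also have "\<dots> \<le> ennreal (2 * 10 powr real DIM('a) * \<alpha>) * indicator (- E) z"
    by (rule nn_integral_smear_le[OF L p])
  also have "\<dots> = ennreal (2 * 10 powr real DIM('a) * \<alpha> * indicator (- E) z)"
    by (auto simp: indicator_def)
  finally show ?thesis
    using \<alpha> by (subst (asm) ennreal_le_iff) auto
qed

lemma good_part_measurable:
  assumes L: "level_set p f \<alpha> E"
  shows "good_part f E \<in> borel_measurable borel"
proof -
  note [measurable] = level_setD(1)[OF L]
  have [measurable]: "E \<in> sets borel" using level_setD(3)[OF L] by simp
  show ?thesis unfolding good_part_def by measurable
qed

lemma good_part_le:
  fixes f :: "'a::euclidean_space \<Rightarrow> real"
  assumes L: "level_set p f \<alpha> E" and p: "1 < p"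
  shows "z \<in> E \<Longrightarrow> good_part f E z = f z" "\<bar>good_part f E z\<bar> \<le> 2 * 10 powr real DIM('a) * \<alpha>"
proof -
  show 1: "good_part f E z = f z" if "z \<in> E"
    using smear_integral_le[OF L p, of z] that by (simp add: good_part_def)
  have "\<alpha> \<le> 2 * 10 powr real DIM('a) * \<alpha>"
    using level_setD(2)[OF L] ge_one_powr_ge_zero[of 10 "real DIM('a)"] by simp
  then show "\<bar>good_part f E z\<bar> \<le> 2 * 10 powr real DIM('a) * \<alpha>"
    using smear_integral_le[OF L p, of z] 1 level_setD(5)[OF L, of z]
    by (cases "z \<in> E") (auto simp: good_part_def)
qed

text \<open>On \<open>E\<close> the function is f itself, and |f| \<le> \<alpha> turns |f|^q into
  \<alpha>^(q-p) |f|^p. Off \<open>E\<close> it is at most a multiple of \<alpha> on a set of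
  measure C \<alpha>^(-p) ||f||_p^p. Both parts scale alike.\<close>

lemma good_part_Lq:
  fixes f :: "'a::euclidean_space \<Rightarrow> real"
  assumes L: "level_set p f \<alpha> E" and p: "1 < p" "p < q"
  shows "(\<integral>\<^sup>+z. ennreal (\<bar>good_part f E z\<bar> powr q) \<partial>lborel) \<le>
    ennreal ((1 + (2 * 10 powr real DIM('a)) powr q * (5 ^ DIM('a) + 2)) * \<alpha> powr (q - p)) * (\<integral>\<^sup>+z. ennreal (\<bar>f z\<bar> powr p) \<partial>lborel)"
proof -
  note [measurable] = level_setD(1)[OF L] good_part_measurable[OF L]
  have \<alpha>: "0 < \<alpha>" by (rule level_setD[OF L])
  have [measurable]: "E \<in> sets borel" using level_setD(3)[OF L] by simp
  define c where "c = (2 * 10 powr real DIM('a)) powr q"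
  let ?X = "\<integral>\<^sup>+z. ennreal (\<bar>f z\<bar> powr p) \<partial>lborel"
  have "(\<integral>\<^sup>+z. ennreal (\<bar>good_part f E z\<bar> powr q) \<partial>lborel)
    \<le> (\<integral>\<^sup>+z. ennreal (\<alpha> powr (q - p)) * ennreal (\<bar>f z\<bar> powr p) + ennreal (c * \<alpha> powr q) * indicator (- E) z \<partial>lborel)"
  proof (intro nn_integral_mono)
    fix z
    show "ennreal (\<bar>good_part f E z\<bar> powr q) \<le> ennreal (\<alpha> powr (q - p)) * ennreal (\<bar>f z\<bar> powr p) + ennreal (c * \<alpha> powr q) * indicator (- E) z"
    proof (cases "z \<in> E")
      case True
      have "\<bar>f z\<bar> powr q = \<bar>f z\<bar> powr (q - p) * \<bar>f z\<bar> powr p"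
        unfolding powr_add[symmetric] by simp
      also have "\<dots> \<le> \<alpha> powr (q - p) * \<bar>f z\<bar> powr p"
        using level_setD(5)[OF L True] p by (intro mult_right_mono powr_mono2) auto
      finally show ?thesis
        using True good_part_le(1)[OF L p(1) True] by (simp flip: ennreal_mult)
    next
      case False
      have "\<bar>good_part f E z\<bar> powr q \<le> (2 * 10 powr real DIM('a) * \<alpha>) powr q"
        using good_part_le(2)[OF L p(1), of z] p by (intro powr_mono2) auto
      also have "\<dots> = c * \<alpha> powr q"
        unfolding c_def by (rule powr_mult)
      finally show ?thesis
        using False by (simp add: add_increasing ennreal_leI)
    qed
  qed
  also have "\<dots> = ennreal (\<alpha> powr (q - p)) * ?X + ennreal (c * \<alpha> powr q) * emeasure lborel (- E)"
    by (simp add: nn_integral_add nn_integral_cmult)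
  also have "\<dots> \<le> ennreal (\<alpha> powr (q - p)) * ?X + ennreal (c * \<alpha> powr q) * (ennreal ((5 ^ DIM('a) + 2) * \<alpha> powr (- p)) * ?X)"
    by (intro add_left_mono mult_left_mono level_setD(6)[OF L]) auto
  also have "ennreal (c * \<alpha> powr q) * (ennreal ((5 ^ DIM('a) + 2) * \<alpha> powr (- p)) * ?X) = ennreal (c * (5 ^ DIM('a) + 2) * \<alpha> powr (q - p)) * ?X"
  proof -
    have "c * \<alpha> powr q * ((5 ^ DIM('a) + 2) * \<alpha> powr (- p)) = c * (5 ^ DIM('a) + 2) * (\<alpha> powr q * \<alpha> powr (- p))"
      by simp
    also have "\<alpha> powr q * \<alpha> powr (- p) = \<alpha> powr (q - p)"
      unfolding powr_add[symmetric] by simp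
    finally show ?thesis
      by (intro ennreal_mult_mult) (auto simp: c_def)
  qed
  also have "ennreal (\<alpha> powr (q - p)) * ?X + ennreal (c * (5 ^ DIM('a) + 2) * \<alpha> powr (q - p)) * ?X
    = ennreal ((1 + c * (5 ^ DIM('a) + 2)) * \<alpha> powr (q - p)) * ?X"
    unfolding distrib_right[symmetric] by (subst ennreal_plus[symmetric]) (auto simp: c_def algebra_simps)
  finally show ?thesis unfolding c_def .
qed

text \<open>By Fubini the spreading is moved from f to the kernel. Since each
  \<open>smear E w\<close> has mass one, the difference is the integral over w off \<open>E\<close>
  of f(w) times the mean of D(w) - D(z) over the small ball around w. The smoothness of
  \<open>dker\<close> bounds this mean by d(w) times one more negative power of
  \<open>rho\<close>.\<close>

lemma Tp_diff_good_part_le: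
  obtains C where "0 < C" "\<And>(f::'a::euclidean_space \<Rightarrow> real) p \<alpha> E t y. level_set p f \<alpha> E \<Longrightarrow> 1 < p \<Longrightarrow> 0 < t \<Longrightarrow> infdist y E \<le> t \<Longrightarrow>
    ennreal \<bar>Tp f t y - Tp (good_part f E) t y\<bar> \<le>
      ennreal (C * t) * (\<integral>\<^sup>+w. ennreal \<bar>f w\<bar> * ennreal (infdist w E * rho t (y - w) powr (- (real DIM('a) + 2))) \<partial>lborel)"
proof -
  let ?N = "real DIM('a)"
  obtain C where C: "0 < C"
    and lip: "\<And>t x y. 0 < t \<Longrightarrow> norm (x - y) \<le> rho t x / 2 \<Longrightarrow>
        \<bar>dker t (x::'a) - dker t y\<bar> \<le> C * norm (x - y) * rho t x powr (- (real DIM('a) + 2))"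
    and L1: "\<And>t y. 0 < t \<Longrightarrow> (\<integral>\<^sup>+z. ennreal \<bar>dker t ((y::'a) - z)\<bar> \<partial>lborel) \<le> ennreal (C / t)"
    by (rule dker_bounds) blast
  show thesis
  proof (rule that[OF C])
    fix f :: "'a \<Rightarrow> real" and p \<alpha> t :: real and E y
    assume L: "level_set p f \<alpha> E" and p: "1 < p" and t: "0 < t" and d: "infdist y E \<le> t"
    note [measurable] = level_setD(1)[OF L] good_part_measurable[OF L]
    have \<alpha>: "0 < \<alpha>" by (rule level_setD[OF L])
    have [measurable]: "E \<in> sets borel" using level_setD(3)[OF L] by simp
    define G where "G = 2 * 10 powr ?N * \<alpha>"
    have G: "0 < G" using \<alpha> by (simp add: G_def)
    define D where "D = (\<lambda>z. dker t (y - z))"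
    have [measurable]: "D \<in> borel_measurable borel" unfolding D_def by measurable
    define S where "S = (\<lambda>z. \<integral>w. f w * smear E w z \<partial>lborel)"
    have [measurable]: "S \<in> borel_measurable borel" unfolding S_def by measurable
    define B where "B = (\<lambda>w. \<integral>z. D z * smear E w z \<partial>lborel)"
    have iDf: "integrable lborel (\<lambda>z. D z * f z)"
      unfolding D_def by (rule integrable_dker_level_set[OF L p t])
    have iDfE: "integrable lborel (\<lambda>z. D z * (f z * indicator E z))" "integrable lborel (\<lambda>z. D z * (f z * indicator (- E) z))"
      by (auto intro!: Bochner_Integration.integrable_bound[OF iDf] AE_I2 simp: indicator_def)
    have iDS: "integrable lborel (\<lambda>z. D z * S z)"
      unfolding D_def
    proof (rule integrable_dker_mult[OF t])
      show "\<bar>S z\<bar> \<le> G" for z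
        using smear_integral_le[OF L p, of z] G by (cases "z \<in> E") (auto simp: S_def G_def)
    qed measurable
    \<comment> \<open>Absolute convergence for Fubini: the integral over w is at most
      \<open>G\<close> for every z, and the kernel is integrable in z.\<close>
    have "(\<integral>\<^sup>+u. ennreal (norm (case u of (w, z) \<Rightarrow> D z * (f w * smear E w z))) \<partial>(lborel \<Otimes>\<^sub>M lborel))
      = (\<integral>\<^sup>+z. \<integral>\<^sup>+w. ennreal (norm (D z * (f w * smear E w z))) \<partial>lborel \<partial>lborel)"
      by (subst lborel_pair.nn_integral_snd[symmetric]) auto
    also have "\<dots> \<le> (\<integral>\<^sup>+z. ennreal G * ennreal \<bar>D z\<bar> \<partial>lborel)"
    proof (intro nn_integral_mono)
      fix z
      have "(\<integral>\<^sup>+w. ennreal (norm (D z * (f w * smear E w z))) \<partial>lborel) = (\<integral>\<^sup>+w. ennreal \<bar>D z\<bar> * ennreal (\<bar>f w\<bar> * smear E w z) \<partial>lborel)"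
        by (intro nn_integral_cong) (simp add: abs_mult flip: ennreal_mult)
      also have "\<dots> = ennreal \<bar>D z\<bar> * (\<integral>\<^sup>+w. ennreal (\<bar>f w\<bar> * smear E w z) \<partial>lborel)"
        by (rule nn_integral_cmult) measurable
      also have "\<dots> \<le> ennreal \<bar>D z\<bar> * ennreal G"
        using nn_integral_smear_le[OF L p, of z] unfolding G_def
        by (intro mult_left_mono) (cases "z \<in> E"; auto)+
      finally show "(\<integral>\<^sup>+w. ennreal (norm (D z * (f w * smear E w z))) \<partial>lborel) \<le> ennreal G * ennreal \<bar>D z\<bar>"
        by (simp add: mult.commute)
    qed
    also have "\<dots> = ennreal G * (\<integral>\<^sup>+z. ennreal \<bar>D z\<bar> \<partial>lborel)"
      by (rule nn_integral_cmult) measurable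
    also have "\<dots> < \<infinity>"
      using L1[OF t, of y] unfolding D_def by (auto simp: ennreal_mult_less_top intro: order_le_less_trans)
    finally have iF: "integrable (lborel \<Otimes>\<^sub>M lborel) (\<lambda>(w, z). D z * (f w * smear E w z))"
      by (intro integrableI_bounded) auto
    have fB: "(\<integral>z. D z * (f w * smear E w z) \<partial>lborel) = f w * B w" for w
      unfolding B_def by (subst integral_mult_right_zero[symmetric]) (simp add: mult_ac)
    have "(\<integral>z. D z * S z \<partial>lborel) = (\<integral>z. \<integral>w. D z * (f w * smear E w z) \<partial>lborel \<partial>lborel)"
      unfolding S_def by simp
    also have "\<dots> = (\<integral>w. \<integral>z. D z * (f w * smear E w z) \<partial>lborel \<partial>lborel)"
      by (rule lborel_pair.Fubini_integral[OF iF])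
    finally have DS: "(\<integral>z. D z * S z \<partial>lborel) = (\<integral>w. f w * B w \<partial>lborel)"
      unfolding fB .
    have ifB: "integrable lborel (\<lambda>w. f w * B w)"
      using lborel_pair.integrable_fst[OF iF] unfolding fB by simp
    have "(\<integral>z. D z * good_part f E z \<partial>lborel) = (\<integral>z. D z * (f z * indicator E z) + D z * S z \<partial>lborel)"
      unfolding good_part_def S_def by (simp add: distrib_left)
    also have "\<dots> = (\<integral>z. D z * (f z * indicator E z) \<partial>lborel) + (\<integral>w. f w * B w \<partial>lborel)"
      unfolding DS[symmetric] by (intro Bochner_Integration.integral_add iDfE iDS)
    finally have g: "(\<integral>z. D z * good_part f E z \<partial>lborel) = (\<integral>z. D z * (f z * indicator E z) \<partial>lborel) + (\<integral>w. f w * B w \<partial>lborel)" .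
    have "(\<integral>z. D z * f z \<partial>lborel) = (\<integral>z. D z * (f z * indicator E z) + D z * (f z * indicator (- E) z) \<partial>lborel)"
      by (intro Bochner_Integration.integral_cong) (auto simp: indicator_def)
    also have "\<dots> = (\<integral>z. D z * (f z * indicator E z) \<partial>lborel) + (\<integral>z. D z * (f z * indicator (- E) z) \<partial>lborel)"
      by (intro Bochner_Integration.integral_add iDfE)
    finally have "(\<integral>z. D z * f z \<partial>lborel) - (\<integral>z. D z * good_part f E z \<partial>lborel) = (\<integral>z. D z * (f z * indicator (- E) z) \<partial>lborel) - (\<integral>w. f w * B w \<partial>lborel)"
      unfolding g by simp
    also have "\<dots> = (\<integral>w. D w * (f w * indicator (- E) w) - f w * B w \<partial>lborel)"
      by (intro Bochner_Integration.integral_diff[symmetric] iDfE ifB)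
    finally have diff: "(\<integral>z. D z * f z \<partial>lborel) - (\<integral>z. D z * good_part f E z \<partial>lborel) = (\<integral>w. D w * (f w * indicator (- E) w) - f w * B w \<partial>lborel)" .
    have pt: "\<bar>D w * (f w * indicator (- E) w) - f w * B w\<bar> \<le> C * (\<bar>f w\<bar> * (infdist w E * rho t (y - w) powr (- (?N + 2))))" for w
    proof (cases "w \<in> E")
      case True
      then have "B w = 0" by (simp add: B_def smear_on_E)
      then show ?thesis using True by simp
    next
      case False
      let ?d = "infdist w E" and ?r = "rho t (y - w)"
      have dw: "0 < ?d"
        using False infdist_eq_0_iff_closed[OF level_setD(3,4)[OF L], of w] infdist_nonneg[of w E] by linarith
      \<comment> \<open>Here t \<ge> d(y) enters: d(w) \<le> t + |y - w| \<le> 2 \<open>rho\<close>,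
        so the spreading radius d(w)/4 is at most half of \<open>rho\<close>, as the difference
        bound for \<open>dker\<close> demands.\<close>
      have "?d \<le> infdist y E + dist w y"
        by (rule infdist_triangle)
      also have "\<dots> \<le> 2 * ?r"
        using d add_le_2_rho[of t "y - w"] by (simp add: dist_norm norm_minus_commute)
      finally have dr: "?d \<le> 2 * ?r" .
      have sm: "integrable lborel (\<lambda>z. smear E w z)"
        by (intro integrableI_bounded) (simp_all add: nn_integral_smear[OF dw])
      have sm1: "(\<integral>z. smear E w z \<partial>lborel) = 1"
        using nn_integral_smear[OF dw] by (subst integral_eq_nn_integral) auto
      have close: "\<bar>D w - D z\<bar> * smear E w z \<le> C * ?d * ?r powr (- (?N + 2)) * smear E w z" for z
      proof (cases "dist w z < ?d / 4")
        case True
        have e: "norm ((y - w) - (y - z)) = dist w z"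
          by (simp add: dist_norm norm_minus_commute)
        have "\<bar>D w - D z\<bar> \<le> C * dist w z * ?r powr (- (?N + 2))"
          unfolding D_def using lip[OF t, of "y - w" "y - z"] True dr unfolding e by simp
        also have "\<dots> \<le> C * ?d * ?r powr (- (?N + 2))"
          using True C dw by (intro mult_right_mono mult_left_mono) auto
        finally show ?thesis by (intro mult_right_mono) auto
      qed (simp add: smear_def)
      have iDs: "integrable lborel (\<lambda>z. (D w - D z) * smear E w z)"
      proof (rule Bochner_Integration.integrable_bound[OF integrable_mult_right[OF sm, of "C * ?d * ?r powr (- (?N + 2))"]])
        show "AE z in lborel. norm ((D w - D z) * smear E w z) \<le> norm (C * ?d * ?r powr (- (?N + 2)) * smear E w z)"
          using close C dw by (intro AE_I2) (simp add: abs_mult)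
      qed measurable
      \<comment> \<open>D(w) is written as its own mean against the probability density
        \<open>smear E w\<close>.\<close>
      have "D w - B w = (\<integral>z. D w * smear E w z \<partial>lborel) - (\<integral>z. D w * smear E w z - (D w - D z) * smear E w z \<partial>lborel)"
        unfolding B_def by (simp add: sm1 algebra_simps)
      also have "\<dots> = (\<integral>z. (D w - D z) * smear E w z \<partial>lborel)"
        using iDs sm by (subst Bochner_Integration.integral_diff) auto
      finally have "\<bar>D w - B w\<bar> \<le> (\<integral>z. \<bar>(D w - D z) * smear E w z\<bar> \<partial>lborel)"
        by (simp add: integral_abs_bound)
      also have "\<dots> \<le> (\<integral>z. C * ?d * ?r powr (- (?N + 2)) * smear E w z \<partial>lborel)"
        using close by (intro integral_mono integrable_abs iDs integrable_mult_right sm) (simp add: abs_mult)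
      also have "\<dots> = C * ?d * ?r powr (- (?N + 2))"
        by (simp add: sm1)
      finally have "\<bar>f w\<bar> * \<bar>D w - B w\<bar> \<le> \<bar>f w\<bar> * (C * ?d * ?r powr (- (?N + 2)))"
        by (intro mult_left_mono) auto
      moreover have "D w * (f w * indicator (- E) w) - f w * B w = f w * (D w - B w)"
        using False by (simp add: algebra_simps)
      ultimately show ?thesis
        by (simp add: abs_mult mult_ac)
    qed
    have "\<bar>Tp f t y - Tp (good_part f E) t y\<bar> = t * \<bar>\<integral>w. D w * (f w * indicator (- E) w) - f w * B w \<partial>lborel\<bar>"
      using t unfolding diff[symmetric] unfolding D_def Tp_def
      by (simp add: abs_mult flip: right_diff_distrib)
    then have "ennreal \<bar>Tp f t y - Tp (good_part f E) t y\<bar> = ennreal t * ennreal \<bar>\<integral>w. D w * (f w * indicator (- E) w) - f w * B w \<partial>lborel\<bar>"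
      using t by (simp add: ennreal_mult)
    also have "\<dots> \<le> ennreal t * (\<integral>\<^sup>+w. ennreal \<bar>D w * (f w * indicator (- E) w) - f w * B w\<bar> \<partial>lborel)"
      by (intro mult_left_mono abs_integral_le_nn_integral) auto
    also have "\<dots> \<le> ennreal t * (\<integral>\<^sup>+w. ennreal C * (ennreal \<bar>f w\<bar> * ennreal (infdist w E * rho t (y - w) powr (- (?N + 2)))) \<partial>lborel)"
    proof (intro mult_left_mono nn_integral_mono)
      fix w
      show "ennreal \<bar>D w * (f w * indicator (- E) w) - f w * B w\<bar> \<le> ennreal C * (ennreal \<bar>f w\<bar> * ennreal (infdist w E * rho t (y - w) powr (- (?N + 2))))"
        using pt[of w] C infdist_nonneg[of w E] by (simp add: ennreal_leI flip: ennreal_mult)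
    qed auto
    also have "\<dots> = ennreal (C * t) * (\<integral>\<^sup>+w. ennreal \<bar>f w\<bar> * ennreal (infdist w E * rho t (y - w) powr (- (?N + 2))) \<partial>lborel)"
      using C t by (subst nn_integral_cmult) (auto simp: mult_ac ennreal_mult)
    finally show "ennreal \<bar>Tp f t y - Tp (good_part f E) t y\<bar> \<le>
      ennreal (C * t) * (\<integral>\<^sup>+w. ennreal \<bar>f w\<bar> * ennreal (infdist w E * rho t (y - w) powr (- (?N + 2))) \<partial>lborel)" .
  qed
qed

text \<open>To be applied in the product of the time axis and the space, whose dimension is n + 1;
  the exponent -(n+2) then lies one below the critical one.\<close>

lemma nn_integral_norm_tail:
  fixes c :: "'b::euclidean_space"
  assumes a: "0 < a"
  shows "(\<integral>\<^sup>+u. ennreal (norm (c - u) powr (- (real DIM('b) + 1))) * (if a \<le> norm (c - u) then 1 else 0) \<partial>lborel)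
    = ennreal (real DIM('b) * unit_ball_vol (real DIM('b)) / a)"
proof -
  let ?M = "real DIM('b)" and ?w = "unit_ball_vol (real DIM('b))"
  let ?\<phi> = "\<lambda>r. ennreal (r powr (- (?M + 1))) * (if a \<le> r then 1 else 0)"
  have "(\<integral>\<^sup>+u. ?\<phi> (norm (c - u)) \<partial>lborel) = (\<integral>\<^sup>+u. ?\<phi> (norm (u::'b)) \<partial>lborel)"
    by (rule nn_integral_lborel_reflect[where f = "\<lambda>u. ?\<phi> (norm u)"]) measurable
  also have "\<dots> = (\<integral>\<^sup>+r. ennreal (?M * ?w * r powr (?M - 1)) * indicator {0<..} r * ?\<phi> r \<partial>lborel)"
    by (rule nn_integral_norm) measurable
  also have "\<dots> = (\<integral>\<^sup>+r. ennreal (?M * ?w) * (ennreal (r powr (- 1 - 1)) * indicator {a..} r) \<partial>lborel)"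
  proof (intro nn_integral_cong)
    fix r :: real
    have "r powr (?M - 1) * r powr (- (?M + 1)) = r powr (- 1 - 1)"
      unfolding powr_add[symmetric] by simp
    then have "?M * ?w * r powr (?M - 1) * r powr (- (?M + 1)) = ?M * ?w * r powr (- 1 - 1)"
      by (simp only: mult.assoc)
    then have "ennreal (?M * ?w * r powr (?M - 1)) * ennreal (r powr (- (?M + 1))) = ennreal (?M * ?w) * ennreal (r powr (- 1 - 1))"
      by (simp only: ennreal_mult''[symmetric] powr_ge_zero)
    then show "ennreal (?M * ?w * r powr (?M - 1)) * indicator {0<..} r * ?\<phi> r = ennreal (?M * ?w) * (ennreal (r powr (- 1 - 1)) * indicator {a..} r)"
      using a by (cases "a \<le> r") auto
  qed
  also have "\<dots> = ennreal (?M * ?w) * ennreal (a powr (- 1) / 1)"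
    using nn_integral_powr_atLeast[of a 1] a by (subst nn_integral_cmult) auto
  also have "\<dots> = ennreal (?M * ?w / a)"
    using a by (subst ennreal_mult[symmetric]) (auto simp: powr_minus_divide)
  finally show ?thesis .
qed

text \<open>For the bounded function \<open>good_part\<close> the L^q bound is available. The error
  Y is at most B, a multiple of \<alpha>, so Y^q \<le> B^(q-1) Y and only the L^1 norm of Y on the
  half-space is needed. In it the factor t of the error bound cancels the density 1/t, and what
  remains is a tail integral in n + 1 dimensions.\<close>

lemma far_part_bound:
  fixes p q :: real
  assumes p: "1 < p" "p < q" and q: "2 \<le> q"
  obtains K where "0 < K" "\<And>(f::'a::euclidean_space \<Rightarrow> real) \<alpha> E. level_set p f \<alpha> E \<Longrightarrow>
     (\<integral>\<^sup>+u. ennreal (\<bar>Tp f (fst u) (snd u)\<bar> powr q) * (if infdist (snd u) E \<le> fst u then 1 else 0) \<partial>half_space)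
       \<le> ennreal (K * \<alpha> powr (q - p)) * (\<integral>\<^sup>+z. ennreal (\<bar>f z\<bar> powr p) \<partial>lborel)"
proof -
  let ?N = "real DIM('a)"
  define k where "k = rho_const ?N"
  have k: "0 < k" unfolding k_def by (intro rho_const_pos) simp
  \<comment> \<open>The tail integral beyond radius d(w)/2 equals \<open>W\<close> / d(w), which is
    exactly compensated by the factor d(w) from the smoothness estimate.\<close>
  define W where "W = 2 * (real DIM(real \<times> 'a) * unit_ball_vol (real DIM(real \<times> 'a)))"
  have W: "0 \<le> W" by (simp add: W_def)
  define cg where "cg = 1 + (2 * 10 powr ?N) powr q * (5 ^ DIM('a) + 2)"
  have cg: "0 < cg" unfolding cg_def by (intro add_pos_nonneg mult_nonneg_nonneg) auto
  obtain A where A: "0 < A" "\<And>(g::'a::euclidean_space \<Rightarrow> real) G. g \<in> borel_measurable borel \<Longrightarrow> (\<And>z. \<bar>g z\<bar> \<le> G) \<Longrightarrow>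
     (\<integral>\<^sup>+z. ennreal (\<bar>g z\<bar> powr q) \<partial>lborel) < \<infinity> \<Longrightarrow>
     (\<integral>\<^sup>+w. ennreal (\<bar>Tp g (fst w) (snd w)\<bar> powr q) \<partial>half_space) \<le> ennreal A * (\<integral>\<^sup>+z. ennreal (\<bar>g z\<bar> powr q) \<partial>lborel)"
    by (rule Tp_Lq_bound[OF q]) blast
  obtain C where C: "0 < C" "\<And>(f::'a::euclidean_space \<Rightarrow> real) p \<alpha> E t y. level_set p f \<alpha> E \<Longrightarrow> 1 < p \<Longrightarrow> 0 < t \<Longrightarrow> infdist y E \<le> t \<Longrightarrow>
    ennreal \<bar>Tp f t y - Tp (good_part f E) t y\<bar> \<le>
      ennreal (C * t) * (\<integral>\<^sup>+w. ennreal \<bar>f w\<bar> * ennreal (infdist w E * rho t (y - w) powr (- (real DIM('a) + 2))) \<partial>lborel)"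
    by (rule Tp_diff_good_part_le) blast
  \<comment> \<open>Four sources: the pointwise bound to the power q - 1, the constant of the error
    estimate, the tail integral, and the L^1 norm of f off \<open>E\<close>.\<close>
  define cb where "cb = (4 * C * k) powr (q - 1) * C * W * (5 ^ DIM('a) + 3)"
  have cb: "0 \<le> cb" unfolding cb_def using C(1) W by simp
  let ?K = "2 powr q * (A * cg + cb)"
  show thesis
  proof (rule that[of ?K])
    show "0 < ?K" using A(1) cg cb by (intro mult_pos_pos add_pos_nonneg) auto
    fix f :: "'a \<Rightarrow> real" and \<alpha> :: real and E
    assume L: "level_set p f \<alpha> E"
    note [measurable] = level_setD(1)[OF L] good_part_measurable[OF L]
    have \<alpha>: "0 < \<alpha>" by (rule level_setD[OF L])
    have [measurable]: "E \<in> sets borel" using level_setD(3)[OF L] by simp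
    let ?X = "\<integral>\<^sup>+z. ennreal (\<bar>f z\<bar> powr p) \<partial>lborel"
    let ?g = "good_part f E"
    let ?if = "\<lambda>u::real \<times> 'a. (if infdist (snd u) E \<le> fst u then 1 else 0) :: ennreal"
    let ?Y = "\<lambda>u. \<bar>Tp f (fst u) (snd u) - Tp ?g (fst u) (snd u)\<bar>"
    let ?\<Psi> = "\<lambda>u. \<integral>\<^sup>+w. ennreal \<bar>f w\<bar> * ennreal (infdist w E * rho (fst u) (snd u - w) powr (- (?N + 2))) \<partial>lborel"
    have X: "?X < \<infinity>" by (rule level_setD(7)[OF L])
    have good: "(\<integral>\<^sup>+u. ennreal (\<bar>Tp ?g (fst u) (snd u)\<bar> powr q) \<partial>half_space) \<le> ennreal (A * cg * \<alpha> powr (q - p)) * ?X"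
    proof -
      have Lq: "(\<integral>\<^sup>+z. ennreal (\<bar>?g z\<bar> powr q) \<partial>lborel) \<le> ennreal (cg * \<alpha> powr (q - p)) * ?X"
        unfolding cg_def by (rule good_part_Lq[OF L p])
      also have "\<dots> < \<infinity>" using X by (simp add: ennreal_mult_less_top)
      finally have "(\<integral>\<^sup>+u. ennreal (\<bar>Tp ?g (fst u) (snd u)\<bar> powr q) \<partial>half_space) \<le> ennreal A * (\<integral>\<^sup>+z. ennreal (\<bar>?g z\<bar> powr q) \<partial>lborel)"
        by (intro A(2)[of _ "2 * 10 powr ?N * \<alpha>"] good_part_le[OF L p(1)]) auto
      also have "\<dots> \<le> ennreal A * (ennreal (cg * \<alpha> powr (q - p)) * ?X)"
        by (intro mult_left_mono Lq) auto
      also have "\<dots> = ennreal (A * cg * \<alpha> powr (q - p)) * ?X"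
        using A(1) cg by (intro ennreal_mult_mult) auto
      finally show ?thesis .
    qed
    \<comment> \<open>By \<open>abs_le_add_powr\<close> the mass of f off \<open>E\<close> is at
      most \<alpha> times the measure of that set, which gives 5^n + 2, plus one more term from the
      p-th power.\<close>
    have fE: "(\<integral>\<^sup>+w. ennreal \<bar>f w\<bar> * indicator (- E) w \<partial>lborel) \<le> ennreal ((5 ^ DIM('a) + 3) * \<alpha> powr (1 - p)) * ?X"
    proof -
      have "(\<integral>\<^sup>+w. ennreal \<bar>f w\<bar> * indicator (- E) w \<partial>lborel) \<le> (\<integral>\<^sup>+w. ennreal \<alpha> * indicator (- E) w + ennreal (\<alpha> powr (1 - p)) * ennreal (\<bar>f w\<bar> powr p) \<partial>lborel)"
        using abs_le_add_powr[OF \<alpha> p(1)] \<alpha>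
        by (intro nn_integral_mono) (auto simp: indicator_def simp flip: ennreal_mult ennreal_plus intro!: ennreal_leI)
      also have "\<dots> = ennreal \<alpha> * emeasure lborel (- E) + ennreal (\<alpha> powr (1 - p)) * ?X"
        by (simp add: nn_integral_add nn_integral_cmult)
      also have "\<dots> \<le> ennreal \<alpha> * (ennreal ((5 ^ DIM('a) + 2) * \<alpha> powr (- p)) * ?X) + ennreal (\<alpha> powr (1 - p)) * ?X"
        by (intro add_right_mono mult_left_mono level_setD(6)[OF L]) auto
      also have "ennreal \<alpha> * (ennreal ((5 ^ DIM('a) + 2) * \<alpha> powr (- p)) * ?X) = ennreal ((5 ^ DIM('a) + 2) * \<alpha> powr (1 - p)) * ?X"
      proof (rule ennreal_mult_mult)
        show "\<alpha> * ((5 ^ DIM('a) + 2) * \<alpha> powr (- p)) = (5 ^ DIM('a) + 2) * \<alpha> powr (1 - p)"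
          using \<alpha> by (simp add: powr_diff powr_minus_divide)
      qed (use \<alpha> in auto)
      also have "ennreal ((5 ^ DIM('a) + 2) * \<alpha> powr (1 - p)) * ?X + ennreal (\<alpha> powr (1 - p)) * ?X = ennreal ((5 ^ DIM('a) + 3) * \<alpha> powr (1 - p)) * ?X"
        unfolding distrib_right[symmetric] by (subst ennreal_plus[symmetric]) (auto simp: algebra_simps)
      finally show ?thesis .
    qed
    have near: "infdist w E \<le> 2 * rho (fst u) (snd u - w)" if "infdist (snd u) E \<le> fst u" for u w
      using that infdist_triangle[of w E "snd u"] add_le_2_rho[of "fst u" "snd u - w"] by (simp add: dist_norm norm_minus_commute)
    \<comment> \<open>Giving up d(w) \<le> 2 \<open>rho\<close> leaves the ordinary potential of f,
      bounded by a multiple of \<alpha>/t. This yields the pointwise bound; the sharper form with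
      d(w) is kept for the L^1 estimate.\<close>
    have \<Psi>1: "?\<Psi> u \<le> ennreal (4 * k * \<alpha> / fst u)" if u: "0 < fst u" "infdist (snd u) E \<le> fst u" for u
    proof -
      have "?\<Psi> u \<le> (\<integral>\<^sup>+w. ennreal 2 * (ennreal \<bar>f w\<bar> * ennreal (rho (fst u) (snd u - w) powr (- (?N + 1)))) \<partial>lborel)"
      proof (intro nn_integral_mono)
        fix w
        let ?r = "rho (fst u) (snd u - w)"
        have r: "0 < ?r" using u by (intro rho_pos)
        have "infdist w E * ?r powr (- (?N + 2)) \<le> 2 * ?r * ?r powr (- (?N + 2))"
          using near[OF u(2), of w] by (intro mult_right_mono) auto
        also have "\<dots> = 2 * (?r powr 1 * ?r powr (- (?N + 2)))"
          using r by simp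
        also have "?r powr 1 * ?r powr (- (?N + 2)) = ?r powr (- (?N + 1))"
          unfolding powr_add[symmetric] by (rule arg_cong[where f = "\<lambda>e. ?r powr e"]) simp
        finally have "\<bar>f w\<bar> * (infdist w E * ?r powr (- (?N + 2))) \<le> \<bar>f w\<bar> * (2 * ?r powr (- (?N + 1)))"
          by (intro mult_left_mono) auto
        then have "ennreal (\<bar>f w\<bar> * (infdist w E * ?r powr (- (?N + 2)))) \<le> ennreal (2 * (\<bar>f w\<bar> * ?r powr (- (?N + 1))))"
          by (intro ennreal_leI) simp
        then show "ennreal \<bar>f w\<bar> * ennreal (infdist w E * ?r powr (- (?N + 2))) \<le> ennreal 2 * (ennreal \<bar>f w\<bar> * ennreal (?r powr (- (?N + 1))))"
          by (simp only: ennreal_mult'' infdist_nonneg powr_ge_zero mult_nonneg_nonneg abs_ge_zero)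
      qed
      also have "\<dots> = ennreal 2 * (\<integral>\<^sup>+w. ennreal \<bar>f w\<bar> * ennreal (rho (fst u) (snd u - w) powr (- (?N + 1))) \<partial>lborel)"
        by (rule nn_integral_cmult) measurable
      also have "\<dots> \<le> ennreal 2 * ennreal (2 * k * \<alpha> / fst u)"
        unfolding k_def by (intro mult_left_mono potential_le_far[OF L p(1)] u) auto
      also have "\<dots> = ennreal (4 * k * \<alpha> / fst u)"
        using k \<alpha> u by (subst ennreal_mult[symmetric]) auto
      finally show ?thesis .
    qed
    define B where "B = 4 * C * k * \<alpha>"
    have B: "0 < B" using C(1) k \<alpha> by (simp add: B_def)
    have Yq: "ennreal (?Y u powr q) \<le> ennreal (B powr (q - 1) * C) * (ennreal (fst u) * ?\<Psi> u)" if u: "0 < fst u" "infdist (snd u) E \<le> fst u" for u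
    proof -
      have Y1: "ennreal (?Y u) \<le> ennreal (C * fst u) * ?\<Psi> u"
        by (rule C(2)[OF L p(1) u])
      also have "\<dots> \<le> ennreal (C * fst u) * ennreal (4 * k * \<alpha> / fst u)"
        by (intro mult_left_mono \<Psi>1 u) auto
      also have "\<dots> = ennreal B"
        using C(1) k \<alpha> u by (subst ennreal_mult[symmetric]) (auto simp: B_def)
      finally have "?Y u \<le> B"
        using B by (subst (asm) ennreal_le_iff) auto
      then have "?Y u powr (q - 1) \<le> B powr (q - 1)"
        using q by (intro powr_mono2) auto
      then have "?Y u powr (q - 1) * ?Y u \<le> B powr (q - 1) * ?Y u"
        by (intro mult_right_mono) auto
      moreover have "?Y u powr (q - 1) * ?Y u = ?Y u powr q"
        using q by (cases "?Y u = 0") (auto simp: powr_diff)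
      ultimately have "ennreal (?Y u powr q) \<le> ennreal (B powr (q - 1)) * ennreal (?Y u)"
        by (simp add: ennreal_leI flip: ennreal_mult)
      also have "\<dots> \<le> ennreal (B powr (q - 1)) * (ennreal (C * fst u) * ?\<Psi> u)"
        by (intro mult_left_mono Y1) auto
      also have "\<dots> = ennreal (B powr (q - 1) * C) * (ennreal (fst u) * ?\<Psi> u)"
        using C(1) u by (simp add: ennreal_mult mult_ac)
      finally show ?thesis .
    qed
    have bad: "(\<integral>\<^sup>+u. ennreal (?Y u powr q) * ?if u \<partial>half_space) \<le> ennreal (cb * \<alpha> powr (q - p)) * ?X"
    proof -
      \<comment> \<open>For t > 0 the quantity \<open>rho\<close> is the distance in n + 1
        dimensions from (t, y) to the boundary point (0, w). By \<open>near\<close> this distance is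
        at least d(w)/2, so the domain can be enlarged to the exterior of a ball around (0,
        w).\<close>
      let ?nn = "\<lambda>w (u::real \<times> 'a). norm ((0, w) - u)"
      let ?tail = "\<lambda>w u. ennreal (?nn w u powr (- (real DIM(real \<times> 'a) + 1))) * (if infdist w E / 2 \<le> ?nn w u then 1 else 0)"
      have "(\<integral>\<^sup>+u. ennreal (?Y u powr q) * ?if u \<partial>half_space) = (\<integral>\<^sup>+u. ennreal (1 / fst u) * indicator {0<..} (fst u) * (ennreal (?Y u powr q) * ?if u) \<partial>lborel)"
        unfolding half_space_def lborel_prod by (rule nn_integral_density) (simp_all add: lborel_prod[symmetric])
      also have "\<dots> \<le> (\<integral>\<^sup>+u. ennreal (B powr (q - 1) * C) * (\<integral>\<^sup>+w. ennreal \<bar>f w\<bar> * ennreal (infdist w E) * ?tail w u \<partial>lborel) \<partial>lborel)"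
      proof (intro nn_integral_mono)
        fix u :: "real \<times> 'a"
        show "ennreal (1 / fst u) * indicator {0<..} (fst u) * (ennreal (?Y u powr q) * ?if u) \<le> ennreal (B powr (q - 1) * C) * (\<integral>\<^sup>+w. ennreal \<bar>f w\<bar> * ennreal (infdist w E) * ?tail w u \<partial>lborel)"
        proof (cases "0 < fst u \<and> infdist (snd u) E \<le> fst u")
          case True
          then have u: "0 < fst u" "infdist (snd u) E \<le> fst u" by auto
          have "ennreal (1 / fst u) * ennreal (?Y u powr q) \<le> ennreal (1 / fst u) * (ennreal (B powr (q - 1) * C) * (ennreal (fst u) * ?\<Psi> u))"
            by (intro mult_left_mono Yq u) auto
          also have "\<dots> = ennreal (B powr (q - 1) * C) * ((ennreal (1 / fst u) * ennreal (fst u)) * ?\<Psi> u)"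
            by (simp only: mult_ac)
          also have "ennreal (1 / fst u) * ennreal (fst u) = 1"
            using u by (subst ennreal_mult[symmetric]) auto
          also have "1 * ?\<Psi> u = (\<integral>\<^sup>+w. ennreal \<bar>f w\<bar> * ennreal (infdist w E) * ?tail w u \<partial>lborel)"
            unfolding mult_1
          proof (intro nn_integral_cong)
            fix w
            have r: "?nn w u = rho (fst u) (snd u - w)"
              by (cases u) (simp add: rho_eq_norm norm_Pair norm_minus_commute)
            have "infdist w E / 2 \<le> ?nn w u"
              unfolding r using near[OF u(2), of w] by simp
            then show "ennreal \<bar>f w\<bar> * ennreal (infdist w E * rho (fst u) (snd u - w) powr (- (?N + 2))) = ennreal \<bar>f w\<bar> * ennreal (infdist w E) * ?tail w u"
              unfolding r by (simp add: ennreal_mult infdist_nonneg mult.assoc add_ac)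
          qed
          finally show ?thesis using u by simp
        qed auto
      qed
      also have "\<dots> = ennreal (B powr (q - 1) * C) * (\<integral>\<^sup>+u. \<integral>\<^sup>+w. ennreal \<bar>f w\<bar> * ennreal (infdist w E) * ?tail w u \<partial>lborel \<partial>lborel)"
        by (rule nn_integral_cmult) measurable
      also have "(\<integral>\<^sup>+u. \<integral>\<^sup>+w. ennreal \<bar>f w\<bar> * ennreal (infdist w E) * ?tail w u \<partial>lborel \<partial>lborel) = (\<integral>\<^sup>+w. \<integral>\<^sup>+u. ennreal \<bar>f w\<bar> * ennreal (infdist w E) * ?tail w u \<partial>lborel \<partial>lborel)"
        by (rule lborel_pair.Fubini') measurable
      also have "\<dots> \<le> (\<integral>\<^sup>+w. ennreal W * (ennreal \<bar>f w\<bar> * indicator (- E) w) \<partial>lborel)"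
      proof (intro nn_integral_mono)
        fix w
        show "(\<integral>\<^sup>+u. ennreal \<bar>f w\<bar> * ennreal (infdist w E) * ?tail w u \<partial>lborel) \<le> ennreal W * (ennreal \<bar>f w\<bar> * indicator (- E) w)"
        proof (cases "w \<in> E")
          case False
          have d: "0 < infdist w E"
            using False infdist_eq_0_iff_closed[OF level_setD(3,4)[OF L], of w] infdist_nonneg[of w E] by linarith
          have "(\<integral>\<^sup>+u. ennreal \<bar>f w\<bar> * ennreal (infdist w E) * ?tail w u \<partial>lborel) = ennreal \<bar>f w\<bar> * ennreal (infdist w E) * (\<integral>\<^sup>+u. ?tail w u \<partial>lborel)"
            by (rule nn_integral_cmult) measurable
          also have "(\<integral>\<^sup>+u. ?tail w u \<partial>lborel) = ennreal (real DIM(real \<times> 'a) * unit_ball_vol (real DIM(real \<times> 'a)) / (infdist w E / 2))"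
            using d by (intro nn_integral_norm_tail) simp
          also have "ennreal \<bar>f w\<bar> * ennreal (infdist w E) * \<dots> = ennreal \<bar>f w\<bar> * ennreal (infdist w E * (real DIM(real \<times> 'a) * unit_ball_vol (real DIM(real \<times> 'a)) / (infdist w E / 2)))"
            unfolding mult.assoc using d by (subst ennreal_mult[symmetric]) auto
          also have "infdist w E * (real DIM(real \<times> 'a) * unit_ball_vol (real DIM(real \<times> 'a)) / (infdist w E / 2)) = W"
            using d by (simp add: W_def)
          finally show ?thesis using False by (simp add: mult.commute)
        qed simp
      qed
      also have "\<dots> = ennreal W * (\<integral>\<^sup>+w. ennreal \<bar>f w\<bar> * indicator (- E) w \<partial>lborel)"
        by (rule nn_integral_cmult) measurable
      finally have "(\<integral>\<^sup>+u. ennreal (?Y u powr q) * ?if u \<partial>half_space) \<le> ennreal (B powr (q - 1) * C) * (ennreal W * (\<integral>\<^sup>+w. ennreal \<bar>f w\<bar> * indicator (- E) w \<partial>lborel))"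
        by (simp add: mult_left_mono)
      also have "\<dots> \<le> ennreal (B powr (q - 1) * C) * (ennreal W * (ennreal ((5 ^ DIM('a) + 3) * \<alpha> powr (1 - p)) * ?X))"
        by (intro mult_left_mono fE) auto
      also have "ennreal W * (ennreal ((5 ^ DIM('a) + 3) * \<alpha> powr (1 - p)) * ?X) = ennreal (W * ((5 ^ DIM('a) + 3) * \<alpha> powr (1 - p))) * ?X"
        using W by (intro ennreal_mult_mult) auto
      also have "ennreal (B powr (q - 1) * C) * (ennreal (W * ((5 ^ DIM('a) + 3) * \<alpha> powr (1 - p))) * ?X) = ennreal (cb * \<alpha> powr (q - p)) * ?X"
      proof (rule ennreal_mult_mult)
        have "B powr (q - 1) = (4 * C * k) powr (q - 1) * \<alpha> powr (q - 1)"
          unfolding B_def by (rule powr_mult)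
        then have "B powr (q - 1) * C * (W * ((5 ^ DIM('a) + 3) * \<alpha> powr (1 - p))) = cb * (\<alpha> powr (q - 1) * \<alpha> powr (1 - p))"
          unfolding cb_def by (simp only: mult_ac)
        also have "\<alpha> powr (q - 1) * \<alpha> powr (1 - p) = \<alpha> powr (q - p)"
          unfolding powr_add[symmetric] by simp
        finally show "B powr (q - 1) * C * (W * ((5 ^ DIM('a) + 3) * \<alpha> powr (1 - p))) = cb * \<alpha> powr (q - p)" .
      qed (use C(1) W in auto)
      finally show ?thesis .
    qed
    have "(\<integral>\<^sup>+u. ennreal (\<bar>Tp f (fst u) (snd u)\<bar> powr q) * ?if u \<partial>half_space)
      \<le> (\<integral>\<^sup>+u. ennreal (2 powr q) * (ennreal (\<bar>Tp ?g (fst u) (snd u)\<bar> powr q) + ennreal (?Y u powr q) * ?if u) \<partial>half_space)"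
    proof (intro nn_integral_mono)
      fix u :: "real \<times> 'a"
      have "enn_powr (ennreal \<bar>Tp f (fst u) (snd u)\<bar>) q \<le> enn_powr (ennreal \<bar>Tp ?g (fst u) (snd u)\<bar> + ennreal (?Y u)) q"
        using q by (intro enn_powr_mono) (auto simp flip: ennreal_plus intro!: ennreal_leI)
      also have "\<dots> \<le> ennreal (2 powr q) * (enn_powr (ennreal \<bar>Tp ?g (fst u) (snd u)\<bar>) q + enn_powr (ennreal (?Y u)) q)"
        using q by (intro enn_powr_add_le) auto
      finally have "ennreal (\<bar>Tp f (fst u) (snd u)\<bar> powr q) \<le> ennreal (2 powr q) * (ennreal (\<bar>Tp ?g (fst u) (snd u)\<bar> powr q) + ennreal (?Y u powr q))"
        by (simp only: enn_powr_ennreal abs_ge_zero)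
      then show "ennreal (\<bar>Tp f (fst u) (snd u)\<bar> powr q) * ?if u \<le> ennreal (2 powr q) * (ennreal (\<bar>Tp ?g (fst u) (snd u)\<bar> powr q) + ennreal (?Y u powr q) * ?if u)"
        by (cases "infdist (snd u) E \<le> fst u") auto
    qed
    also have "\<dots> = ennreal (2 powr q) * ((\<integral>\<^sup>+u. ennreal (\<bar>Tp ?g (fst u) (snd u)\<bar> powr q) \<partial>half_space) + (\<integral>\<^sup>+u. ennreal (?Y u powr q) * ?if u \<partial>half_space))"
      by (subst nn_integral_cmult, measurable, subst nn_integral_add, measurable)
    also have "\<dots> \<le> ennreal (2 powr q) * (ennreal (A * cg * \<alpha> powr (q - p)) * ?X + ennreal (cb * \<alpha> powr (q - p)) * ?X)"
      by (intro mult_left_mono add_mono good bad) auto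
    also have "ennreal (A * cg * \<alpha> powr (q - p)) * ?X + ennreal (cb * \<alpha> powr (q - p)) * ?X = ennreal ((A * cg + cb) * \<alpha> powr (q - p)) * ?X"
      unfolding distrib_right[symmetric] using A(1) cg cb by (subst ennreal_plus[symmetric]) (auto simp: algebra_simps)
    also have "ennreal (2 powr q) * (ennreal ((A * cg + cb) * \<alpha> powr (q - p)) * ?X) = ennreal (?K * \<alpha> powr (q - p)) * ?X"
      using A(1) cg cb by (intro ennreal_mult_mult) auto
    finally show "(\<integral>\<^sup>+u. ennreal (\<bar>Tp f (fst u) (snd u)\<bar> powr q) * ?if u \<partial>half_space) \<le> ennreal (?K * \<alpha> powr (q - p)) * ?X" .
  qed
qed

section \<open>The weak type estimate\<close>

text \<open>After Tonelli the integral over x in \<open>E\<close> becomes, for fixed y, an integral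
  over radii r \<ge> d(y). The inner integral is split at t = d(y): the part below does not depend
  on r, so only the integral of r^(-1-sq) beyond d(y) remains; the part above is handled by Hardy's
  inequality.\<close>

lemma nn_integral_R_op_bound:
  fixes p q s :: real
  assumes p: "1 < p" "p < q" and q: "2 \<le> q" and s: "s = real DIM('a::euclidean_space) * (1 / p - 1 / q)" "0 < s"
  obtains K where "0 < K" "\<And>(f::'a \<Rightarrow> real) \<alpha> E. level_set p f \<alpha> E \<Longrightarrow>
     (\<integral>\<^sup>+x. (\<integral>\<^sup>+y. ennreal (1 / norm (x - y) powr (real DIM('a) + s * q)) *
        enn_powr (\<integral>\<^sup>+t. ennreal (\<bar>Tp f t y / t\<bar> * t powr s) * (if 0 < t \<and> t < 2 * norm (x - y) then 1 else 0) \<partial>lborel) q \<partial>lborel) * indicator E x \<partial>lborel)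
       \<le> ennreal (K * \<alpha> powr (q - p)) * (\<integral>\<^sup>+z. ennreal (\<bar>f z\<bar> powr p) \<partial>lborel)"
proof -
  let ?N = "real DIM('a)" and ?w = "unit_ball_vol (real DIM('a))"
  have q1: "1 < q" "0 < q" using p by auto
  obtain K1 where K1: "0 < K1" "\<And>(f::'a \<Rightarrow> real) \<alpha> E. level_set p f \<alpha> E \<Longrightarrow>
     (\<integral>\<^sup>+y. ennreal (infdist y E powr (- (s * q))) *
        enn_powr (\<integral>\<^sup>+t. ennreal (\<bar>Tp f t y\<bar> / t * t powr s) * indicator {0<..<infdist y E} t \<partial>lborel) q \<partial>lborel)
       \<le> ennreal (K1 * \<alpha> powr (q - p)) * (\<integral>\<^sup>+z. ennreal (\<bar>f z\<bar> powr p) \<partial>lborel)"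
    by (rule near_part_bound[OF p s]) blast
  obtain K2 where K2: "0 < K2" "\<And>(f::'a::euclidean_space \<Rightarrow> real) \<alpha> E. level_set p f \<alpha> E \<Longrightarrow>
     (\<integral>\<^sup>+u. ennreal (\<bar>Tp f (fst u) (snd u)\<bar> powr q) * (if infdist (snd u) E \<le> fst u then 1 else 0) \<partial>half_space)
       \<le> ennreal (K2 * \<alpha> powr (q - p)) * (\<integral>\<^sup>+z. ennreal (\<bar>f z\<bar> powr p) \<partial>lborel)"
    by (rule far_part_bound[OF p q]) blast
  define CH where "CH = (2 / s * 2 powr (s / 2)) powr (q - 1) * (2 powr (s * (q + 1) / 2) / (s * (q + 1) / 2))"
  have CH: "0 \<le> CH" using s(2) q by (simp add: CH_def)
  \<comment> \<open>The area factor of polar coordinates, times the factor 2^q lost when the q-th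
    power of a sum is split.\<close>
  define c where "c = ?N * ?w * 2 powr q"
  have c: "0 < c" by (simp add: c_def)
  let ?K = "c * (K1 / (s * q) + CH * K2)"
  show thesis
  proof (rule that[of ?K])
    show "0 < ?K" using c K1(1) K2(1) CH s(2) q1 by (intro mult_pos_pos add_pos_nonneg) auto
    fix f :: "'a \<Rightarrow> real" and \<alpha> :: real and E
    assume L: "level_set p f \<alpha> E"
    note [measurable] = level_setD(1)[OF L]
    have [measurable]: "E \<in> sets borel" using level_setD(3)[OF L] by simp
    let ?X = "\<integral>\<^sup>+z. ennreal (\<bar>f z\<bar> powr p) \<partial>lborel"
    define A where "A = (\<lambda>y r. \<integral>\<^sup>+t. ennreal (\<bar>Tp f t y / t\<bar> * t powr s) * (if 0 < t \<and> t < 2 * r then 1 else 0) \<partial>lborel)"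
    have A_meas' [measurable]: "A y \<in> borel_measurable borel" for y
      unfolding A_def by measurable
    let ?A0 = "\<lambda>y. \<integral>\<^sup>+t. ennreal (\<bar>Tp f t y\<bar> / t * t powr s) * indicator {0<..<infdist y E} t \<partial>lborel"
    let ?A1 = "\<lambda>y r. \<integral>\<^sup>+t. ennreal (\<bar>Tp f t y / t\<bar> * t powr s) * indicator {0<..<2 * r} t * indicator {infdist y E..} t \<partial>lborel"
    let ?F = "\<lambda>y. \<integral>\<^sup>+t. ennreal (1 / t) * indicator {0<..} t * (ennreal (\<bar>Tp f t y\<bar> powr q) * (if infdist y E \<le> t then 1 else 0)) \<partial>lborel"
    have [measurable]: "(\<lambda>y. ?A0 y) \<in> borel_measurable borel"
    proof -
      have "?A0 y = (\<integral>\<^sup>+t. ennreal (\<bar>Tp f t y\<bar> / t * t powr s) * (if 0 < t \<and> t < infdist y E then 1 else 0) \<partial>lborel)" for y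
        by (intro nn_integral_cong) (auto simp: indicator_def)
      then show ?thesis by simp
    qed
    have A_le: "A y r \<le> ?A0 y + ?A1 y r" for y r
    proof -
      have "A y r \<le> (\<integral>\<^sup>+t. ennreal (\<bar>Tp f t y\<bar> / t * t powr s) * indicator {0<..<infdist y E} t +
          ennreal (\<bar>Tp f t y / t\<bar> * t powr s) * indicator {0<..<2 * r} t * indicator {infdist y E..} t \<partial>lborel)"
        unfolding A_def by (intro nn_integral_mono) (auto simp: indicator_def)
      also have "\<dots> = ?A0 y + ?A1 y r"
        by (rule nn_integral_add) measurable
      finally show ?thesis .
    qed
    have section_bound: "(\<integral>\<^sup>+x. ennreal (1 / norm (x - y) powr (?N + s * q)) * enn_powr (A y (norm (x - y))) q * indicator E x \<partial>lborel)
      \<le> ennreal c * (ennreal (1 / (s * q)) * (ennreal (infdist y E powr (- (s * q))) * enn_powr (?A0 y) q) + ennreal CH * ?F y)" for y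
    proof -
      let ?d = "infdist y E"
      \<comment> \<open>Relaxing the condition that x is in \<open>E\<close> to |x - y| \<ge> d(y)
        makes the integrand radial around y.\<close>
      let ?\<phi> = "\<lambda>r. ennreal (1 / r powr (?N + s * q)) * enn_powr (A y r) q * indicator {?d..} r"
      have "(\<integral>\<^sup>+x. ennreal (1 / norm (x - y) powr (?N + s * q)) * enn_powr (A y (norm (x - y))) q * indicator E x \<partial>lborel)
        \<le> (\<integral>\<^sup>+x. ?\<phi> (norm (y - x)) \<partial>lborel)"
        using infdist_le[of _ E y] by (intro nn_integral_mono) (auto simp: indicator_def norm_minus_commute dist_norm)
      also have "\<dots> = (\<integral>\<^sup>+x. ?\<phi> (norm (x::'a)) \<partial>lborel)"
        by (rule nn_integral_lborel_reflect[where f = "\<lambda>x. ?\<phi> (norm x)"]) measurable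
      also have "\<dots> = (\<integral>\<^sup>+r. ennreal (?N * ?w * r powr (?N - 1)) * indicator {0<..} r * ?\<phi> r \<partial>lborel)"
        by (rule nn_integral_norm) measurable
      also have "\<dots> \<le> (\<integral>\<^sup>+r. ennreal c * (ennreal (r powr (- (s * q) - 1)) * indicator {0<..} r * indicator {?d..} r * enn_powr (?A0 y) q +
          ennreal (r powr (- 1 - s * q)) * indicator {0<..} r * enn_powr (?A1 y r) q) \<partial>lborel)"
      proof (intro nn_integral_mono)
        fix r :: real
        show "ennreal (?N * ?w * r powr (?N - 1)) * indicator {0<..} r * ?\<phi> r \<le> ennreal c * (ennreal (r powr (- (s * q) - 1)) * indicator {0<..} r * indicator {?d..} r * enn_powr (?A0 y) q +
          ennreal (r powr (- 1 - s * q)) * indicator {0<..} r * enn_powr (?A1 y r) q)"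
        proof (cases "0 < r \<and> ?d \<le> r")
          case True
          have "enn_powr (A y r) q \<le> enn_powr (?A0 y + ?A1 y r) q"
            using q1 by (intro enn_powr_mono A_le) auto
          also have "\<dots> \<le> ennreal (2 powr q) * (enn_powr (?A0 y) q + enn_powr (?A1 y r) q)"
            using q1 by (intro enn_powr_add_le) auto
          finally have "ennreal (?N * ?w * r powr (?N - 1)) * (ennreal (1 / r powr (?N + s * q)) * enn_powr (A y r) q)
            \<le> ennreal (?N * ?w * r powr (?N - 1)) * (ennreal (1 / r powr (?N + s * q)) * (ennreal (2 powr q) * (enn_powr (?A0 y) q + enn_powr (?A1 y r) q)))"
            by (intro mult_left_mono) auto
          also have "\<dots> = ennreal (?N * ?w * r powr (?N - 1)) * (ennreal (1 / r powr (?N + s * q) * 2 powr q) * (enn_powr (?A0 y) q + enn_powr (?A1 y r) q))"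
            by (subst ennreal_mult_mult) auto
          also have "\<dots> = ennreal (c * r powr (- (s * q) - 1)) * (enn_powr (?A0 y) q + enn_powr (?A1 y r) q)"
          proof (rule ennreal_mult_mult)
            have e1: "1 / r powr (?N + s * q) = r powr (- (?N + s * q))"
              by (rule powr_minus_divide[symmetric])
            have e2: "r powr (?N - 1) * r powr (- (?N + s * q)) = r powr (- (s * q) - 1)"
              unfolding powr_add[symmetric] by (rule arg_cong[where f = "\<lambda>e. r powr e"]) simp
            have "?N * ?w * r powr (?N - 1) * (1 / r powr (?N + s * q) * 2 powr q) = c * (r powr (?N - 1) * r powr (- (?N + s * q)))"
              unfolding c_def e1 by (simp only: mult_ac)
            then show "?N * ?w * r powr (?N - 1) * (1 / r powr (?N + s * q) * 2 powr q) = c * r powr (- (s * q) - 1)"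
              unfolding e2 .
          qed auto
          also have "\<dots> = ennreal c * (ennreal (r powr (- (s * q) - 1)) * (enn_powr (?A0 y) q + enn_powr (?A1 y r) q))"
            using c by (intro ennreal_mult_mult[symmetric]) auto
          finally have *: "ennreal (?N * ?w * r powr (?N - 1)) * (ennreal (1 / r powr (?N + s * q)) * enn_powr (A y r) q)
            \<le> ennreal c * (ennreal (r powr (- (s * q) - 1)) * (enn_powr (?A0 y) q + enn_powr (?A1 y r) q))" .
          have ex: "- 1 - s * q = - (s * q) - 1" by simp
          show ?thesis
            using * True unfolding ex by (simp only: distrib_left indicator_simps mult_1_right mult_1 greaterThan_iff atLeast_iff)
        qed auto
      qed
      also have "\<dots> = ennreal c * ((\<integral>\<^sup>+r. ennreal (r powr (- (s * q) - 1)) * indicator {0<..} r * indicator {?d..} r \<partial>lborel) * enn_powr (?A0 y) q +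
          (\<integral>\<^sup>+r. ennreal (r powr (- 1 - s * q)) * indicator {0<..} r * enn_powr (?A1 y r) q \<partial>lborel))"
      proof -
        have A1: "?A1 y r = (\<integral>\<^sup>+t. ennreal (\<bar>Tp f t y / t\<bar> * t powr s) * (if 0 < t \<and> t < 2 * r \<and> ?d \<le> t then 1 else 0) \<partial>lborel)" for r
          by (intro nn_integral_cong) (auto simp: indicator_def)
        have gen: "(\<integral>\<^sup>+r. ennreal c * (u r * a + v r) \<partial>lborel) = ennreal c * ((\<integral>\<^sup>+r. u r \<partial>lborel) * a + (\<integral>\<^sup>+r. v r \<partial>lborel))"
          if [measurable]: "u \<in> borel_measurable borel" "v \<in> borel_measurable borel" for u v :: "real \<Rightarrow> ennreal" and a
          by (simp add: nn_integral_cmult nn_integral_add nn_integral_multc)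
        show ?thesis
        proof (rule gen)
          show "(\<lambda>r. ennreal (r powr (- 1 - s * q)) * indicator {0<..} r * enn_powr (?A1 y r) q) \<in> borel_measurable borel"
            unfolding A1 by measurable
        qed measurable
      qed
      also have "\<dots> \<le> ennreal c * (ennreal (1 / (s * q)) * (ennreal (?d powr (- (s * q))) * enn_powr (?A0 y) q) + ennreal CH * ?F y)"
      proof (intro mult_left_mono add_mono)
        show "(\<integral>\<^sup>+r. ennreal (r powr (- (s * q) - 1)) * indicator {0<..} r * indicator {?d..} r \<partial>lborel) * enn_powr (?A0 y) q
          \<le> ennreal (1 / (s * q)) * (ennreal (?d powr (- (s * q))) * enn_powr (?A0 y) q)"
        \<comment> \<open>For y in \<open>E\<close> the integral in r diverges, but
          \<open>?A0 y\<close> runs over an empty interval and the product is 0.\<close>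
        proof (cases "?d = 0")
          case True
          then show ?thesis by simp
        next
          case False
          then have d: "0 < ?d" using infdist_nonneg[of y E] by linarith
          have "(\<integral>\<^sup>+r. ennreal (r powr (- (s * q) - 1)) * indicator {0<..} r * indicator {?d..} r \<partial>lborel)
            \<le> (\<integral>\<^sup>+r. ennreal (r powr (- (s * q) - 1)) * indicator {?d..} r \<partial>lborel)"
            by (intro nn_integral_mono) (auto simp: indicator_def)
          also have "\<dots> = ennreal (?d powr (- (s * q)) / (s * q))"
            using d s(2) q1 by (intro nn_integral_powr_atLeast) auto
          also have "\<dots> = ennreal (1 / (s * q)) * ennreal (?d powr (- (s * q)))"
            using s(2) q1 by (subst ennreal_mult[symmetric]) auto
          finally have "(\<integral>\<^sup>+r. ennreal (r powr (- (s * q) - 1)) * indicator {0<..} r * indicator {?d..} r \<partial>lborel) * enn_powr (?A0 y) q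
            \<le> (ennreal (1 / (s * q)) * ennreal (?d powr (- (s * q)))) * enn_powr (?A0 y) q"
            by (intro mult_right_mono) auto
          then show ?thesis by (simp only: mult.assoc)
        qed
        have "(\<integral>\<^sup>+r. ennreal (r powr (- 1 - s * q)) * indicator {0<..} r * enn_powr (?A1 y r) q \<partial>lborel)
          \<le> ennreal CH * (\<integral>\<^sup>+t. ennreal (t powr (q - 1) * \<bar>Tp f t y / t\<bar> powr q) * indicator {0<..} t * indicator {?d..} t \<partial>lborel)"
          unfolding CH_def by (rule nn_integral_Hardy_tail[OF s(2) q1(1)]) auto
        \<comment> \<open>With v = |\<open>Tp\<close>| / t the weight t^(q-1) of Hardy's inequality
          turns into 1/t, the density of \<open>half_space\<close>.\<close>
        also have "(\<integral>\<^sup>+t. ennreal (t powr (q - 1) * \<bar>Tp f t y / t\<bar> powr q) * indicator {0<..} t * indicator {?d..} t \<partial>lborel) = ?F y"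
        proof (intro nn_integral_cong)
          fix t :: real
          have "t powr (q - 1) * \<bar>Tp f t y / t\<bar> powr q = 1 / t * \<bar>Tp f t y\<bar> powr q" if "0 < t"
            using that by (simp add: powr_diff powr_divide abs_divide)
          then show "ennreal (t powr (q - 1) * \<bar>Tp f t y / t\<bar> powr q) * indicator {0<..} t * indicator {?d..} t =
             ennreal (1 / t) * indicator {0<..} t * (ennreal (\<bar>Tp f t y\<bar> powr q) * (if ?d \<le> t then 1 else 0))"
            by (auto simp: indicator_def simp flip: ennreal_mult)
        qed
        finally show "(\<integral>\<^sup>+r. ennreal (r powr (- 1 - s * q)) * indicator {0<..} r * enn_powr (?A1 y r) q \<partial>lborel) \<le> ennreal CH * ?F y" .
      qed auto
      finally show ?thesis .
    qed
    have "(\<integral>\<^sup>+x. (\<integral>\<^sup>+y. ennreal (1 / norm (x - y) powr (?N + s * q)) * enn_powr (A y (norm (x - y))) q \<partial>lborel) * indicator E x \<partial>lborel)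
      = (\<integral>\<^sup>+x. \<integral>\<^sup>+y. ennreal (1 / norm (x - y) powr (?N + s * q)) * enn_powr (A y (norm (x - y))) q * indicator E x \<partial>lborel \<partial>lborel)"
      unfolding A_def by (intro nn_integral_cong nn_integral_multc[symmetric]) measurable
    also have "\<dots> = (\<integral>\<^sup>+y. \<integral>\<^sup>+x. ennreal (1 / norm (x - y) powr (?N + s * q)) * enn_powr (A y (norm (x - y))) q * indicator E x \<partial>lborel \<partial>lborel)"
      unfolding A_def by (rule lborel_pair.Fubini'[symmetric]) measurable
    also have "\<dots> \<le> (\<integral>\<^sup>+y. ennreal c * (ennreal (1 / (s * q)) * (ennreal (infdist y E powr (- (s * q))) * enn_powr (?A0 y) q) + ennreal CH * ?F y) \<partial>lborel)"
      by (intro nn_integral_mono section_bound)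
    also have "\<dots> = ennreal c * (ennreal (1 / (s * q)) * (\<integral>\<^sup>+y. ennreal (infdist y E powr (- (s * q))) * enn_powr (?A0 y) q \<partial>lborel) + ennreal CH * (\<integral>\<^sup>+y. ?F y \<partial>lborel))"
    proof -
      have gen: "(\<integral>\<^sup>+y. ennreal c * (a * u y + b * v y) \<partial>lborel) = ennreal c * (a * (\<integral>\<^sup>+y. u y \<partial>lborel) + b * (\<integral>\<^sup>+y. v y \<partial>lborel))"
        if [measurable]: "u \<in> borel_measurable borel" "v \<in> borel_measurable borel" for u v :: "'a \<Rightarrow> ennreal" and a b
        by (simp add: nn_integral_cmult nn_integral_add)
      show ?thesis
        by (rule gen) measurable
    qed
    also have "(\<integral>\<^sup>+y. ?F y \<partial>lborel) = (\<integral>\<^sup>+t. \<integral>\<^sup>+y. ennreal (1 / t) * indicator {0<..} t * (ennreal (\<bar>Tp f t y\<bar> powr q) * (if infdist y E \<le> t then 1 else 0)) \<partial>lborel \<partial>lborel)"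
      by (rule lborel_pair.Fubini'[symmetric]) measurable
    also have "\<dots> = (\<integral>\<^sup>+u. ennreal (\<bar>Tp f (fst u) (snd u)\<bar> powr q) * (if infdist (snd u) E \<le> fst u then 1 else 0) \<partial>half_space)"
      by (subst nn_integral_half_space) simp_all
    also have "ennreal c * (ennreal (1 / (s * q)) * (\<integral>\<^sup>+y. ennreal (infdist y E powr (- (s * q))) * enn_powr (?A0 y) q \<partial>lborel) + ennreal CH * \<dots>)
      \<le> ennreal c * (ennreal (1 / (s * q)) * (ennreal (K1 * \<alpha> powr (q - p)) * ?X) + ennreal CH * (ennreal (K2 * \<alpha> powr (q - p)) * ?X))"
      by (intro mult_left_mono add_mono K1 K2 L) auto
    also have "ennreal (1 / (s * q)) * (ennreal (K1 * \<alpha> powr (q - p)) * ?X) = ennreal (K1 / (s * q) * \<alpha> powr (q - p)) * ?X"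
      using s(2) q1 K1(1) by (intro ennreal_mult_mult) auto
    also have "ennreal CH * (ennreal (K2 * \<alpha> powr (q - p)) * ?X) = ennreal (CH * K2 * \<alpha> powr (q - p)) * ?X"
      using CH K2(1) by (intro ennreal_mult_mult) auto
    also have "ennreal (K1 / (s * q) * \<alpha> powr (q - p)) * ?X + ennreal (CH * K2 * \<alpha> powr (q - p)) * ?X = ennreal ((K1 / (s * q) + CH * K2) * \<alpha> powr (q - p)) * ?X"
      unfolding distrib_right[symmetric] using s(2) q1 K1(1) CH K2(1) by (subst ennreal_plus[symmetric]) (auto simp: distrib_right simp del: ennreal_plus)
    also have "ennreal c * (ennreal ((K1 / (s * q) + CH * K2) * \<alpha> powr (q - p)) * ?X) = ennreal (?K * \<alpha> powr (q - p)) * ?X"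
      using c s(2) q1 K1(1) CH K2(1) by (intro ennreal_mult_mult) auto
    finally show "(\<integral>\<^sup>+x. (\<integral>\<^sup>+y. ennreal (1 / norm (x - y) powr (real DIM('a) + s * q)) *
        enn_powr (\<integral>\<^sup>+t. ennreal (\<bar>Tp f t y / t\<bar> * t powr s) * (if 0 < t \<and> t < 2 * norm (x - y) then 1 else 0) \<partial>lborel) q \<partial>lborel) * indicator E x \<partial>lborel)
       \<le> ennreal (?K * \<alpha> powr (q - p)) * ?X"
      unfolding A_def .
  qed
qed

text \<open>Chebyshev's inequality, outer regularity and the covering bound for |f|^p at height
  \<alpha>^p. Removing whole balls with too large an average is what makes every ball that meets
  \<open>E\<close> good, whatever its centre.\<close>

lemma level_set_exists:
  fixes f :: "'a::euclidean_space \<Rightarrow> real"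
  assumes [measurable]: "f \<in> borel_measurable borel" and \<alpha>: "0 < \<alpha>"
    and I: "(\<integral>\<^sup>+z. ennreal (\<bar>f z\<bar> powr p) \<partial>lborel) = ennreal I" "0 < I" and p: "1 < p"
  obtains E where "level_set p f \<alpha> E"
proof -
  let ?A = "{x. \<alpha> < \<bar>f x\<bar>}"
  have A_meas [measurable]: "?A \<in> sets borel" by measurable
  have "emeasure lborel ?A = (\<integral>\<^sup>+z. indicator ?A z \<partial>lborel)"
    by simp
  also have "\<dots> \<le> (\<integral>\<^sup>+z. ennreal (\<alpha> powr (- p)) * ennreal (\<bar>f z\<bar> powr p) \<partial>lborel)"
  proof (intro nn_integral_mono)
    fix z
    have "1 \<le> \<alpha> powr (- p) * \<bar>f z\<bar> powr p" if "\<alpha> < \<bar>f z\<bar>"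
    proof -
      have "1 = \<alpha> powr (- p) * \<alpha> powr p"
        unfolding powr_add[symmetric] using \<alpha> by simp
      also have "\<dots> \<le> \<alpha> powr (- p) * \<bar>f z\<bar> powr p"
        using that \<alpha> p by (intro mult_left_mono powr_mono2) auto
      finally show ?thesis .
    qed
    then show "indicator ?A z \<le> ennreal (\<alpha> powr (- p)) * ennreal (\<bar>f z\<bar> powr p)"
      by (auto simp: indicator_def simp flip: ennreal_mult)
  qed
  also have "\<dots> = ennreal (\<alpha> powr (- p) * I)"
    using I by (subst nn_integral_cmult) (auto simp: ennreal_mult)
  finally have A: "emeasure lborel ?A \<le> ennreal (\<alpha> powr (- p) * I)" .
  \<comment> \<open>The permitted excess in outer regularity. It has the size of the Chebyshev bound
    itself, so \<open>U\<close> contributes 2 to the constant, and its positivity is the reason for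
    assuming I > 0.\<close>
  have e: "0 < \<alpha> powr (- p) * I" using \<alpha> I by simp
  obtain U where U: "open U" "?A \<subseteq> U" "emeasure lborel (U - ?A) < ennreal (\<alpha> powr (- p) * I)"
    using outer_regular_lborel[OF A_meas e] by blast
  let ?h = "\<lambda>z. ennreal (\<bar>f z\<bar> powr p)"
  define O1 where "O1 = \<Union>{ball c r |c r. 0 < r \<and> ennreal (\<alpha> powr p) * emeasure lborel (ball c r) < (\<integral>\<^sup>+z\<in>ball c r. ?h z \<partial>lborel)}"
  have O1: "open O1" unfolding O1_def by auto
  have "emeasure lborel O1 \<le> ennreal (5 ^ DIM('a) / \<alpha> powr p) * (\<integral>\<^sup>+z. ?h z \<partial>lborel)"
    unfolding O1_def using \<alpha> by (intro emeasure_large_average_balls_le) auto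
  also have "\<dots> = ennreal (5 ^ DIM('a) * (\<alpha> powr (- p) * I))"
    unfolding I(1) by (subst ennreal_mult[symmetric]) (use I(2) in \<open>auto simp: powr_minus_divide\<close>)
  finally have O1e: "emeasure lborel O1 \<le> ennreal (5 ^ DIM('a) * (\<alpha> powr (- p) * I))" .
  have "emeasure lborel (U \<union> O1) \<le> emeasure lborel (?A \<union> (U - ?A)) + emeasure lborel O1"
    using U O1 by (intro order_trans[OF emeasure_subadditive] add_mono emeasure_mono) auto
  also have "\<dots> \<le> (emeasure lborel ?A + emeasure lborel (U - ?A)) + emeasure lborel O1"
    using U by (intro add_right_mono emeasure_subadditive) auto
  also have "\<dots> \<le> (ennreal (\<alpha> powr (- p) * I) + ennreal (\<alpha> powr (- p) * I)) + ennreal (5 ^ DIM('a) * (\<alpha> powr (- p) * I))"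
    using U(3) by (intro add_mono A O1e) auto
  also have "\<dots> = ennreal ((5 ^ DIM('a) + 2) * \<alpha> powr (- p) * I)"
    using less_imp_le[OF e]
    by (simp only: ennreal_plus[symmetric] add_nonneg_nonneg mult_nonneg_nonneg zero_le_power zero_le_numeral) (simp add: algebra_simps)
  finally have O: "emeasure lborel (U \<union> O1) \<le> ennreal ((5 ^ DIM('a) + 2) * \<alpha> powr (- p) * I)" .
  show thesis
  proof (rule that)
    show "level_set p f \<alpha> (- (U \<union> O1))"
      unfolding level_set_def
    proof (intro conjI ballI allI impI)
      show "closed (- (U \<union> O1))" using U O1 by auto
      \<comment> \<open>The removed set has finite measure, so it cannot be the whole space.\<close>
      show "- (U \<union> O1) \<noteq> {}"
      proof
        assume "- (U \<union> O1) = {}"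
        then have "emeasure lborel (U \<union> O1) = emeasure lborel (UNIV :: 'a set)"
          by (intro arg_cong[where f = "emeasure lborel"]) auto
        then show False using O by (simp add: emeasure_lborel_UNIV top_unique)
      qed
      show "\<bar>f x\<bar> \<le> \<alpha>" if "x \<in> - (U \<union> O1)" for x
        using that U(2) by (meson ComplD UnI1 mem_Collect_eq not_le subsetD)
      show "emeasure lborel (- (- (U \<union> O1))) \<le> ennreal ((5 ^ DIM('a) + 2) * \<alpha> powr (- p)) * (\<integral>\<^sup>+z. ?h z \<partial>lborel)"
        using O I by (simp add: ennreal_mult'' del: ennreal_plus)
      fix x c r assume x: "x \<in> - (U \<union> O1)" "x \<in> ball c r"
      then have r: "0 < r" using zero_le_dist[of c x] unfolding mem_ball by linarith
      have "\<not> ennreal (\<alpha> powr p) * emeasure lborel (ball c r) < (\<integral>\<^sup>+z\<in>ball c r. ?h z \<partial>lborel)"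
      proof
        assume "ennreal (\<alpha> powr p) * emeasure lborel (ball c r) < (\<integral>\<^sup>+z\<in>ball c r. ?h z \<partial>lborel)"
        then have "x \<in> O1" unfolding O1_def using r x(2) by blast
        then show False using x by simp
      qed
      then show "(\<integral>\<^sup>+z\<in>ball c r. ?h z \<partial>lborel) \<le> ennreal (\<alpha> powr p * (unit_ball_vol (real DIM('a)) * r powr real DIM('a)))"
        using r by (simp add: not_less emeasure_ball powr_realpow ennreal_mult)
    qed (use assms in auto)
  qed
qed

theorem theorem5:
  fixes p q s :: real
  assumes "1 < p" "p < q" "2 \<le> q"
    and "s = real DIM('a::euclidean_space) * (1 / p - 1 / q)"
    and "0 < s" "s < 1"
  shows "\<exists>C. \<forall>(f :: 'a \<Rightarrow> real) (\<alpha>::real).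
           0 < \<alpha> \<longrightarrow> f \<in> borel_measurable lebesgue \<longrightarrow>
           integrable lebesgue (\<lambda>x. \<bar>f x\<bar> powr p) \<longrightarrow>
           lebesgue_outer {x. R_op s q f x > ennreal \<alpha>}
             \<le> ennreal (C * \<alpha> powr (- p) * (\<integral> x. \<bar>f x\<bar> powr p \<partial>lebesgue))"
proof -
  let ?N = "real DIM('a)"
  have q: "0 < q" using assms by simp
  obtain K where K: "0 < K" "\<And>(f::'a \<Rightarrow> real) \<alpha> E. level_set p f \<alpha> E \<Longrightarrow>
     (\<integral>\<^sup>+x. (\<integral>\<^sup>+y. ennreal (1 / norm (x - y) powr (real DIM('a) + s * q)) *
        enn_powr (\<integral>\<^sup>+t. ennreal (\<bar>Tp f t y / t\<bar> * t powr s) * (if 0 < t \<and> t < 2 * norm (x - y) then 1 else 0) \<partial>lborel) q \<partial>lborel) * indicator E x \<partial>lborel)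
       \<le> ennreal (K * \<alpha> powr (q - p)) * (\<integral>\<^sup>+z. ennreal (\<bar>f z\<bar> powr p) \<partial>lborel)"
    by (rule nn_integral_R_op_bound[OF assms(1-5)]) blast
  have main: "lebesgue_outer {x. R_op s q f x > ennreal \<alpha>} \<le> ennreal ((5 ^ DIM('a) + 2 + K) * \<alpha> powr (- p) * (\<integral> x. \<bar>f x\<bar> powr p \<partial>lebesgue))"
    if \<alpha>: "0 < \<alpha>" and f_meas: "f \<in> borel_measurable lebesgue" and f_int: "integrable lebesgue (\<lambda>x. \<bar>f x\<bar> powr p)" for f :: "'a \<Rightarrow> real" and \<alpha>
  proof -
    \<comment> \<open>A Borel representative makes all functions jointly Borel, as Tonelli on
      products of \<open>lborel\<close> requires. Changing f on a null set affects neither its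
      Poisson integral nor its norm.\<close>
    obtain f' where f': "f' \<in> borel_measurable lborel" "AE x in lborel. f x = f' x"
      using completion_ex_borel_measurable_real[OF f_meas] by blast
    have [measurable]: "f' \<in> borel_measurable borel" using f'(1) by simp
    have AE: "AE x in lebesgue. f x = f' x"
      using f'(2) by (rule AE_completion)
    have f'_leb: "g \<in> borel_measurable lebesgue" if "g \<in> borel_measurable borel" for g :: "'a \<Rightarrow> real"
      using that by (intro measurable_completion) simp
    define I where "I = (\<integral> x. \<bar>f x\<bar> powr p \<partial>lebesgue)"
    have I0: "0 \<le> I" unfolding I_def by simp
    have I: "(\<integral>\<^sup>+z. ennreal (\<bar>f' z\<bar> powr p) \<partial>lborel) = ennreal I"
    proof -
      have "(\<integral>\<^sup>+z. ennreal (\<bar>f' z\<bar> powr p) \<partial>lborel) = (\<integral>\<^sup>+z. ennreal (\<bar>f z\<bar> powr p) \<partial>lborel)"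
        using f'(2) by (intro nn_integral_cong_AE) (auto elim!: eventually_mono)
      also have "\<dots> = (\<integral>\<^sup>+z. ennreal (\<bar>f z\<bar> powr p) \<partial>lebesgue)"
        by (simp add: nn_integral_completion)
      also have "\<dots> = ennreal I"
        unfolding I_def by (rule nn_integral_eq_integral[OF f_int]) simp
      finally show ?thesis .
    qed
    have pi: "poisson_integral f y \<tau> = poisson_integral f' y \<tau>" for y \<tau>
      unfolding poisson_integral_def
    proof (rule integral_cong_AE)
      have k: "(\<lambda>z. poisson_kernel \<tau> (y - z)) \<in> borel_measurable lebesgue"
        by (rule f'_leb) measurable
      then show "(\<lambda>z. f z * poisson_kernel \<tau> (y - z)) \<in> borel_measurable lebesgue"
        using f_meas by (rule borel_measurable_times[rotated])
      show "(\<lambda>z. f' z * poisson_kernel \<tau> (y - z)) \<in> borel_measurable lebesgue"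
        by (rule f'_leb) measurable
      show "AE z in lebesgue. f z * poisson_kernel \<tau> (y - z) = f' z * poisson_kernel \<tau> (y - z)"
        using AE by (auto elim!: eventually_mono)
    qed
    show ?thesis
    \<comment> \<open>The set \<open>E\<close> is available only for I > 0. If I = 0, then f
      vanishes almost everywhere and so does the operator, identically.\<close>
    proof (cases "I = 0")
      case True
      have "(\<integral>\<^sup>+z. ennreal (\<bar>f' z\<bar> powr p) \<partial>lborel) = 0"
        using I True by simp
      then have "AE z in lborel. f' z = 0"
        by (subst (asm) nn_integral_0_iff_AE) (auto elim!: eventually_mono)
      then have "AE z in lebesgue. f' z = 0"
        by (rule AE_completion)
      then have "poisson_integral f' y \<tau> = 0" for y \<tau>
        unfolding poisson_integral_def by (intro integral_eq_zero_AE) (auto elim!: eventually_mono)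
      then have "R_op s q f x = 0" for x
        unfolding R_op_def pi using q by simp
      then have "lebesgue_outer {x. R_op s q f x > ennreal \<alpha>} \<le> emeasure lebesgue ({} :: 'a set)"
        unfolding lebesgue_outer_def by (intro INF_lower) auto
      then show ?thesis by simp
    next
      case False
      then have I1: "0 < I" using I0 by simp
      obtain E where L: "level_set p f' \<alpha> E"
        using level_set_exists[OF \<open>f' \<in> borel_measurable borel\<close> \<alpha> I I1 assms(1)] by blast
      have E_meas [measurable]: "E \<in> sets borel" using level_setD(3)[OF L] by simp
      define J where "J = (\<lambda>x. \<integral>\<^sup>+y. ennreal (1 / norm (x - y) powr (?N + s * q)) *
        enn_powr (\<integral>\<^sup>+t. ennreal (\<bar>Tp f' t y / t\<bar> * t powr s) * (if 0 < t \<and> t < 2 * norm (x - y) then 1 else 0) \<partial>lborel) q \<partial>lborel)"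
      have [measurable]: "J \<in> borel_measurable borel"
        unfolding J_def by measurable
      have R: "R_op s q f x = enn_powr (J x) (1 / q)" for x
      proof -
        have "(\<integral>\<^sup>+t\<in>{0<..<2 * norm (x - y)}. ennreal (\<bar>deriv (\<lambda>\<tau>. poisson_integral f y \<tau>) t\<bar> * t powr s) \<partial>lborel)
          = (\<integral>\<^sup>+t. ennreal (\<bar>Tp f' t y / t\<bar> * t powr s) * (if 0 < t \<and> t < 2 * norm (x - y) then 1 else 0) \<partial>lborel)" for y
          unfolding pi by (intro nn_integral_cong) (auto simp: indicator_def deriv_poisson_integral[OF L assms(1)])
        then show ?thesis
          unfolding R_op_def J_def by (simp add: nn_integral_completion)
      qed
      \<comment> \<open>A Borel set containing the superlevel set bounds its outer measure. Off
        \<open>E\<close> nothing is claimed about the operator; on \<open>E\<close> Chebyshev's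
        inequality with exponent q gives \<alpha>^(-q) \<alpha>^(q-p) = \<alpha>^(-p).\<close>
      define B where "B = - E \<union> {x \<in> E. ennreal (\<alpha> powr q) < J x}"
      have [measurable]: "B \<in> sets borel" unfolding B_def by measurable
      have "{x. R_op s q f x > ennreal \<alpha>} \<subseteq> B"
        unfolding R enn_powr_less_iff[OF q \<alpha>] B_def by auto
      then have "lebesgue_outer {x. R_op s q f x > ennreal \<alpha>} \<le> emeasure lebesgue B"
        unfolding lebesgue_outer_def by (intro INF_lower) auto
      also have "\<dots> = emeasure lborel B"
        by simp
      also have "\<dots> \<le> emeasure lborel (- E) + emeasure lborel {x \<in> E. ennreal (\<alpha> powr q) < J x}"
        unfolding B_def by (intro emeasure_subadditive) measurable
      also have "\<dots> \<le> ennreal ((5 ^ DIM('a) + 2) * \<alpha> powr (- p) * I) + ennreal (K * \<alpha> powr (- p) * I)"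
      proof (intro add_mono)
        show "emeasure lborel (- E) \<le> ennreal ((5 ^ DIM('a) + 2) * \<alpha> powr (- p) * I)"
          using level_setD(6)[OF L] I0 unfolding I by (simp add: ennreal_mult'' del: ennreal_plus)
        have "emeasure lborel {x \<in> E. ennreal (\<alpha> powr q) < J x} = (\<integral>\<^sup>+x. indicator {x \<in> E. ennreal (\<alpha> powr q) < J x} x \<partial>lborel)"
          by simp
        also have "\<dots> \<le> (\<integral>\<^sup>+x. ennreal (\<alpha> powr (- q)) * (J x * indicator E x) \<partial>lborel)"
        proof (intro nn_integral_mono)
          fix x
          have "1 \<le> ennreal (\<alpha> powr (- q)) * J x" if "ennreal (\<alpha> powr q) < J x"
          proof -
            have "\<alpha> powr (- q) * \<alpha> powr q = 1"
              unfolding powr_add[symmetric] using \<alpha> by simp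
            then have "1 = ennreal (\<alpha> powr (- q)) * ennreal (\<alpha> powr q)"
              by (simp flip: ennreal_mult)
            also have "\<dots> \<le> ennreal (\<alpha> powr (- q)) * J x"
              using that by (intro mult_left_mono) auto
            finally show ?thesis .
          qed
          then show "indicator {x \<in> E. ennreal (\<alpha> powr q) < J x} x \<le> ennreal (\<alpha> powr (- q)) * (J x * indicator E x)"
            by (auto simp: indicator_def)
        qed
        also have "\<dots> = ennreal (\<alpha> powr (- q)) * (\<integral>\<^sup>+x. J x * indicator E x \<partial>lborel)"
          by (rule nn_integral_cmult) measurable
        also have "\<dots> \<le> ennreal (\<alpha> powr (- q)) * (ennreal (K * \<alpha> powr (q - p)) * ennreal I)"
          using K(2)[OF L] unfolding I J_def by (intro mult_left_mono) auto
        also have "\<dots> = ennreal (K * \<alpha> powr (- p)) * ennreal I"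
        proof (rule ennreal_mult_mult)
          have "\<alpha> powr (- q) * \<alpha> powr (q - p) = \<alpha> powr (- p)"
            unfolding powr_add[symmetric] by simp
          then show "\<alpha> powr (- q) * (K * \<alpha> powr (q - p)) = K * \<alpha> powr (- p)"
            by (simp add: mult_ac)
        qed (use K(1) in auto)
        also have "\<dots> = ennreal (K * \<alpha> powr (- p) * I)"
          using I0 by (rule ennreal_mult''[symmetric])
        finally show "emeasure lborel {x \<in> E. ennreal (\<alpha> powr q) < J x} \<le> ennreal (K * \<alpha> powr (- p) * I)" .
      qed
      also have "\<dots> = ennreal ((5 ^ DIM('a) + 2 + K) * \<alpha> powr (- p) * I)"
        using K(1) I0 by (subst ennreal_plus[symmetric]) (auto simp: algebra_simps)
      finally show ?thesis unfolding I_def .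
    qed
  qed
  show ?thesis
    by (intro exI[of _ "5 ^ DIM('a) + 2 + K"] allI impI main)
qed

end
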